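(* Let $A$ be a (not necessarily bounded) normal operator in a complex Hilbert space $H$ and let $B\in B(H)$ be hyponormal. If $BA\subset AB$, then $$\big||A|-|B|\big|\leq |A-B|.$$
   Context: $B(H)$ is the algebra of bounded everywhere defined linear operators on $H$. Operators are linear, not necessarily bounded, defined on a subspace $D(T)$ of $H$. $S\subset T$ means $D(S)\subset D(T)$ and $S=T$ on $D(S)$. Natural domains are used: $D(ST)=\{x\in D(T): Tx\in D(S)\}$, $D(S\pm T)=D(S)\cap D(T)$. A densely defined operator $T$ is normal if it is closed and $TT^*=T^*T$. A densely defined operator $T$ is hyponormal if $D(T)\subset D(T^* )$ and $\|T^*x\|\le\|Tx\|$ for all $x\in D(T)$. For a closed densely defined operator $T$, $|T|$ denotes the unique positive self-adjoint square root of $T^*T$. For positive self-adjoint operators $S,T$ (possibly unbounded), $T\le S$ means $D(S^{1/2})\subset D(T^{1/2})$ and $\|T^{1/2}x\|\le\|S^{1/2}x\|$ for all $x\in D(S^{1/2})$. *)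

theory Defs
  imports "HOL-Analysis.Analysis"
begin

text \<open>
  A complex inner product space is viewed at the same time as a real inner product space with
  \<open>inner x y = Re \<langle>x, y\<rangle>\<close>; positive definiteness and the formula for the norm are thereby
  inherited from \<^class>\<open>real_inner\<close>. The form is linear in the first argument.
\<close>

class complex_inner = real_inner +
  fixes scaleC :: "complex \<Rightarrow> 'a \<Rightarrow> 'a"  (infixr \<open>*\<^sub>C\<close> 75)
    and cinner :: "'a \<Rightarrow> 'a \<Rightarrow> complex"
  assumes scaleC_add_right: "a *\<^sub>C (x + y) = a *\<^sub>C x + a *\<^sub>C y"
    and scaleC_add_left: "(a + b) *\<^sub>C x = a *\<^sub>C x + b *\<^sub>C x"
    and scaleC_scaleC: "a *\<^sub>C b *\<^sub>C x = (a * b) *\<^sub>C x"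
    and scaleR_scaleC: "r *\<^sub>R x = complex_of_real r *\<^sub>C x"
    and cinner_commute: "cinner x y = cnj (cinner y x)"
    and cinner_add_left: "cinner (x + y) z = cinner x z + cinner y z"
    and cinner_scaleC_left: "cinner (a *\<^sub>C x) y = a * cinner x y"
    and inner_eq_Re_cinner: "inner x y = Re (cinner x y)"

class chilbert_space = complex_inner + complete_space

text \<open>
  An operator is a partial function, with \<open>dom T\<close> as its domain. Thus \<open>=\<close> is equality including
  domains, \<open>S \<subseteq>\<^sub>m T\<close> says that \<open>T\<close> extends \<open>S\<close>, and \<open>S \<circ>\<^sub>m T\<close> is the product \<open>ST\<close> on its natural
  domain.
\<close>

type_synonym 'a operator = "'a \<rightharpoonup> 'a"

definition linear_op :: "'a::complex_inner operator \<Rightarrow> bool" where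
  "linear_op T \<longleftrightarrow>
     T 0 = Some 0 \<and>
     (\<forall>x y u v. T x = Some u \<longrightarrow> T y = Some v \<longrightarrow> T (x + y) = Some (u + v)) \<and>
     (\<forall>c x u. T x = Some u \<longrightarrow> T (c *\<^sub>C x) = Some (c *\<^sub>C u))"

definition bounded_op :: "'a::complex_inner operator \<Rightarrow> bool" where
  "bounded_op T \<longleftrightarrow>
     linear_op T \<and> dom T = UNIV \<and> (\<exists>K. \<forall>x. norm (the (T x)) \<le> K * norm x)"

definition op_diff :: "'a::complex_inner operator \<Rightarrow> 'a operator \<Rightarrow> 'a operator"
    (infixl \<open>-\<^sub>o\<close> 65) where
  "S -\<^sub>o T = (\<lambda>x. if x \<in> dom S \<inter> dom T then Some (the (S x) - the (T x)) else None)"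

definition densely_defined :: "'a::complex_inner operator \<Rightarrow> bool" where
  "densely_defined T \<longleftrightarrow> linear_op T \<and> closure (dom T) = UNIV"

definition closed_op :: "'a::complex_inner operator \<Rightarrow> bool" where
  "closed_op T \<longleftrightarrow> linear_op T \<and> closed {(x, y). T x = Some y}"

text \<open>Only meaningful for densely defined \<open>T\<close>, where the vector \<open>z\<close> is unique.\<close>

definition op_adjoint :: "'a::complex_inner operator \<Rightarrow> 'a operator" where
  "op_adjoint T = (\<lambda>y.
     if \<exists>z. \<forall>x\<in>dom T. cinner (the (T x)) y = cinner x z
     then Some (THE z. \<forall>x\<in>dom T. cinner (the (T x)) y = cinner x z)
     else None)"

definition normal_op :: "'a::complex_inner operator \<Rightarrow> bool" where
  "normal_op T \<longleftrightarrow>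
     densely_defined T \<and> closed_op T \<and> T \<circ>\<^sub>m op_adjoint T = op_adjoint T \<circ>\<^sub>m T"

definition hyponormal_op :: "'a::complex_inner operator \<Rightarrow> bool" where
  "hyponormal_op T \<longleftrightarrow>
     densely_defined T \<and> dom T \<subseteq> dom (op_adjoint T) \<and>
     (\<forall>x\<in>dom T. norm (the (op_adjoint T x)) \<le> norm (the (T x)))"

definition selfadjoint_op :: "'a::complex_inner operator \<Rightarrow> bool" where
  "selfadjoint_op T \<longleftrightarrow> densely_defined T \<and> op_adjoint T = T"

definition pos_selfadjoint_op :: "'a::complex_inner operator \<Rightarrow> bool" where
  "pos_selfadjoint_op T \<longleftrightarrow>
     selfadjoint_op T \<and> (\<forall>x\<in>dom T. cinner (the (T x)) x \<in> \<real>\<^sub>\<ge>\<^sub>0)"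

definition op_sqrt :: "'a::complex_inner operator \<Rightarrow> 'a operator" where
  "op_sqrt T = (THE R. pos_selfadjoint_op R \<and> R \<circ>\<^sub>m R = T)"

definition op_abs :: "'a::complex_inner operator \<Rightarrow> 'a operator" where
  "op_abs T = op_sqrt (op_adjoint T \<circ>\<^sub>m T)"

text \<open>
  The order is a relation between positive self-adjoint operators only, so that nothing is
  asserted about the unspecified values of \<^const>\<open>op_sqrt\<close> outside its intended domain.
\<close>

definition op_le :: "'a::complex_inner operator \<Rightarrow> 'a operator \<Rightarrow> bool"
    (infix \<open>\<le>\<^sub>o\<close> 50) where
  "T \<le>\<^sub>o S \<longleftrightarrow>
     pos_selfadjoint_op T \<and> pos_selfadjoint_op S \<and>
     dom (op_sqrt S) \<subseteq> dom (op_sqrt T) \<and>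
     (\<forall>x\<in>dom (op_sqrt S). norm (the (op_sqrt T x)) \<le> norm (the (op_sqrt S x)))"

end

theory Submission
  imports Defs
begin

text \<open>
  For \<open>x\<close> in the common domain of \<open>A\<close> and \<open>|A|\<close>, expand \<open>\<parallel>|A|x - |B|x\<parallel>\<^sup>2\<close> and
  \<open>\<parallel>Ax - Bx\<parallel>\<^sup>2\<close>. The squares agree because \<open>\<parallel>|T|x\<parallel> = \<parallel>Tx\<parallel>\<close>, so
  \<open>\<parallel>(|A| - |B|)x\<parallel> \<le> \<parallel>(A - B)x\<parallel>\<close> comes down to the comparison of the mixed terms,
  \<open>Re \<langle>Ax, Bx\<rangle> \<le> \<langle>|A|x, |B|x\<rangle>\<close>. The order between the moduli then follows from the norm
  inequality by operator monotonicity of the square root.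

  Both steps rest on one form of the Heinz inequality, \<open>heinz_form\<close>: if \<open>L\<close> is positive
  self-adjoint, \<open>K\<close> is symmetric and \<open>\<parallel>Kx\<parallel> \<le> \<parallel>Lx\<parallel>\<close> on the domain of \<open>L\<close>, then
  \<open>\<langle>Kx, x\<rangle> \<le> \<langle>Lx, x\<rangle>\<close>. Indeed \<open>\<kappa> = K(1 + L)\<^sup>-\<^sup>1\<close> is a contraction which is symmetric for the
  positive form \<open>\<langle>x, (1 + L)\<^sup>-\<^sup>1 y\<rangle>\<close>; the form norms of the iterates of \<open>\<kappa>\<close> are therefore
  log-convex and bounded, hence cannot grow, and this says \<open>K \<le> 1 + L\<close>. Replacing \<open>K, L\<close> by
  \<open>tK, tL\<close> and letting \<open>t\<close> tend to infinity removes the \<open>1\<close>.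

  For the mixed terms put \<open>S = (1 + A*A)\<^sup>-\<^sup>1\<^sup>/\<^sup>2\<close>, so that \<open>Z = AS\<close> and \<open>C = |A|S\<close> are bounded and
  the domain of \<open>A\<close> is the range of \<open>S\<close>. If \<open>B\<close> commutes with \<open>S\<close> and \<open>C\<close>, then
  hyponormality gives \<open>\<parallel>SB*Zw\<parallel> \<le> \<parallel>BZSw\<parallel> = \<parallel>ZBSw\<parallel> = \<parallel>CBSw\<parallel> = \<parallel>|B|CSw\<parallel>\<close>, and normality
  gives \<open>\<parallel>Z*BSw\<parallel> = \<parallel>ZBSw\<parallel>\<close>. So the symmetric operator \<open>K = Re (SB*Z)\<close> is dominated in norm
  by \<open>L = |B|CS\<close>, which is positive as a product of commuting positive operators, and
  \<open>heinz_form\<close> yields \<open>\<langle>Kw, w\<rangle> \<le> \<langle>Lw, w\<rangle>\<close>: this is the comparison of the mixed terms at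
  \<open>x = Sw\<close> (\<open>abs_form_inequality\<close>).

  That \<open>B\<close> commutes with \<open>S\<close> and \<open>C\<close> is the part of Fuglede's theorem which concerns \<open>|A|\<close>
  (\<open>fuglede_abs\<close>). Since \<open>\<parallel>A\<^sup>n x\<parallel> = \<parallel>|A|\<^sup>n x\<parallel>\<close>, the spectral subspace of \<open>|A|\<close> for
  \<open>[0, r]\<close> consists of the vectors with \<open>\<parallel>A\<^sup>n x\<parallel> = O(r\<^sup>n)\<close>, and \<open>BA \<subseteq> AB\<close> shows that \<open>B\<close>
  preserves this growth condition. So does \<open>B*\<close>, because \<open>B*A* \<subseteq> A*B*\<close> and \<open>|A*| = |A|\<close>.
  Hence \<open>B\<close> commutes with the spectral projections of \<open>|A|\<close>, and with \<open>|A|\<close> itself by cutting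
  the spectrum into small pieces.

  The argument only sees \<open>Re \<langle>x, y\<rangle>\<close>, so it is carried out in real Hilbert spaces. An unbounded
  operator is represented by its graph, a closed subspace of \<open>H \<times> H\<close>; adjoints and products of
  such linear relations come without domain conditions. Positive self-adjoint \<open>L\<close> are
  parametrised as \<open>{(S\<^sup>2 w, C\<^sup>2 w)}\<close> with bounded positive \<open>S, C\<close> such that \<open>S\<^sup>2 + C\<^sup>2 = 1\<close>, and
  their square roots as \<open>{(Sw, Cw)}\<close>.
\<close>

section \<open>Orthogonal projections\<close>

text \<open>
  By the parallelogram law a minimising sequence for the distance of \<open>x\<close> to \<open>M\<close> is Cauchy; its
  limit is the foot of the perpendicular.
\<close>

lemma orthogonal_projection_exists:
  fixes M :: "'a::{real_inner,complete_space} set"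
  assumes M: "closed M" "subspace M"
  shows "\<exists>p\<in>M. \<forall>m\<in>M. inner (x - p) m = 0"
proof -
  define d where "d = infdist x M"
  have ne: "M \<noteq> {}" using subspace_0[OF M(2)] by auto
  have d_le: "d \<le> norm (x - m)" if "m \<in> M" for m
    using infdist_le[OF that, of x] by (simp add: d_def dist_norm)
  have d0: "0 \<le> d" by (simp add: d_def infdist_nonneg)
  have "\<exists>m\<in>M. norm (x - m) < d + inverse (real (Suc n))" for n
  proof -
    have "d < d + inverse (real (Suc n))" by simp
    moreover have "bdd_below ((\<lambda>m. dist x m) ` M)" by (rule bdd_belowI2[where m = 0]) simp
    ultimately show ?thesis
      using cINF_less_iff[of M "\<lambda>m. dist x m" "d + inverse (real (Suc n))"] ne
      by (simp add: d_def infdist_def dist_norm)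
  qed
  then obtain f where fM: "\<And>n. f n \<in> M" and f: "\<And>n. norm (x - f n) < d + inverse (real (Suc n))"
    by metis
  have par: "(norm (f m - f n))\<^sup>2 \<le> 2 * (norm (x - f m))\<^sup>2 + 2 * (norm (x - f n))\<^sup>2 - 4 * d\<^sup>2" for m n
  proof -
    have "(1/2) *\<^sub>R (f m + f n) \<in> M" using fM M(2) by (simp add: subspace_add subspace_mul)
    from power_mono[OF d_le[OF this] d0, of 2]
    have "4 * d\<^sup>2 \<le> 4 * (norm (x - (1/2) *\<^sub>R (f m + f n)))\<^sup>2" by simp
    also have "\<dots> = (norm ((x - f m) + (x - f n)))\<^sup>2"
    proof -
      have "(x - f m) + (x - f n) = 2 *\<^sub>R (x - (1/2) *\<^sub>R (f m + f n))"
        by (simp add: algebra_simps flip: scaleR_2)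
      then show ?thesis by (simp add: power_mult_distrib)
    qed
    also have "\<dots> = 2 * (norm (x - f m))\<^sup>2 + 2 * (norm (x - f n))\<^sup>2 - (norm (f m - f n))\<^sup>2"
      by (simp add: power2_norm_eq_inner inner_diff inner_add inner_commute)
    finally show ?thesis by simp
  qed
  have lim: "(\<lambda>n. norm (x - f n)) \<longlonglongrightarrow> d"
  proof (rule real_tendsto_sandwich[of "\<lambda>_. d" _ _ "\<lambda>n. d + inverse (real (Suc n))"])
    show "(\<lambda>n. d + inverse (real (Suc n))) \<longlonglongrightarrow> d"
      using tendsto_add[OF tendsto_const LIMSEQ_inverse_real_of_nat, of d] by simp
  qed (use d_le fM less_imp_le[OF f] in auto)
  have "Cauchy f"
  proof (rule metric_CauchyI)
    fix e :: real assume "e > 0"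
    have "(\<lambda>n. (norm (x - f n))\<^sup>2) \<longlonglongrightarrow> d\<^sup>2" by (intro tendsto_intros lim)
    moreover have "d\<^sup>2 < d\<^sup>2 + e\<^sup>2 / 4" using \<open>e > 0\<close> by simp
    ultimately have "\<forall>\<^sub>F n in sequentially. (norm (x - f n))\<^sup>2 < d\<^sup>2 + e\<^sup>2 / 4"
      by (rule order_tendstoD(2))
    then obtain N where N: "\<And>n. n \<ge> N \<Longrightarrow> (norm (x - f n))\<^sup>2 < d\<^sup>2 + e\<^sup>2 / 4"
      by (auto simp: eventually_sequentially)
    have "dist (f m) (f n) < e" if "m \<ge> N" "n \<ge> N" for m n
    proof -
      have "(norm (f m - f n))\<^sup>2 < e\<^sup>2" using par[of m n] N[OF that(1)] N[OF that(2)] by simp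
      then show ?thesis using \<open>e > 0\<close> by (simp add: dist_norm power2_less_imp_less)
    qed
    then show "\<exists>N. \<forall>m\<ge>N. \<forall>n\<ge>N. dist (f m) (f n) < e" by blast
  qed
  then obtain p where p: "f \<longlonglongrightarrow> p" using Cauchy_convergent_iff convergent_def by blast
  have pM: "p \<in> M" using closed_sequentially[OF M(1)] fM p by blast
  have np: "norm (x - p) = d"
    using LIMSEQ_unique[OF lim tendsto_norm[OF tendsto_diff[OF tendsto_const p]]] by simp
  have "inner (x - p) m = 0" if "m \<in> M" for m
  proof (rule ccontr)
    assume nz: "inner (x - p) m \<noteq> 0"
    define t where "t = inner (x - p) m / inner m m"
    have mm: "inner m m > 0" using nz by auto
    have "p + t *\<^sub>R m \<in> M" using pM that M(2) by (simp add: subspace_add subspace_mul)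
    from power_mono[OF d_le[OF this] d0, of 2]
    have "(norm (x - p))\<^sup>2 \<le> (norm (x - p - t *\<^sub>R m))\<^sup>2" by (simp add: np diff_diff_eq)
    also have "\<dots> = (norm (x - p))\<^sup>2 - 2 * t * inner (x - p) m + t\<^sup>2 * inner m m"
      unfolding power2_norm_eq_inner
      by (simp add: inner_diff_left inner_diff_right inner_commute power2_eq_square algebra_simps)
    also have "\<dots> = (norm (x - p))\<^sup>2 - (inner (x - p) m)\<^sup>2 / inner m m"
      using mm by (simp add: t_def field_simps power2_eq_square)
    finally have "(inner (x - p) m)\<^sup>2 / inner m m \<le> 0" by simp
    moreover have "0 < (inner (x - p) m)\<^sup>2 / inner m m" using nz mm by simp
    ultimately show False by simp
  qed
  with pM show ?thesis by blast
qed

lemma subspace_closure: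
  fixes M :: "'a::real_normed_vector set"
  assumes "subspace M" shows "subspace (closure M)"
proof (rule subspaceI)
  show "0 \<in> closure M" using subspace_0[OF assms] closure_subset by blast
next
  fix x y assume "x \<in> closure M" "y \<in> closure M"
  then obtain f g where "\<And>n. f n \<in> M" "f \<longlonglongrightarrow> x" "\<And>n. g n \<in> M" "g \<longlonglongrightarrow> y"
    unfolding closure_sequential by blast
  then have "\<And>n. f n + g n \<in> M" "(\<lambda>n. f n + g n) \<longlonglongrightarrow> x + y"
    by (auto intro: subspace_add[OF assms] tendsto_add)
  then show "x + y \<in> closure M" unfolding closure_sequential by fast
next
  fix c x assume "x \<in> closure M"
  then obtain f where "\<And>n. f n \<in> M" "f \<longlonglongrightarrow> x"
    unfolding closure_sequential by blast
  then have "\<And>n. c *\<^sub>R f n \<in> M" "(\<lambda>n. c *\<^sub>R f n) \<longlonglongrightarrow> c *\<^sub>R x"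
    by (auto intro: subspace_mul[OF assms] tendsto_scaleR)
  then show "c *\<^sub>R x \<in> closure M" unfolding closure_sequential by fast
qed

lemma dense_subspaceI:
  fixes M :: "'a::{real_inner,complete_space} set"
  assumes "subspace M" and orth: "\<And>z. (\<And>m. m \<in> M \<Longrightarrow> inner z m = 0) \<Longrightarrow> z = 0"
  shows "closure M = UNIV"
proof -
  have "x \<in> closure M" for x
  proof -
    have "closed (closure M)" "subspace (closure M)"
      using assms(1) by (auto intro: subspace_closure)
    from orthogonal_projection_exists[OF this, of x]
    obtain p where p: "p \<in> closure M" "\<And>m. m \<in> closure M \<Longrightarrow> inner (x - p) m = 0" by blast
    have "x - p = 0" using p(2) closure_subset by (intro orth) blast
    with p(1) show ?thesis by simp
  qed
  then show ?thesis by blast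
qed

lemma closed_linear_eqI:
  fixes f g :: "'a::real_normed_vector \<Rightarrow> 'b::real_normed_vector"
  assumes "closure M = UNIV" "bounded_linear f" "bounded_linear g" "\<And>m. m \<in> M \<Longrightarrow> f m = g m"
  shows "f x = g x"
proof -
  have "closed {x. f x = g x}"
    using assms(2,3) by (intro closed_Collect_eq continuous_intros) (auto simp: linear_continuous_on)
  then have "closure M \<subseteq> {x. f x = g x}" using assms(4) by (intro closure_minimal) auto
  with assms(1) show ?thesis by auto
qed

section \<open>Bounded positive maps\<close>

definition sym_map :: "('a::real_inner \<Rightarrow> 'a) \<Rightarrow> bool" where
  "sym_map f \<longleftrightarrow> bounded_linear f \<and> (\<forall>x y. inner (f x) y = inner x (f y))"

definition pos_map :: "('a::real_inner \<Rightarrow> 'a) \<Rightarrow> bool" where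
  "pos_map f \<longleftrightarrow> sym_map f \<and> (\<forall>x. 0 \<le> inner (f x) x)"

text \<open>
  Invariance of a graph under \<open>f \<times> f\<close> says that \<open>f\<close> commutes with the (possibly unbounded)
  operator: \<open>fX \<subseteq> Xf\<close>.
\<close>

definition invariant :: "('a \<times> 'a) set \<Rightarrow> ('a \<Rightarrow> 'a) \<Rightarrow> bool" where
  "invariant X f \<longleftrightarrow> (\<forall>x y. (x, y) \<in> X \<longrightarrow> (f x, f y) \<in> X)"

text \<open>
  A bicommutant condition: whatever commutes with \<open>T\<close>, including closed unbounded operators,
  commutes with \<open>f\<close>. It holds for square roots and spectral projections of \<open>T\<close> and takes the
  place of a functional calculus.
\<close>

definition function_of :: "('a::real_normed_vector \<Rightarrow> 'a) \<Rightarrow> ('a \<Rightarrow> 'a) \<Rightarrow> bool" where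
  "function_of T f \<longleftrightarrow> (\<forall>X. closed X \<longrightarrow> subspace X \<longrightarrow> invariant X T \<longrightarrow> invariant X f)"

lemma sym_mapD:
  assumes "sym_map f"
  shows sym_map_linear: "bounded_linear f" and sym_map_inner: "inner (f x) y = inner x (f y)"
  using assms by (auto simp: sym_map_def)

lemma pos_mapD:
  assumes "pos_map f"
  shows pos_map_sym: "sym_map f" and pos_map_linear: "bounded_linear f"
    and pos_map_inner: "inner (f x) y = inner x (f y)"
    and pos_map_nonneg: "0 \<le> inner (f x) x"
  using assms by (auto simp: sym_map_def pos_map_def)

lemma function_of_trans: "function_of T f \<Longrightarrow> function_of f g \<Longrightarrow> function_of T g"
  by (auto simp: function_of_def)

lemma closed_graph_bounded_linear:
  fixes f :: "'a::real_normed_vector \<Rightarrow> 'b::real_normed_vector"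
  assumes "bounded_linear f" shows "closed (range (\<lambda>x. (x, f x)))"
proof -
  have "range (\<lambda>x. (x, f x)) = {z. snd z = f (fst z)}" by auto
  moreover have "closed {z. snd z = f (fst z)}"
    by (intro closed_Collect_eq continuous_intros bounded_linear.continuous_on[OF assms])
  ultimately show ?thesis by simp
qed

lemma subspace_range_pair:
  assumes "linear f" "linear g" shows "subspace (range (\<lambda>x. (f x, g x)))"
proof -
  have "linear (\<lambda>x. (f x, g x))"
    using assms by (intro linearI) (simp_all add: linear_add linear_scale)
  from linear_subspace_image[OF this subspace_UNIV] show ?thesis .
qed

lemma function_of_commute:
  assumes "function_of T f" "bounded_linear B" "\<And>x. B (T x) = T (B x)"
  shows "B (f x) = f (B x)"
proof -
  let ?X = "range (\<lambda>x. (x, B x))"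
  have "subspace ?X"
    using subspace_range_pair[OF linear_ident bounded_linear.linear[OF assms(2)]] .
  moreover have "invariant ?X T" using assms(3) by (auto simp: invariant_def)
  ultimately have "invariant ?X f"
    using assms(1) closed_graph_bounded_linear[OF assms(2)] by (auto simp: function_of_def)
  then have "(f x, f (B x)) \<in> ?X" by (simp add: invariant_def)
  then show ?thesis by auto
qed

lemma pos_map_Cauchy_Schwarz:
  assumes "pos_map f"
  shows "(inner (f x) y)\<^sup>2 \<le> inner (f x) x * inner (f y) y"
proof -
  interpret bounded_linear f by (rule pos_map_linear[OF assms])
  have q: "0 \<le> inner (f x) x * t\<^sup>2 + 2 * inner (f x) y * t + inner (f y) y" for t
  proof -
    have "0 \<le> inner (f (t *\<^sub>R x + y)) (t *\<^sub>R x + y)" by (rule pos_map_nonneg[OF assms])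
    also have "\<dots> = inner (f x) x * t\<^sup>2 + 2 * inner (f x) y * t + inner (f y) y"
      using pos_map_inner[OF assms, of y x] 
      by (simp add: add scaleR inner_add power2_eq_square inner_commute algebra_simps)
    finally show ?thesis .
  qed
  show ?thesis
  proof (cases "inner (f x) x = 0")
    case True
    have "inner (f x) y = 0"
    proof (rule ccontr)
      assume "inner (f x) y \<noteq> 0"
      then show False
        using q[of "- (inner (f y) y + 1) / (2 * inner (f x) y)"] True by (simp add: field_simps)
    qed
    then show ?thesis by (simp add: True)
  next
    case False
    then have p: "inner (f x) x > 0" using pos_map_nonneg[OF assms, of x] by simp
    show ?thesis
      using q[of "- inner (f x) y / inner (f x) x"] p
      by (simp add: field_simps power2_eq_square)
  qed
qed

lemma pos_map_eq_0:
  assumes "pos_map f" "inner (f x) x = 0" shows "f x = 0"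
  using pos_map_Cauchy_Schwarz[OF assms(1), of x "f x"] assms(2) by simp

lemma pos_map_norm_le:
  assumes "pos_map f" "\<And>x. inner (f x) x \<le> d * inner x x"
  shows "norm (f x) \<le> d * norm x"
proof (cases "f x = 0")
  case True
  have "0 \<le> d * norm x"
  proof (cases "x = 0")
    case False
    have "0 \<le> d * inner x x" using assms pos_map_nonneg order_trans by metis
    moreover have "0 < inner x x" using False by simp
    ultimately have "0 \<le> d" by (metis linorder_not_less mult_neg_pos)
    then show ?thesis by simp
  qed simp
  with True show ?thesis by simp
next
  case False
  have "(inner (f x) (f x))\<^sup>2 \<le> inner (f x) x * inner (f (f x)) (f x)"
    by (rule pos_map_Cauchy_Schwarz[OF assms(1)])
  also have "\<dots> \<le> (d * inner x x) * (d * inner (f x) (f x))"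
    using assms pos_map_nonneg[OF assms(1)] order_trans by (intro mult_mono) blast+
  finally have "inner (f x) (f x) * inner (f x) (f x) \<le> (d\<^sup>2 * inner x x) * inner (f x) (f x)"
    by (simp add: power2_eq_square mult_ac)
  then have "inner (f x) (f x) \<le> d\<^sup>2 * inner x x" using False by (subst (asm) mult_le_cancel_right) auto
  then have le: "(norm (f x))\<^sup>2 \<le> (d * norm x)\<^sup>2" by (simp add: power2_norm_eq_inner power_mult_distrib)
  have "0 < inner (f x) (f x)" using False by simp
  then have "x \<noteq> 0" using assms(1) by (auto simp: bounded_linear.linear linear_0 pos_map_linear)
  have "0 \<le> d * inner x x" using assms pos_map_nonneg order_trans by metis
  moreover have "0 < inner x x" using \<open>x \<noteq> 0\<close> by simp
  ultimately have "0 \<le> d * norm x" by (meson linorder_not_less mult_neg_pos mult_nonneg_nonneg norm_ge_zero)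
  with le show ?thesis by (rule power2_le_imp_le)
qed


lemma invariant_const_0: "subspace X \<Longrightarrow> invariant X (\<lambda>x. 0)"
  using subspace_0[of X] by (simp add: invariant_def zero_prod_def)

lemma invariant_id: "invariant X (\<lambda>x. x)"
  by (simp add: invariant_def)

lemma invariant_compose: "invariant X f \<Longrightarrow> invariant X g \<Longrightarrow> invariant X (\<lambda>x. f (g x))"
  by (simp add: invariant_def)

lemma invariant_add:
  "subspace X \<Longrightarrow> invariant X f \<Longrightarrow> invariant X g \<Longrightarrow> invariant X (\<lambda>x. f x + g x)"
  using subspace_add[of X] by (fastforce simp: invariant_def)

lemma invariant_diff:
  "subspace X \<Longrightarrow> invariant X f \<Longrightarrow> invariant X g \<Longrightarrow> invariant X (\<lambda>x. f x - g x)"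
  using subspace_diff[of X] by (fastforce simp: invariant_def)

lemma invariant_scaleR: "subspace X \<Longrightarrow> invariant X f \<Longrightarrow> invariant X (\<lambda>x. c *\<^sub>R f x)"
  using subspace_mul[of X] by (fastforce simp: invariant_def)

lemma invariant_limit:
  assumes "closed X" "\<And>n. invariant X (f n)" "\<And>x. (\<lambda>n. f n x) \<longlonglongrightarrow> g x"
  shows "invariant X g"
  unfolding invariant_def
proof (intro allI impI)
  fix x y assume "(x, y) \<in> X"
  then have *: "(f n x, f n y) \<in> X" for n using assms(2) by (auto simp: invariant_def)
  have "(\<lambda>n. (f n x, f n y)) \<longlonglongrightarrow> (g x, g y)" by (intro tendsto_Pair assms(3))
  from closed_sequentially[OF assms(1) * this] show "(g x, g y) \<in> X" .
qed

text \<open>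
  If \<open>Q = 1 - T\<close> is a contraction, then \<open>1 - Y\<close> is a square root of \<open>T\<close> exactly when
  \<open>Y = (Q + Y\<^sup>2) / 2\<close>, and this fixed point is the limit of the iteration from \<open>Y = 0\<close>. The numbers
  below run through the same iteration with \<open>Q\<close> replaced by \<open>1\<close>, and they dominate the operator
  iterates and their differences in norm. Convergence thus follows from that of a bounded
  monotone sequence of reals.
\<close>

primrec sqrt_majorant :: "nat \<Rightarrow> real" where
  "sqrt_majorant 0 = 0"
| "sqrt_majorant (Suc n) = (1 + (sqrt_majorant n)\<^sup>2) / 2"

lemma sqrt_majorant_bounds: "0 \<le> sqrt_majorant n \<and> sqrt_majorant n \<le> 1"
proof (induction n)
  case (Suc n)
  then have "(sqrt_majorant n)\<^sup>2 \<le> 1" by (simp add: power_le_one)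
  then show ?case by simp
qed simp

lemma sqrt_majorant_mono: "sqrt_majorant n \<le> sqrt_majorant (Suc n)"
  using zero_le_power2[of "1 - sqrt_majorant n"] by (simp add: power2_eq_square algebra_simps)

lemma convergent_sqrt_majorant: "convergent sqrt_majorant"
proof (rule Bseq_mono_convergent)
  show "Bseq sqrt_majorant" using sqrt_majorant_bounds by (intro BseqI'[of _ 1]) auto
  show "\<forall>m. \<forall>n\<ge>m. sqrt_majorant m \<le> sqrt_majorant n"
    using lift_Suc_mono_le[of sqrt_majorant] sqrt_majorant_mono by blast
qed

primrec sqrt_iter :: "('a::real_vector \<Rightarrow> 'a) \<Rightarrow> nat \<Rightarrow> 'a \<Rightarrow> 'a" where
  "sqrt_iter Q 0 = (\<lambda>x. 0)"
| "sqrt_iter Q (Suc n) = (\<lambda>x. (1/2) *\<^sub>R (Q x + sqrt_iter Q n (sqrt_iter Q n x)))"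

text \<open>
  The iterates are built from \<open>T\<close> by sums and products, so they leave invariant what \<open>T\<close> leaves
  invariant, and closedness passes this on to the limit. Positivity of \<open>1 - Y\<close> is just
  \<open>\<parallel>Y\<parallel> \<le> 1\<close>.
\<close>

lemma sqrt_contraction:
  fixes T :: "'a::{real_inner,complete_space} \<Rightarrow> 'a"
  assumes T: "pos_map T" and le1: "\<And>x. T x \<bullet> x \<le> x \<bullet> x"
  shows "\<exists>S. pos_map S \<and> (\<forall>x. S (S x) = T x) \<and> function_of T S"
proof -
  interpret T: bounded_linear T by (rule pos_map_linear[OF T])
  define Q where "Q x = x - T x" for x
  have Q_lin: "linear Q"
    unfolding Q_def by (intro linearI) (simp_all add: T.add T.scaleR algebra_simps)
  have Q_le: "norm (Q x) \<le> norm x" for x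
  proof -
    have "norm (Q x) \<le> 1 * norm x"
    proof (rule pos_map_norm_le)
      have "bounded_linear Q"
        unfolding Q_def by (intro bounded_linear_sub T.bounded_linear_axioms bounded_linear_ident)
      then show "pos_map Q"
        using le1 pos_map_inner[OF T] by (simp add: pos_map_def sym_map_def Q_def inner_diff)
      show "Q x \<bullet> x \<le> 1 * (x \<bullet> x)" for x
        using pos_map_nonneg[OF T, of x] by (simp add: Q_def inner_diff)
    qed
    then show ?thesis by simp
  qed
  let ?q = sqrt_majorant and ?Y = "sqrt_iter Q"
  have lin: "linear (?Y n)" for n
  proof (induction n)
    case (Suc n)
    then show ?case
      using Q_lin by (intro linearI) (simp_all add: linear_add linear_scale algebra_simps)
  qed (simp add: linear_zero)
  have Y_le: "norm (?Y n x) \<le> ?q n * norm x" for n x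
  proof (induction n arbitrary: x)
    case (Suc n)
    have "norm (?Y n (?Y n x)) \<le> ?q n * (?q n * norm x)"
      using Suc[of "?Y n x"] mult_left_mono[OF Suc[of x], of "?q n"] sqrt_majorant_bounds[of n]
      by linarith
    then have "norm (Q x + ?Y n (?Y n x)) \<le> norm x + ?q n * (?q n * norm x)"
      using norm_triangle_ineq[of "Q x" "?Y n (?Y n x)"] Q_le[of x] by linarith
    moreover have "norm (?Y (Suc n) x) = norm (Q x + ?Y n (?Y n x)) / 2" by simp
    ultimately show ?case by (simp del: sqrt_iter.simps add: power2_eq_square algebra_simps)
  qed simp
  have Y_diff: "norm (?Y (Suc n) x - ?Y n x) \<le> (?q (Suc n) - ?q n) * norm x" for n x
  proof (induction n arbitrary: x)
    case 0
    show ?case using Q_le[of x] by simp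
  next
    case (Suc n)
    let ?a = "?Y (Suc n)" and ?b = "?Y n" and ?d = "?q (Suc n) - ?q n"
    \<comment> \<open>With the factors in this order, \<open>a\<^sup>2 - b\<^sup>2 = a(a - b) + (a - b)b\<close> is dominated in norm by
      the scalar identity \<open>q'\<^sup>2 - q\<^sup>2 = q'(q' - q) + (q' - q)q\<close>.\<close>
    have "?Y (Suc (Suc n)) x - ?a x = (1/2) *\<^sub>R (?a (?a x) - ?b (?b x))"
      by (simp add: algebra_simps)
    also have "?a (?a x) - ?b (?b x) = ?a (?a x - ?b x) + (?a (?b x) - ?b (?b x))"
      using linear_diff[OF lin[of "Suc n"]] by (simp del: sqrt_iter.simps)
    finally have "norm (?Y (Suc (Suc n)) x - ?a x)
        \<le> (1/2) * (norm (?a (?a x - ?b x)) + norm (?a (?b x) - ?b (?b x)))"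
      by (simp del: sqrt_iter.simps add: norm_triangle_ineq)
    also have "\<dots> \<le> (1/2) * (?q (Suc n) * (?d * norm x) + ?d * (?q n * norm x))"
    proof (intro mult_left_mono add_mono)
      show "norm (?a (?a x - ?b x)) \<le> ?q (Suc n) * (?d * norm x)"
        using Y_le[of "Suc n" "?a x - ?b x"] mult_left_mono[OF Suc[of x], of "?q (Suc n)"]
          sqrt_majorant_bounds[of "Suc n"] by linarith
      show "norm (?a (?b x) - ?b (?b x)) \<le> ?d * (?q n * norm x)"
        using Suc[of "?b x"] mult_left_mono[OF Y_le[of n x], of ?d] sqrt_majorant_mono[of n]
        by linarith
    qed simp
    also have "\<dots> = (?q (Suc (Suc n)) - ?q (Suc n)) * norm x"
      by (simp add: power2_eq_square field_simps)
    finally show ?case .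
  qed
  have Y_dist: "norm (?Y n x - ?Y m x) \<le> (?q n - ?q m) * norm x" if "m \<le> n" for m n x
    using that
  proof (induction n rule: dec_induct)
    case (step n)
    have "norm (?Y (Suc n) x - ?Y m x) \<le> norm (?Y (Suc n) x - ?Y n x) + norm (?Y n x - ?Y m x)"
      using norm_triangle_ineq[of "?Y (Suc n) x - ?Y n x" "?Y n x - ?Y m x"]
      by (simp del: sqrt_iter.simps)
    also have "\<dots> \<le> (?q (Suc n) - ?q m) * norm x"
      using Y_diff[of n x] step(3) by (simp del: sqrt_iter.simps sqrt_majorant.simps add: algebra_simps)
    finally show ?case .
  qed simp
  have "Cauchy (\<lambda>n. ?Y n x)" for x
  proof (rule metric_CauchyI)
    fix e :: real assume e: "e > 0"
    define e' where "e' = e / (norm x + 1)"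
    have e': "e' > 0" using e by (simp add: e'_def add_nonneg_pos)
    obtain N where N: "\<And>m n. m \<ge> N \<Longrightarrow> n \<ge> N \<Longrightarrow> dist (?q m) (?q n) < e'"
      using convergent_Cauchy[OF convergent_sqrt_majorant] e' unfolding Cauchy_def by metis
    have *: "norm (?Y n x - ?Y m x) < e" if "m \<ge> N" "n \<ge> m" for m n
    proof -
      have "(?q n - ?q m) * norm x \<le> e' * norm x"
        using N[of n m] that by (intro mult_right_mono) (auto simp: dist_norm)
      also have "\<dots> < e"
      proof -
        have "norm x / (norm x + 1) < 1" by (simp add: divide_less_eq add_nonneg_pos)
        then have "e * (norm x / (norm x + 1)) < e * 1" using e by (intro mult_strict_left_mono)
        then show ?thesis by (simp add: e'_def)
      qed
      finally show ?thesis using Y_dist[OF that(2), of x] by linarith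
    qed
    have "dist (?Y m x) (?Y n x) < e" if "m \<ge> N" "n \<ge> N" for m n
      using *[of m n] *[of n m] that by (cases "m \<le> n") (auto simp: dist_norm norm_minus_commute)
    then show "\<exists>N. \<forall>m\<ge>N. \<forall>n\<ge>N. dist (?Y m x) (?Y n x) < e" by blast
  qed
  then have "\<exists>y. (\<lambda>n. ?Y n x) \<longlonglongrightarrow> y" for x
    using Cauchy_convergent_iff convergent_def by blast
  then obtain Y where Y: "\<And>x. (\<lambda>n. ?Y n x) \<longlonglongrightarrow> Y x" by metis
  have YY: "(\<lambda>n. ?Y n (?Y n x)) \<longlonglongrightarrow> Y (Y x)" for x
  proof -
    have "(\<lambda>n. ?Y n (?Y n x - Y x)) \<longlonglongrightarrow> 0"
    proof (rule Lim_null_comparison)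
      have "norm (?Y n (?Y n x - Y x)) \<le> norm (?Y n x - Y x)" for n
        using Y_le[of n "?Y n x - Y x"] sqrt_majorant_bounds[of n]
          mult_right_mono[of "?q n" 1 "norm (?Y n x - Y x)"] by simp
      then show "\<forall>\<^sub>F n in sequentially. norm (?Y n (?Y n x - Y x)) \<le> norm (?Y n x - Y x)" by simp
      show "(\<lambda>n. norm (?Y n x - Y x)) \<longlonglongrightarrow> 0"
        using tendsto_norm[OF tendsto_diff[OF Y[of x] tendsto_const[of "Y x"]]] by simp
    qed
    from tendsto_add[OF this Y[of "Y x"]] show ?thesis using lin by (simp add: linear_diff)
  qed
  have fix_eq: "Y x = (1/2) *\<^sub>R (Q x + Y (Y x))" for x
  proof (rule LIMSEQ_unique)
    show "(\<lambda>n. ?Y (Suc n) x) \<longlonglongrightarrow> Y x" using LIMSEQ_Suc[OF Y[of x]] .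
    show "(\<lambda>n. ?Y (Suc n) x) \<longlonglongrightarrow> (1/2) *\<^sub>R (Q x + Y (Y x))"
      by (simp only: sqrt_iter.simps) (intro tendsto_intros YY)
  qed
  have Y_norm: "norm (Y x) \<le> norm x" for x
  proof (rule LIMSEQ_le_const2[OF tendsto_norm[OF Y[of x]]])
    have "norm (?Y n x) \<le> norm x" for n
      using Y_le[of n x] sqrt_majorant_bounds[of n] mult_right_mono[of "?q n" 1 "norm x"] by simp
    then show "\<exists>N. \<forall>n\<ge>N. norm (?Y n x) \<le> norm x" by blast
  qed
  have Y_lin: "bounded_linear Y"
  proof (rule bounded_linear_intro[where K = 1])
    show "Y (x + y) = Y x + Y y" for x y
      using LIMSEQ_unique[OF Y[of "x + y"]] tendsto_add[OF Y[of x] Y[of y]] lin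
      by (simp add: linear_add)
    show "Y (r *\<^sub>R x) = r *\<^sub>R Y x" for r x
      using LIMSEQ_unique[OF Y[of "r *\<^sub>R x"]] tendsto_scaleR[OF tendsto_const Y[of x], of r] lin
      by (simp add: linear_scale)
  qed (use Y_norm in simp)
  have Q_sym: "Q x \<bullet> y = x \<bullet> Q y" for x y by (simp add: Q_def inner_diff pos_map_inner[OF T])
  have "?Y n x \<bullet> y = x \<bullet> ?Y n y" for n x y
    by (induction n arbitrary: x y) (simp_all add: inner_add Q_sym)
  then have Y_sym: "Y x \<bullet> y = x \<bullet> Y y" for x y
    using LIMSEQ_unique[OF tendsto_inner[OF Y[of x] tendsto_const[of y]]]
      tendsto_inner[OF tendsto_const[of x] Y[of y]] by simp
  define S where "S x = x - Y x" for x
  have "pos_map S"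
    unfolding pos_map_def sym_map_def
  proof (intro conjI allI)
    show "bounded_linear S" unfolding S_def by (intro bounded_linear_sub bounded_linear_ident Y_lin)
    show "S x \<bullet> y = x \<bullet> S y" for x y by (simp add: S_def inner_diff Y_sym)
    show "0 \<le> S x \<bullet> x" for x
    proof -
      have "Y x \<bullet> x \<le> norm x * norm x"
        using Cauchy_Schwarz_ineq2[of "Y x" x] mult_right_mono[OF Y_norm[of x], of "norm x"] by simp
      then show ?thesis by (simp add: S_def inner_diff power2_norm_eq_inner flip: power2_eq_square)
    qed
  qed
  moreover have "S (S x) = T x" for x
  proof -
    have "S (S x) = x - 2 *\<^sub>R Y x + Y (Y x)"
      by (simp add: S_def linear_diff[OF bounded_linear.linear[OF Y_lin]] scaleR_2)
    also have "2 *\<^sub>R Y x = Q x + Y (Y x)" using arg_cong[OF fix_eq[of x], of "\<lambda>z. 2 *\<^sub>R z"] by simp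
    finally show ?thesis by (simp add: Q_def)
  qed
  moreover have "function_of T S"
    unfolding function_of_def
  proof (intro allI impI)
    fix X :: "('a \<times> 'a) set"
    assume X: "closed X" "subspace X" "invariant X T"
    have "invariant X Q"
      unfolding Q_def by (intro invariant_diff invariant_id X)
    then have "invariant X (?Y n)" for n
      by (induction n) (auto intro!: invariant_const_0 invariant_scaleR invariant_add X
          invariant_compose[of _ "?Y _" "?Y _"])
    from invariant_limit[OF X(1) this Y] show "invariant X S"
      unfolding S_def by (intro invariant_diff invariant_id X)
  qed
  ultimately show ?thesis by blast
qed


lemma pos_map_bound:
  assumes "pos_map T" obtains K where "K > 0" "\<And>x. T x \<bullet> x \<le> K * (x \<bullet> x)"
proof -
  obtain K where K: "K > 0" "\<And>x. norm (T x) \<le> norm x * K"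
    using bounded_linear.pos_bounded[OF pos_map_linear[OF assms]] by blast
  have "T x \<bullet> x \<le> K * (x \<bullet> x)" for x
    using Cauchy_Schwarz_ineq2[of "T x" x] mult_right_mono[OF K(2)[of x], of "norm x"]
    by (simp add: power2_norm_eq_inner[symmetric] power2_eq_square mult_ac)
  with K(1) show ?thesis using that by blast
qed

lemma pos_map_scaleR:
  assumes "pos_map T" "0 \<le> c" shows "pos_map (\<lambda>x. c *\<^sub>R T x)"
  using assms by (auto simp: pos_map_def sym_map_def intro: bounded_linear_const_scaleR)

lemma pos_map_sqrt_exists:
  fixes T :: "'a::{real_inner,complete_space} \<Rightarrow> 'a"
  assumes T: "pos_map T"
  shows "\<exists>S. pos_map S \<and> (\<forall>x. S (S x) = T x) \<and> function_of T S"
proof -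
  obtain K where K: "K > 0" "\<And>x. T x \<bullet> x \<le> K * (x \<bullet> x)" using pos_map_bound[OF T] by blast
  define T' where "T' x = (1/K) *\<^sub>R T x" for x
  have T': "pos_map T'" unfolding T'_def using K(1) by (intro pos_map_scaleR T) simp
  have "T' x \<bullet> x \<le> x \<bullet> x" for x using K by (simp add: T'_def field_simps)
  from sqrt_contraction[OF T' this] obtain S where
    S: "pos_map S" "\<And>x. S (S x) = T' x" "function_of T' S" by blast
  have "function_of T T'"
    unfolding function_of_def T'_def by (blast intro: invariant_scaleR)
  then have "function_of T S" using S(3) function_of_trans by blast
  then have "function_of T (\<lambda>x. sqrt K *\<^sub>R S x)"
    unfolding function_of_def by (blast intro: invariant_scaleR)
  moreover have "pos_map (\<lambda>x. sqrt K *\<^sub>R S x)" using K(1) by (intro pos_map_scaleR S) simp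
  moreover have "sqrt K *\<^sub>R S (sqrt K *\<^sub>R S x) = T x" for x
    using K(1) by (simp add: linear_scale[OF bounded_linear.linear[OF pos_map_linear[OF S(1)]]] S(2) T'_def)
  ultimately show ?thesis by blast
qed

text \<open>
  With \<open>y = (S - S')x\<close>, commutation gives \<open>(S + S')y = 0\<close>; both summands are positive, so
  \<open>Sy = S'y = 0\<close> and \<open>\<parallel>y\<parallel>\<^sup>2 = \<langle>x, (S - S')y\<rangle> = 0\<close>.
\<close>

lemma pos_map_sqrt_unique:
  fixes S S' :: "'a::{real_inner,complete_space} \<Rightarrow> 'a"
  assumes S: "pos_map S" and S': "pos_map S'" and comm: "\<And>x. S (S' x) = S' (S x)"
    and eq: "\<And>x. S (S x) = S' (S' x)"
  shows "S = S'"
proof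
  fix x
  interpret S: bounded_linear S by (rule pos_map_linear[OF S])
  interpret S': bounded_linear S' by (rule pos_map_linear[OF S'])
  define y where "y = S x - S' x"
  have "S y + S' y = 0" by (simp add: y_def S.diff S'.diff comm eq)
  then have "S y \<bullet> y + S' y \<bullet> y = 0" using inner_add_left[of "S y" "S' y" y] by simp
  then have "S y \<bullet> y = 0" "S' y \<bullet> y = 0"
    using pos_map_nonneg[OF S, of y] pos_map_nonneg[OF S', of y] by linarith+
  then have "S y = 0" "S' y = 0" using pos_map_eq_0 S S' by blast+
  moreover have "y \<bullet> y = x \<bullet> (S y - S' y)"
    by (subst (1) y_def) (simp add: inner_diff pos_map_inner[OF S] pos_map_inner[OF S'])
  ultimately show "S x = S' x" by (simp add: y_def)
qed

text \<open>
  If \<open>r\<close> is the square root of \<open>S\<close>, then \<open>ST = rTr\<close>.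
\<close>

lemma pos_map_mult:
  fixes S T :: "'a::{real_inner,complete_space} \<Rightarrow> 'a"
  assumes S: "pos_map S" and T: "pos_map T" and comm: "\<And>x. S (T x) = T (S x)"
  shows "pos_map (\<lambda>x. S (T x))"
proof -
  obtain r where r: "pos_map r" "\<And>x. r (r x) = S x" "function_of S r"
    using pos_map_sqrt_exists[OF S] by blast
  have rT: "T (r x) = r (T x)" for x
    by (rule function_of_commute[OF r(3) pos_map_linear[OF T]]) (simp add: comm)
  have "S (T x) \<bullet> x = T (r x) \<bullet> r x" for x
    by (simp add: r(2)[symmetric] rT pos_map_inner[OF r(1)])
  then show ?thesis
    unfolding pos_map_def sym_map_def
    using bounded_linear_compose[OF pos_map_linear[OF S] pos_map_linear[OF T]]
    using pos_map_nonneg[OF T] by (simp add: pos_map_inner[OF S] pos_map_inner[OF T] comm)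
qed

lemma Cauchy_of_dist_le:
  fixes g :: "nat \<Rightarrow> 'a::metric_space" and h :: "nat \<Rightarrow> 'b::metric_space"
  assumes "Cauchy g" "\<And>m n. dist (h m) (h n) \<le> K * dist (g m) (g n)"
  shows "Cauchy h"
proof (rule metric_CauchyI)
  fix e :: real assume "e > 0"
  define e' where "e' = e / (\<bar>K\<bar> + 1)"
  have "e' > 0" using \<open>e > 0\<close> by (simp add: e'_def add_nonneg_pos)
  then obtain N where N: "\<And>m n. m \<ge> N \<Longrightarrow> n \<ge> N \<Longrightarrow> dist (g m) (g n) < e'"
    using assms(1) unfolding Cauchy_def by metis
  have "dist (h m) (h n) < e" if "m \<ge> N" "n \<ge> N" for m n
  proof -
    have "dist (h m) (h n) \<le> (\<bar>K\<bar> + 1) * dist (g m) (g n)"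
      by (rule order_trans[OF assms(2)]) (intro mult_right_mono, auto)
    also have "\<dots> < (\<bar>K\<bar> + 1) * e'"
      using N[OF that] by (intro mult_strict_left_mono) auto
    also have "\<dots> = e" by (simp add: e'_def)
    finally show ?thesis .
  qed
  then show "\<exists>N. \<forall>m\<ge>N. \<forall>n\<ge>N. dist (h m) (h n) < e" by blast
qed

lemma closed_range_bounded_below:
  fixes f :: "'a::{real_normed_vector,complete_space} \<Rightarrow> 'b::real_normed_vector"
  assumes "bounded_linear f" "\<And>x. norm x \<le> K * norm (f x)"
  shows "closed (range f)"
  unfolding closed_sequential_limits
proof (intro allI impI)
  interpret bounded_linear f by fact
  fix g l assume "(\<forall>n. g n \<in> range f) \<and> g \<longlonglongrightarrow> l"
  then have gl: "g \<longlonglongrightarrow> l" and "\<forall>n. \<exists>y. g n = f y" by auto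
  then obtain h where "\<forall>n. g n = f (h n)" by metis
  then have h: "g = (\<lambda>n. f (h n))" by blast
  have "Cauchy h"
  proof (rule Cauchy_of_dist_le[OF LIMSEQ_imp_Cauchy[OF gl]])
    show "dist (h m) (h n) \<le> K * dist (g m) (g n)" for m n
      using assms(2)[of "h m - h n"] by (simp add: h dist_norm diff)
  qed
  then obtain y where "h \<longlonglongrightarrow> y" using Cauchy_convergent_iff convergent_def by blast
  then have "g \<longlonglongrightarrow> f y" unfolding h by (rule tendsto)
  with gl have "l = f y" by (rule LIMSEQ_unique)
  then show "l \<in> range f" by simp
qed

lemma coercive_surj:
  fixes f :: "'a::{real_inner,complete_space} \<Rightarrow> 'a"
  assumes f: "sym_map f" and c: "c > 0" "\<And>x. c * (x \<bullet> x) \<le> f x \<bullet> x"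
  shows "surj f"
proof -
  interpret bounded_linear f by (rule sym_map_linear[OF f])
  have below: "c * norm x \<le> norm (f x)" for x
  proof (cases "x = 0")
    case False
    have "c * norm x * norm x \<le> norm (f x) * norm x"
      using order_trans[OF c(2)[of x] order_trans[OF abs_ge_self Cauchy_Schwarz_ineq2[of "f x" x]]]
      by (metis mult.assoc power2_eq_square power2_norm_eq_inner)
    then show ?thesis by (rule mult_right_le_imp_le) (use False in simp)
  qed (simp add: zero)
  have "closed (range f)"
  proof (rule closed_range_bounded_below[OF bounded_linear_axioms])
    show "norm x \<le> (1/c) * norm (f x)" for x using below[of x] c(1) by (simp add: field_simps)
  qed
  moreover have "closure (range f) = UNIV"
  proof (rule dense_subspaceI)
    show "subspace (range f)" using linear_subspace_image[OF linear_axioms subspace_UNIV] .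
    fix z assume "\<And>m. m \<in> range f \<Longrightarrow> z \<bullet> m = 0"
    then have "z \<bullet> f z = 0" by blast
    then have "c * (z \<bullet> z) \<le> 0" using c(2)[of z] by (simp add: inner_commute)
    then have "z \<bullet> z \<le> 0" using c(1) by (simp add: mult_le_0_iff)
    with inner_ge_zero[of z] have "z \<bullet> z = 0" by linarith
    then show "z = 0" by simp
  qed
  ultimately show ?thesis by (simp add: closure_closed)
qed

definition proj_map :: "('a::real_inner \<Rightarrow> 'a) \<Rightarrow> bool" where
  "proj_map E \<longleftrightarrow> sym_map E \<and> (\<forall>x. E (E x) = E x)"

text \<open>
  The point is that the projection onto the kernel of \<open>W\<close> leaves invariant every closed subspace
  \<open>X\<close> which \<open>W \<times> W\<close> leaves invariant. Write the projected vector as \<open>p + q\<close> with \<open>p\<close> in \<open>X\<close> and \<open>q\<close>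
  orthogonal to \<open>X\<close>. As \<open>W \<times> W\<close> is symmetric, it preserves \<open>X\<close> and its complement, so it
  annihilates both \<open>p\<close> and \<open>q\<close>. A vector \<open>q\<close> in the kernel does not distinguish a vector from its
  projection, and the original vector lies in \<open>X\<close>; so \<open>q\<close> is orthogonal to \<open>p + q\<close> and to \<open>p\<close>.
\<close>

lemma kernel_projection:
  fixes W :: "'a::{real_inner,complete_space} \<Rightarrow> 'a"
  assumes W: "sym_map W"
  shows "\<exists>E. proj_map E \<and> (\<forall>x. E x = x \<longleftrightarrow> W x = 0) \<and> function_of W E"
proof -
  interpret W: bounded_linear W by (rule sym_map_linear[OF W])
  let ?M = "{x. W x = 0}"
  have M: "closed ?M" "subspace ?M"
    by (auto simp: subspace_def W.add W.scaleR W.zero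
        intro!: closed_Collect_eq continuous_intros W.continuous_on)
  obtain E where E: "\<And>x. W (E x) = 0" "\<And>x m. W m = 0 \<Longrightarrow> (x - E x) \<bullet> m = 0"
  proof -
    have "\<exists>p. W p = 0 \<and> (\<forall>m. W m = 0 \<longrightarrow> (x - p) \<bullet> m = 0)" for x
      using orthogonal_projection_exists[OF M, of x] by blast
    then obtain E where "\<forall>x. W (E x) = 0 \<and> (\<forall>m. W m = 0 \<longrightarrow> (x - E x) \<bullet> m = 0)" by metis
    then show ?thesis using that by blast
  qed
  have uniq: "E x = p" if "W p = 0" "\<And>m. W m = 0 \<Longrightarrow> (x - p) \<bullet> m = 0" for x p
  proof -
    have "W (E x - p) = 0" using E(1) that(1) by (simp add: W.diff)
    then have "(x - p) \<bullet> (E x - p) - (x - E x) \<bullet> (E x - p) = 0" using that(2) E(2) by simp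
    then have "(E x - p) \<bullet> (E x - p) = 0" by (simp add: inner_diff)
    then show ?thesis by simp
  qed
  have add: "E (x + y) = E x + E y" for x y
  proof (rule uniq)
    show "(x + y - (E x + E y)) \<bullet> m = 0" if "W m = 0" for m
      using E(2)[OF that, of x] E(2)[OF that, of y] by (simp add: inner_diff inner_add)
  qed (simp add: W.add E)
  have scale: "E (r *\<^sub>R x) = r *\<^sub>R E x" for r x
  proof (rule uniq)
    show "(r *\<^sub>R x - r *\<^sub>R E x) \<bullet> m = 0" if "W m = 0" for m
      using E(2)[OF that, of x] by (simp add: inner_diff)
  qed (simp add: W.scaleR E)
  have half: "E x \<bullet> E y = x \<bullet> E y" for x y
    using E(2)[OF E(1)[of y], of x] by (simp add: inner_diff)
  have "norm (E x) \<le> norm x * 1" for x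
  proof (cases "E x = 0")
    case False
    have "norm (E x) * norm (E x) \<le> norm x * norm (E x)"
      using half[of x x] Cauchy_Schwarz_ineq2[of x "E x"]
      by (simp flip: power2_eq_square add: power2_norm_eq_inner)
    with False show ?thesis by simp
  qed simp
  then have lin: "bounded_linear E" using add scale by (intro bounded_linear_intro)
  have fix_iff: "E x = x \<longleftrightarrow> W x = 0" for x
    using E(1)[of x] uniq[of x x] by auto
  have proj: "proj_map E"
    unfolding proj_map_def sym_map_def
  proof (intro conjI allI)
    show "E x \<bullet> y = x \<bullet> E y" for x y
      using half[of x y] half[of y x] by (simp add: inner_commute)
    show "E (E x) = E x" for x using fix_iff E(1) by blast
  qed (rule lin)
  have "invariant X E" if X: "closed X" "subspace X" "invariant X W" for X :: "('a \<times> 'a) set"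
    unfolding invariant_def
  proof (intro allI impI)
    fix x y assume xy: "(x, y) \<in> X"
    obtain pp where pp: "pp \<in> X" "\<forall>z\<in>X. ((E x, E y) - pp) \<bullet> z = 0"
      using orthogonal_projection_exists[OF X(1,2), of "(E x, E y)"] by blast
    obtain p p' where pp': "pp = (p, p')" by (cases pp)
    have p: "(p, p') \<in> X" using pp(1) pp' by simp
    have orth: "((E x, E y) - (p, p')) \<bullet> (a, b) = 0" if "(a, b) \<in> X" for a b
      using pp(2) pp' that by blast
    define q where "q = E x - p"
    define q' where "q' = E y - p'"
    have orth': "q \<bullet> a + q' \<bullet> b = 0" if "(a, b) \<in> X" for a b
      using orth[OF that] by (simp add: q_def q'_def)
    have Wp: "(W p, W p') \<in> X" using X(3) p by (simp add: invariant_def)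
    have Wq: "W q = - W p" "W q' = - W p'" by (simp_all add: q_def q'_def W.diff E)
    have "(W (W p), W (W p')) \<in> X" using X(3) Wp by (simp add: invariant_def)
    from orth'[OF this] have "W q \<bullet> W p + W q' \<bullet> W p' = 0" by (simp add: sym_map_inner[OF W])
    then have "W p \<bullet> W p + W p' \<bullet> W p' = 0" by (simp add: Wq)
    then have "W p = 0" "W p' = 0" by (simp_all add: add_nonneg_eq_0_iff)
    then have Wq0: "W q = 0" "W q' = 0" using Wq by simp_all
    have "q \<bullet> q + q' \<bullet> q' = (q \<bullet> E x + q' \<bullet> E y) - (q \<bullet> p + q' \<bullet> p')"
      by (simp add: q_def q'_def inner_diff)
    also have "q \<bullet> p + q' \<bullet> p' = 0" by (rule orth'[OF p])
    also have "q \<bullet> E x = q \<bullet> x" using E(2)[OF Wq0(1), of x] by (simp add: inner_diff inner_commute)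
    also have "q' \<bullet> E y = q' \<bullet> y" using E(2)[OF Wq0(2), of y] by (simp add: inner_diff inner_commute)
    also have "q \<bullet> x + q' \<bullet> y = 0" by (rule orth'[OF xy])
    finally have "q \<bullet> q + q' \<bullet> q' = 0" by simp
    then have "q = 0" "q' = 0" by (simp_all add: add_nonneg_eq_0_iff)
    with p show "(E x, E y) \<in> X" by (simp add: q_def q'_def)
  qed
  then have "function_of W E" by (auto simp: function_of_def)
  with proj fix_iff show ?thesis by blast
qed

section \<open>Closed linear relations\<close>

text \<open>
  On graphs, the adjoint is the orthogonal complement turned by a right angle. For densely
  defined operators this is the graph of the adjoint operator; for linear relations it always
  makes sense.
\<close>

definition adj :: "('a::real_inner \<times> 'a) set \<Rightarrow> ('a \<times> 'a) set" where
  "adj G = {(y, z). \<forall>x u. (x, u) \<in> G \<longrightarrow> u \<bullet> y = x \<bullet> z}"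

text \<open>Positive self-adjoint linear relations.\<close>

definition psa :: "('a::real_inner \<times> 'a) set \<Rightarrow> bool" where
  "psa L \<longleftrightarrow> adj L = L \<and> (\<forall>x u. (x, u) \<in> L \<longrightarrow> 0 \<le> u \<bullet> x)"

lemma adjI: "(\<And>x u. (x, u) \<in> G \<Longrightarrow> u \<bullet> y = x \<bullet> z) \<Longrightarrow> (y, z) \<in> adj G"
  by (simp add: adj_def)

lemma adjD: "(y, z) \<in> adj G \<Longrightarrow> (x, u) \<in> G \<Longrightarrow> u \<bullet> y = x \<bullet> z"
  by (simp add: adj_def)

lemma psaD:
  assumes "psa L"
  shows psa_adj: "adj L = L" and psa_nonneg: "(x, u) \<in> L \<Longrightarrow> 0 \<le> u \<bullet> x"
  using assms by (auto simp: psa_def)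

lemma psa_sym: "psa L \<Longrightarrow> (x, u) \<in> L \<Longrightarrow> (y, v) \<in> L \<Longrightarrow> u \<bullet> y = x \<bullet> v"
  using adjD[of y v L x u] by (simp add: psa_adj)

lemma closed_adj: "closed (adj G)"
proof -
  have "adj G = (\<Inter>p\<in>G. {w. snd p \<bullet> fst w = fst p \<bullet> snd w})" by (force simp: adj_def)
  moreover have "closed {w. snd p \<bullet> fst w = fst p \<bullet> snd w}" for p :: "'a \<times> 'a"
    by (intro closed_Collect_eq continuous_intros)
  ultimately show ?thesis by (simp add: closed_INT)
qed

lemma subspace_adj: "subspace (adj G)"
  by (auto simp: subspace_def adj_def inner_add zero_prod_def)

lemma psa_closed: "psa L \<Longrightarrow> closed L"
  using closed_adj[of L] by (simp add: psa_adj)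

lemma psa_subspace: "psa L \<Longrightarrow> subspace L"
  using subspace_adj[of L] by (simp add: psa_adj)

lemma adj_adj:
  fixes G :: "('a::{real_inner,complete_space} \<times> 'a) set"
  assumes G: "closed G" "subspace G" shows "adj (adj G) = G"
proof (rule set_eqI, rule iffI)
  fix ab assume "ab \<in> adj (adj G)"
  then obtain a b where ab: "ab = (a, b)" "(a, b) \<in> adj (adj G)" by (cases ab) auto
  obtain pp where pp: "pp \<in> G" "\<forall>z\<in>G. ((a, b) - pp) \<bullet> z = 0"
    using orthogonal_projection_exists[OF G, of "(a, b)"] by blast
  obtain p p' where p: "pp = (p, p')" by (cases pp)
  define c where "c = a - p"
  define d where "d = b - p'"
  have orth: "c \<bullet> x + d \<bullet> u = 0" if "(x, u) \<in> G" for x u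
    using pp(2) that unfolding p c_def d_def by fastforce
  have "(d, - c) \<in> adj G"
  proof (rule adjI)
    fix x u assume "(x, u) \<in> G"
    from orth[OF this] show "u \<bullet> d = x \<bullet> - c" by (simp add: inner_commute)
  qed
  from adjD[OF ab(2) this] have "c \<bullet> a + d \<bullet> b = 0" by simp
  moreover have "c \<bullet> p + d \<bullet> p' = 0" using orth pp(1) p by blast
  ultimately have "c \<bullet> c + d \<bullet> d = 0" by (simp add: c_def d_def inner_diff)
  then have "c = 0" "d = 0" by (simp_all add: add_nonneg_eq_0_iff)
  then show "ab \<in> G" using pp(1) by (simp add: ab(1) p c_def d_def)
next
  fix ab assume "ab \<in> G"
  then show "ab \<in> adj (adj G)"
    by (cases ab) (auto intro!: adjI dest: adjD simp: inner_commute)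
qed

text \<open>
  If \<open>1 + Q\<close> is onto and \<open>(y, z)\<close> belongs to the adjoint, choose \<open>x\<close> with \<open>(1 + Q)x = y + z\<close>.
  Then \<open>y - x\<close> is orthogonal to the range of \<open>1 + Q\<close>, so \<open>y = x\<close>.
\<close>

lemma psa_of_surj:
  assumes sym: "\<And>x v y w. (x, v) \<in> Q \<Longrightarrow> (y, w) \<in> Q \<Longrightarrow> v \<bullet> y = x \<bullet> w"
    and pos: "\<And>x v. (x, v) \<in> Q \<Longrightarrow> 0 \<le> v \<bullet> x"
    and surj: "\<And>h. \<exists>x. (x, h - x) \<in> Q"
  shows "psa Q"
  unfolding psa_def
proof (intro conjI allI impI set_eqI iffI)
  fix p assume "p \<in> adj Q"
  then obtain y z where p: "p = (y, z)" "(y, z) \<in> adj Q" by (cases p) auto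
  obtain x where x: "(x, y + z - x) \<in> Q" using surj by blast
  have "h \<bullet> (y - x) = 0" for h
  proof -
    obtain a where a: "(a, h - a) \<in> Q" using surj by blast
    have "(h - a) \<bullet> y = a \<bullet> z" using adjD[OF p(2) a] .
    moreover have "(h - a) \<bullet> x = a \<bullet> (y + z - x)" by (rule sym[OF a x])
    ultimately show ?thesis by (simp add: inner_diff inner_add)
  qed
  from this[of "y - x"] have "y = x" by simp
  with x show "p \<in> Q" by (simp add: p)
next
  fix p assume "p \<in> Q"
  then show "p \<in> adj Q" using sym by (cases p) (auto intro: adjI)
qed (rule pos)

text \<open>
  Self-adjointness of \<open>T*T\<close>: the component of \<open>(h, 0)\<close> along the graph of \<open>T\<close> solves
  \<open>(1 + T*T)x = h\<close>.
\<close>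

lemma von_neumann:
  fixes G :: "('a::{real_inner,complete_space} \<times> 'a) set"
  assumes G: "closed G" "subspace G" shows "psa (G O adj G)"
proof (rule psa_of_surj)
  fix x v y w assume "(x, v) \<in> G O adj G" "(y, w) \<in> G O adj G"
  then obtain u t where "(x, u) \<in> G" "(u, v) \<in> adj G" "(y, t) \<in> G" "(t, w) \<in> adj G" by blast
  then have "t \<bullet> u = y \<bullet> v" "u \<bullet> t = x \<bullet> w" using adjD by blast+
  then show "v \<bullet> y = x \<bullet> w" by (simp add: inner_commute)
next
  fix x v assume "(x, v) \<in> G O adj G"
  then obtain u where "(x, u) \<in> G" "(u, v) \<in> adj G" by blast
  then have "u \<bullet> u = x \<bullet> v" using adjD[of u v G x u] by blast
  then show "0 \<le> v \<bullet> x" using inner_ge_zero[of u] by (simp add: inner_commute)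
next
  fix h
  obtain pp where pp: "pp \<in> G" "\<forall>z\<in>G. ((h, 0) - pp) \<bullet> z = 0"
    using orthogonal_projection_exists[OF G, of "(h, 0)"] by blast
  obtain x u where p: "pp = (x, u)" by (cases pp)
  have "(u, h - x) \<in> adj G"
  proof (rule adjI)
    fix a b assume "(a, b) \<in> G"
    then show "b \<bullet> u = a \<bullet> (h - x)" using pp(2) unfolding p
      by (fastforce simp: inner_diff inner_commute)
  qed
  then show "\<exists>x. (x, h - x) \<in> G O adj G" using pp(1) p by blast
qed

text \<open>
  The range of \<open>1 + L\<close> is closed since \<open>\<parallel>(1 + L)x\<parallel> \<ge> \<parallel>x\<parallel>\<close>, and dense since a vector \<open>z\<close>
  orthogonal to it satisfies \<open>Lz = -z\<close>, which positivity forbids unless \<open>z = 0\<close>.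
\<close>

lemma psa_surj:
  fixes L :: "('a::{real_inner,complete_space} \<times> 'a) set"
  assumes L: "psa L" shows "\<exists>x. (x, h - x) \<in> L"
proof -
  let ?M = "(\<lambda>(a, b). a + b) ` L"
  note sub = psa_subspace[OF L]
  have lin: "linear (\<lambda>(a, b). a + b :: 'a)" by (intro linearI) (auto simp: algebra_simps)
  have "closed ?M"
    unfolding closed_sequential_limits
  proof (intro allI impI)
    fix g l assume "(\<forall>n. g n \<in> ?M) \<and> g \<longlonglongrightarrow> l"
    then have gl: "g \<longlonglongrightarrow> l" and "\<forall>n. \<exists>a b. (a, b) \<in> L \<and> g n = a + b" by force+
    then obtain a b where ab: "\<And>n. (a n, b n) \<in> L" and g: "\<And>n. g n = a n + b n" by metis
    have "norm (a m - a n) \<le> norm (g m - g n)" for m n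
    proof (rule power2_le_imp_le)
      have "(a m - a n, b m - b n) \<in> L" using subspace_diff[OF sub ab[of m] ab[of n]] by simp
      from psa_nonneg[OF L this] have "0 \<le> (b m - b n) \<bullet> (a m - a n)" .
      moreover have "g m - g n = (a m - a n) + (b m - b n)" by (simp add: g)
      moreover have "(norm (p + q))\<^sup>2 = (norm p)\<^sup>2 + (norm q)\<^sup>2 + 2 * (q \<bullet> p)" for p q :: 'a
        by (simp add: power2_norm_eq_inner inner_add inner_commute)
      ultimately show "(norm (a m - a n))\<^sup>2 \<le> (norm (g m - g n))\<^sup>2" by simp
    qed simp
    then have "Cauchy a"
      by (intro Cauchy_of_dist_le[OF LIMSEQ_imp_Cauchy[OF gl], of _ 1]) (simp add: dist_norm)
    then obtain a' where a': "a \<longlonglongrightarrow> a'" using Cauchy_convergent_iff convergent_def by blast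
    have "b \<longlonglongrightarrow> l - a'"
      using tendsto_diff[OF gl a'] by (simp add: g)
    from tendsto_Pair[OF a' this] have "(a', l - a') \<in> L"
      by (rule closed_sequentially[OF psa_closed[OF L], rotated]) (rule ab)
    then show "l \<in> ?M" by (force intro!: image_eqI)
  qed
  moreover have "closure ?M = UNIV"
  proof (rule dense_subspaceI)
    show "subspace ?M" by (rule linear_subspace_image[OF lin sub])
    fix z assume z: "\<And>m. m \<in> ?M \<Longrightarrow> z \<bullet> m = 0"
    have "(z, - z) \<in> adj L"
    proof (rule adjI)
      fix x u assume "(x, u) \<in> L"
      then have "z \<bullet> (x + u) = 0" by (intro z) (force intro!: image_eqI)
      then show "u \<bullet> z = x \<bullet> - z" by (simp add: inner_add inner_commute)
    qed
    then have "(z, - z) \<in> L" by (simp add: psa_adj[OF L])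
    from psa_nonneg[OF L this] have "0 \<le> - z \<bullet> z" .
    then have "z \<bullet> z \<le> 0" by simp
    with inner_ge_zero[of z] have "z \<bullet> z = 0" by linarith
    then show "z = 0" by simp
  qed
  ultimately have "h \<in> ?M" by (simp add: closure_closed)
  then obtain a b where ab: "(a, b) \<in> L" "h = a + b" by auto
  then have "(a, h - a) \<in> L" by simp
  then show ?thesis by blast
qed

lemma psa_resolvent:
  fixes L :: "('a::{real_inner,complete_space} \<times> 'a) set"
  assumes L: "psa L"
  shows "\<exists>R. pos_map R \<and> (\<forall>x. R x \<bullet> x \<le> x \<bullet> x) \<and> L = range (\<lambda>w. (R w, w - R w))"
proof -
  note sub = psa_subspace[OF L]
  have "\<forall>h. \<exists>x. (x, h - x) \<in> L" using psa_surj[OF L] by blast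
  then obtain R where R: "\<And>h. (R h, h - R h) \<in> L" by metis
  have uniq: "R h = x" if "(x, h - x) \<in> L" for h x
  proof -
    have "(R h - x, - (R h - x)) \<in> L" using subspace_diff[OF sub R[of h] that] by simp
    from psa_nonneg[OF L this] have "(R h - x) \<bullet> (R h - x) \<le> 0"
      by (simp only: inner_minus_left)
    with inner_ge_zero[of "R h - x"] have "(R h - x) \<bullet> (R h - x) = 0" by linarith
    then show ?thesis by simp
  qed
  have nn: "0 \<le> (x - R x) \<bullet> R x" for x by (rule psa_nonneg[OF L R])
  have "bounded_linear R"
  proof (rule bounded_linear_intro[where K = 1])
    show "R (x + y) = R x + R y" for x y
      using subspace_add[OF sub R[of x] R[of y]] by (intro uniq) (simp add: algebra_simps)
    show "R (r *\<^sub>R x) = r *\<^sub>R R x" for r x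
      using subspace_mul[OF sub R[of x], of r] by (intro uniq) (simp add: algebra_simps)
    show "norm (R x) \<le> norm x * 1" for x
    proof (rule power2_le_imp_le)
      have "(norm x)\<^sup>2 = (norm (R x))\<^sup>2 + (norm (x - R x))\<^sup>2 + 2 * ((x - R x) \<bullet> R x)"
        by (simp add: power2_norm_eq_inner inner_diff inner_commute)
      then show "(norm (R x))\<^sup>2 \<le> (norm x * 1)\<^sup>2" using nn[of x] by simp
    qed simp
  qed
  moreover have "R x \<bullet> y = x \<bullet> R y" for x y
    using psa_sym[OF L R[of x] R[of y]] by (simp add: inner_diff)
  moreover have "0 \<le> R x \<bullet> x" for x
    using nn[of x] inner_ge_zero[of "R x"] unfolding inner_diff inner_commute[of "R x" x] by linarith
  moreover have "R x \<bullet> x \<le> x \<bullet> x" for x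
    using nn[of x] inner_ge_zero[of "x - R x"] unfolding inner_diff by (simp add: inner_commute)
  moreover have "L = range (\<lambda>w. (R w, w - R w))"
  proof (intro set_eqI iffI)
    fix p assume "p \<in> L"
    then obtain a b where p: "p = (a, b)" "(a, b) \<in> L" by (cases p) auto
    then have "R (a + b) = a" by (intro uniq) simp
    then show "p \<in> range (\<lambda>w. (R w, w - R w))" by (intro image_eqI[of _ _ "a + b"]) (simp_all add: p)
  qed (use R in auto)
  ultimately show ?thesis unfolding pos_map_def sym_map_def by blast
qed

section \<open>Square roots of positive self-adjoint relations\<close>

text \<open>
  For \<open>S = (1 + L)\<^sup>-\<^sup>1\<^sup>/\<^sup>2\<close> and \<open>C = (L(1 + L)\<^sup>-\<^sup>1)\<^sup>1\<^sup>/\<^sup>2\<close> one has \<open>L = C\<^sup>2 S\<^sup>-\<^sup>2\<close> and \<open>L\<^sup>1\<^sup>/\<^sup>2 = C S\<^sup>-\<^sup>1\<close>.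
  The pair is the cosine and sine of the angle that the graph of \<open>L\<^sup>1\<^sup>/\<^sup>2\<close> makes with the horizontal
  axis. The last two conditions say that both are functions of the resolvent \<open>S\<^sup>2 = (1 + L)\<^sup>-\<^sup>1\<close>.
\<close>

definition cos_sin :: "('a::real_inner \<Rightarrow> 'a) \<Rightarrow> ('a \<Rightarrow> 'a) \<Rightarrow> bool" where
  "cos_sin S C \<longleftrightarrow> pos_map S \<and> pos_map C \<and> (\<forall>x. S (C x) = C (S x)) \<and>
     (\<forall>x. S (S x) + C (C x) = x) \<and>
     function_of (\<lambda>x. S (S x)) S \<and> function_of (\<lambda>x. S (S x)) C"

lemma cos_sinD:
  assumes "cos_sin S C"
  shows cos_sin_S: "pos_map S" and cos_sin_C: "pos_map C"
    and cos_sin_commute: "S (C x) = C (S x)"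
    and cos_sin_sum: "S (S x) + C (C x) = x"
    and cos_sin_fun_S: "function_of (\<lambda>x. S (S x)) S"
    and cos_sin_fun_C: "function_of (\<lambda>x. S (S x)) C"
  using assms by (auto simp: cos_sin_def)

lemma psa_cos_sin:
  fixes L :: "('a::{real_inner,complete_space} \<times> 'a) set"
  assumes L: "psa L"
  shows "\<exists>S C. cos_sin S C \<and> L = range (\<lambda>w. (S (S w), C (C w)))"
proof -
  obtain R where R: "pos_map R" "\<And>x. R x \<bullet> x \<le> x \<bullet> x" "L = range (\<lambda>w. (R w, w - R w))"
    using psa_resolvent[OF L] by blast
  have "bounded_linear (\<lambda>w. w - R w)"
    by (intro bounded_linear_sub bounded_linear_ident pos_map_linear R)
  then have "pos_map (\<lambda>w. w - R w)"
    using R(2) by (simp add: pos_map_def sym_map_def inner_diff pos_map_inner[OF R(1)])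
  from pos_map_sqrt_exists[OF this] obtain C where
    C: "pos_map C" "\<And>x. C (C x) = x - R x" "function_of (\<lambda>w. w - R w) C" by blast
  obtain S where S: "pos_map S" "\<And>x. S (S x) = R x" "function_of R S"
    using pos_map_sqrt_exists[OF R(1)] by blast
  have "function_of R (\<lambda>w. w - R w)"
    by (auto simp: function_of_def intro: invariant_diff invariant_id)
  then have RC: "function_of R C" using C(3) function_of_trans by blast
  have "R (C x) = C (R x)" for x
    by (rule function_of_commute[OF RC]) (simp_all add: pos_map_linear R)
  then have "C (S x) = S (C x)" for x
    using function_of_commute[OF S(3) pos_map_linear[OF C(1)]] by simp
  then have "cos_sin S C" unfolding cos_sin_def using S C RC by simp
  moreover have "L = range (\<lambda>w. (S (S w), C (C w)))" by (simp add: R(3) S(2) C(2))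
  ultimately show ?thesis by blast
qed

text \<open>
  If \<open>(a, b)\<close> is in the adjoint, then \<open>Ca = Sb\<close>, and \<open>w = Sa + Cb\<close> satisfies \<open>Sw = a\<close> and
  \<open>Cw = b\<close> by \<open>S\<^sup>2 + C\<^sup>2 = 1\<close>.
\<close>

lemma psa_quotient:
  fixes S C :: "'a::{real_inner,complete_space} \<Rightarrow> 'a"
  assumes "cos_sin S C" shows "psa (range (\<lambda>w. (S w, C w)))"
  unfolding psa_def
proof (intro conjI allI impI set_eqI iffI)
  note S = cos_sin_S[OF assms] and C = cos_sin_C[OF assms]
  interpret S: bounded_linear S by (rule pos_map_linear[OF S])
  interpret C: bounded_linear C by (rule pos_map_linear[OF C])
  fix p assume "p \<in> adj (range (\<lambda>w. (S w, C w)))"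
  then obtain a b where p: "p = (a, b)" and ab: "(a, b) \<in> adj (range (\<lambda>w. (S w, C w)))"
    by (cases p) auto
  have "w \<bullet> (C a - S b) = 0" for w
  proof -
    have "C w \<bullet> a = S w \<bullet> b" by (rule adjD[OF ab]) simp
    then show ?thesis by (simp add: inner_diff pos_map_inner[OF S] pos_map_inner[OF C])
  qed
  from this[of "C a - S b"] have eq: "C a = S b" by simp
  define w where "w = S a + C b"
  have "S w = a"
    using cos_sin_sum[OF assms, of a] by (simp add: w_def S.add cos_sin_commute[OF assms] eq[symmetric])
  moreover have "C w = b"
    using cos_sin_sum[OF assms, of b]
    by (simp add: w_def C.add cos_sin_commute[OF assms, symmetric] eq)
  ultimately show "p \<in> range (\<lambda>w. (S w, C w))" using p by auto
next
  note S = cos_sin_S[OF assms] and C = cos_sin_C[OF assms]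
  fix p assume "p \<in> range (\<lambda>w. (S w, C w))"
  then show "p \<in> adj (range (\<lambda>w. (S w, C w)))"
    by (auto intro!: adjI simp: pos_map_inner[OF S] pos_map_inner[OF C] cos_sin_commute[OF assms])
next
  note S = cos_sin_S[OF assms] and C = cos_sin_C[OF assms]
  fix x u assume "(x, u) \<in> range (\<lambda>w. (S w, C w))"
  then obtain w where "x = S w" "u = C w" by auto
  then show "0 \<le> u \<bullet> x"
    using pos_map_nonneg[OF pos_map_mult[OF S C cos_sin_commute[OF assms]], of w]
    by (simp add: pos_map_inner[OF C] pos_map_inner[OF S] cos_sin_commute[OF assms])
qed

lemma quotient_square:
  assumes "cos_sin S C"
  shows "range (\<lambda>w. (S w, C w)) O range (\<lambda>w. (S w, C w)) = range (\<lambda>w. (S (S w), C (C w)))"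
proof (intro set_eqI iffI)
  note S = cos_sin_S[OF assms] and C = cos_sin_C[OF assms]
  interpret S: bounded_linear S by (rule pos_map_linear[OF S])
  interpret C: bounded_linear C by (rule pos_map_linear[OF C])
  fix p assume "p \<in> range (\<lambda>w. (S w, C w)) O range (\<lambda>w. (S w, C w))"
  then obtain w v where p: "p = (S w, C v)" and eq: "C w = S v" by auto
  define t where "t = S w + C v"
  have "S t = w"
    using cos_sin_sum[OF assms, of w] by (simp add: t_def S.add cos_sin_commute[OF assms] eq[symmetric])
  moreover have "C t = v"
    using cos_sin_sum[OF assms, of v]
    by (simp add: t_def C.add cos_sin_commute[OF assms, symmetric] eq)
  ultimately show "p \<in> range (\<lambda>w. (S (S w), C (C w)))" using p by auto
next
  fix p assume "p \<in> range (\<lambda>w. (S (S w), C (C w)))"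
  then obtain w where "p = (S (S w), C (C w))" by auto
  moreover have "(S (S w), S (C w)) \<in> range (\<lambda>w. (S w, C w))"
    using cos_sin_commute[OF assms, of w] by auto
  ultimately show "p \<in> range (\<lambda>w. (S w, C w)) O range (\<lambda>w. (S w, C w))" by auto
qed

lemma cos_sin_norm:
  assumes "cos_sin S C" shows "(norm (S w))\<^sup>2 + (norm (C w))\<^sup>2 = (norm w)\<^sup>2"
proof -
  have "w \<bullet> w = w \<bullet> (S (S w) + C (C w))" by (simp add: cos_sin_sum[OF assms])
  then show ?thesis
    by (simp add: power2_norm_eq_inner inner_add pos_map_inner[OF cos_sin_S[OF assms]]
        pos_map_inner[OF cos_sin_C[OF assms]])
qed

lemma single_valued_quotient:
  fixes S C :: "'a::{real_inner,complete_space} \<Rightarrow> 'a"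
  assumes SC: "cos_sin S C" and sv: "single_valued (range (\<lambda>w. (S (S w), C (C w))))"
  shows inj_quotient: "S w = 0 \<Longrightarrow> w = 0" and dense_quotient: "closure (range S) = UNIV"
proof -
  interpret S: bounded_linear S by (rule pos_map_linear[OF cos_sin_S[OF SC]])
  interpret C: bounded_linear C by (rule pos_map_linear[OF cos_sin_C[OF SC]])
  have inj: "w = 0" if "S w = 0" for w
  proof -
    have "(0, C (C w)) \<in> range (\<lambda>w. (S (S w), C (C w)))" by (rule image_eqI[of _ _ w]) (simp_all add: that S.zero)
    moreover have "(0, 0) \<in> range (\<lambda>w. (S (S w), C (C w)))" by (rule image_eqI[of _ _ 0]) (simp_all add: S.zero C.zero)
    ultimately have "C (C w) = 0" using sv by (auto dest: single_valuedD)
    then show ?thesis using cos_sin_sum[OF SC, of w] that S.zero by simp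
  qed
  then show "S w = 0 \<Longrightarrow> w = 0" .
  show "closure (range S) = UNIV"
  proof (rule dense_subspaceI)
    show "subspace (range S)" using linear_subspace_image[OF S.linear_axioms subspace_UNIV] .
    fix z assume "\<And>m. m \<in> range S \<Longrightarrow> z \<bullet> m = 0"
    then have "S z \<bullet> S z = 0" by (simp add: pos_map_inner[OF cos_sin_S[OF SC]])
    then show "z = 0" using inj by simp
  qed
qed

text \<open>
  A normal operator commutes with \<open>(1 + T*T)\<^sup>-\<^sup>1\<close>. For \<open>u = Tx\<close> and \<open>v = TRx\<close> with \<open>R\<close> the
  resolvent, \<open>T*v = x - Rx\<close>, so that \<open>TT*v = u - v\<close>; as \<open>TT* = T*T\<close>, this means \<open>v = Ru\<close>.
\<close>

lemma resolvent_invariant: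
  fixes S C :: "'a::{real_inner,complete_space} \<Rightarrow> 'a"
  assumes G: "closed G" "subspace G" and SC: "cos_sin S C"
    and eq: "G O adj G = range (\<lambda>w. (S (S w), C (C w)))" "adj G O G = G O adj G"
  shows "invariant G (\<lambda>w. S (S w))" "invariant G S" "invariant G C"
proof -
  show inv: "invariant G (\<lambda>w. S (S w))"
    unfolding invariant_def
  proof (intro allI impI)
    fix x u assume xu: "(x, u) \<in> G"
    have C: "C (C w) = w - S (S w)" for w using cos_sin_sum[OF SC, of w] by (simp add: algebra_simps)
    have "(S (S x), x - S (S x)) \<in> G O adj G" unfolding eq C by blast
    then obtain v where v: "(S (S x), v) \<in> G" "(v, x - S (S x)) \<in> adj G" by blast
    have "(x - S (S x), u - v) \<in> G" using subspace_diff[OF G(2) xu v(1)] by simp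
    then have "(v, u - v) \<in> adj G O G" using v(2) by blast
    then obtain w where "v = S (S w)" "u - v = w - S (S w)" unfolding eq C by auto
    then show "(S (S x), S (S u)) \<in> G" using v(1) by simp
  qed
  show "invariant G S" "invariant G C"
    using inv G(1,2) cos_sin_fun_S[OF SC] cos_sin_fun_C[OF SC] by (simp_all add: function_of_def)
qed

text \<open>
  Here \<open>C = |T|S\<close>, so the conclusion contains \<open>\<parallel>|T|x\<parallel> = \<parallel>Tx\<parallel>\<close> and the equality of the domains
  of \<open>T\<close> and \<open>|T|\<close>. On the range of \<open>S\<close> the norm identity follows from
  \<open>\<parallel>Tx\<parallel>\<^sup>2 = \<langle>T*Tx, x\<rangle>\<close>; it extends by density, as \<open>T\<close> is closed. Nothing of the graph is missed: a
  vector of the graph orthogonal to all \<open>(S\<^sup>2 v, T S\<^sup>2 v)\<close> has first component orthogonal to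
  \<open>(1 + T*T)S\<^sup>2 v = v\<close> for all \<open>v\<close>.
\<close>

lemma closed_relation_quotient:
  fixes S C :: "'a::{real_inner,complete_space} \<Rightarrow> 'a"
  assumes G: "closed G" "subspace G" "single_valued G" and SC: "cos_sin S C"
    and eq: "G O adj G = range (\<lambda>w. (S (S w), C (C w)))"
    and sv: "single_valued (G O adj G)"
  shows "\<exists>Z. bounded_linear Z \<and> (\<forall>w. norm (Z w) = norm (C w)) \<and> G = range (\<lambda>w. (S w, Z w))"
proof -
  note S = cos_sin_S[OF SC] and C = cos_sin_C[OF SC]
  interpret S: bounded_linear S by (rule pos_map_linear[OF S])
  interpret C: bounded_linear C by (rule pos_map_linear[OF C])
  note dense = dense_quotient[OF SC sv[unfolded eq]]
  have on_range: "\<exists>u. (S (S v), u) \<in> G \<and> (u, C (C v)) \<in> adj G \<and> norm u = norm (C (S v))" for v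
  proof -
    have "(S (S v), C (C v)) \<in> G O adj G" unfolding eq by blast
    then obtain u where u: "(S (S v), u) \<in> G" "(u, C (C v)) \<in> adj G" by blast
    from adjD[OF u(2,1)] have "u \<bullet> u = C (S v) \<bullet> C (S v)"
      by (simp add: pos_map_inner[OF S] pos_map_inner[OF C] cos_sin_commute[OF SC])
    then show ?thesis using u by (auto simp: norm_eq_sqrt_inner)
  qed
  then obtain U where U: "\<And>v. (S (S v), U v) \<in> G" "\<And>v. (U v, C (C v)) \<in> adj G"
    "\<And>v. norm (U v) = norm (C (S v))" by metis
  have U_diff: "norm (U v - U v') = norm (C (S v - S v'))" for v v'
  proof -
    have "(S (S (v - v')), U v - U v') \<in> G"
      using subspace_diff[OF G(2) U(1)[of v] U(1)[of v']] by (simp add: S.diff)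
    then have "U v - U v' = U (v - v')" using single_valuedD[OF G(3)] U(1) by blast
    then show ?thesis using U(3)[of "v - v'"] by (simp add: S.diff)
  qed
  have "\<exists>u. (S w, u) \<in> G \<and> norm u = norm (C w)" for w
  proof -
    have "w \<in> closure (range S)" using dense by simp
    then obtain g where "\<And>n. g n \<in> range S" and gw: "g \<longlonglongrightarrow> w" unfolding closure_sequential by blast
    then have "\<forall>n. \<exists>v. g n = S v" by blast
    then obtain v where "\<forall>n. g n = S (v n)" by metis
    then have g: "g = (\<lambda>n. S (v n))" by blast
    have Cg: "(\<lambda>n. C (g n)) \<longlonglongrightarrow> C w" by (rule C.tendsto[OF gw])
    have "Cauchy (\<lambda>n. U (v n))"
      by (rule Cauchy_of_dist_le[OF LIMSEQ_imp_Cauchy[OF Cg], of _ 1])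
        (simp add: dist_norm U_diff g C.diff)
    then obtain u where u: "(\<lambda>n. U (v n)) \<longlonglongrightarrow> u" using Cauchy_convergent_iff convergent_def by blast
    have "(\<lambda>n. (S (g n), U (v n))) \<longlonglongrightarrow> (S w, u)" by (intro tendsto_Pair u S.tendsto gw)
    then have "(S w, u) \<in> G"
      by (rule closed_sequentially[OF G(1), rotated]) (simp add: g U)
    moreover have "norm u = norm (C w)"
      using LIMSEQ_unique[OF tendsto_norm[OF u]] tendsto_norm[OF Cg] by (simp add: U(3) g)
    ultimately show ?thesis by blast
  qed
  then obtain Z where Z: "\<And>w. (S w, Z w) \<in> G" "\<And>w. norm (Z w) = norm (C w)" by metis
  obtain K where K: "\<And>w. norm (C w) \<le> norm w * K" using C.bounded by blast
  have lin: "bounded_linear Z"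
  proof (rule bounded_linear_intro[where K = K])
    show "Z (x + y) = Z x + Z y" for x y
      using single_valuedD[OF G(3) Z(1)[of "x + y"]] subspace_add[OF G(2) Z(1)[of x] Z(1)[of y]]
      by (simp add: S.add)
    show "Z (r *\<^sub>R x) = r *\<^sub>R Z x" for r x
      using single_valuedD[OF G(3) Z(1)[of "r *\<^sub>R x"]] subspace_mul[OF G(2) Z(1)[of x], of r]
      by (simp add: S.scaleR)
  qed (simp add: Z K)
  let ?M = "range (\<lambda>w. (S w, Z w))"
  have closed: "closed ?M"
  proof (rule closed_range_bounded_below)
    show "bounded_linear (\<lambda>w. (S w, Z w))" by (intro bounded_linear_Pair S.bounded_linear_axioms lin)
    show "norm w \<le> 1 * norm (S w, Z w)" for w
      by (simp add: norm_Pair Z cos_sin_norm[OF SC])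
  qed
  have sub: "subspace ?M" by (intro subspace_range_pair S.linear_axioms bounded_linear.linear[OF lin])
  have "z \<in> ?M" if "z \<in> G" for z
  proof -
    obtain pp where pp: "pp \<in> ?M" "\<forall>m\<in>?M. (z - pp) \<bullet> m = 0"
      using orthogonal_projection_exists[OF closed sub, of z] by blast
    have "pp \<in> G" using pp(1) Z(1) by auto
    with that have zG: "z - pp \<in> G" using subspace_diff[OF G(2)] by blast
    obtain x u where xu: "z - pp = (x, u)" by (cases "z - pp")
    have "x \<bullet> v = 0" for v
    proof -
      have "U v = Z (S v)" using single_valuedD[OF G(3) U(1)[of v] Z(1)[of "S v"]] .
      have "x \<bullet> S (S v) + u \<bullet> Z (S v) = 0" using pp(2) xu by auto
      moreover have "u \<bullet> Z (S v) = x \<bullet> C (C v)"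
        using adjD[OF U(2)[of v] zG[unfolded xu]] \<open>U v = Z (S v)\<close> by simp
      ultimately have "x \<bullet> (S (S v) + C (C v)) = 0" by (simp add: inner_add)
      then show ?thesis by (simp add: cos_sin_sum[OF SC])
    qed
    from this[of x] have "x = 0" by simp
    then have "u = 0" using single_valuedD[OF G(3) zG[unfolded xu]] subspace_0[OF G(2)]
      by (simp add: zero_prod_def)
    with \<open>x = 0\<close> xu pp(1) show ?thesis by (simp add: zero_prod_def[symmetric])
  qed
  then have "G = ?M" using Z(1) by auto
  then show ?thesis using lin Z(2) by blast
qed

lemma inner_eq_of_norm_eq:
  assumes "linear f" "linear g" "\<And>w. norm (f w) = norm (g w)"
  shows "f v \<bullet> f w = g v \<bullet> g w"
  unfolding dot_norm using assms(3)[of "v + w"] assms(3)[of v] assms(3)[of w]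
  by (simp add: linear_add assms(1,2))

text \<open>
  Another square root \<open>L\<close> of \<open>C\<^sup>2 S\<^sup>-\<^sup>2\<close> is of the form \<open>Z S\<^sup>-\<^sup>1\<close> with \<open>Z\<close> bounded. Both \<open>SZ\<close> and \<open>SC\<close>
  are positive square roots of \<open>S\<^sup>2 C\<^sup>2\<close>, so they agree by uniqueness for bounded maps, and \<open>S\<close>
  cancels because it is injective.
\<close>

lemma psa_sqrt_unique:
  fixes S C :: "'a::{real_inner,complete_space} \<Rightarrow> 'a"
  assumes L: "psa L" "single_valued L" and SC: "cos_sin S C"
    and eq: "L O L = range (\<lambda>w. (S (S w), C (C w)))"
  shows "L = range (\<lambda>w. (S w, C w))"
proof -
  note S = cos_sin_S[OF SC] and C = cos_sin_C[OF SC]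
  interpret S: bounded_linear S by (rule pos_map_linear[OF S])
  interpret C: bounded_linear C by (rule pos_map_linear[OF C])
  note cl = psa_closed[OF L(1)] psa_subspace[OF L(1)]
  have sv: "single_valued (L O adj L)" using L by (simp add: psa_adj single_valued_relcomp)
  have eq': "L O adj L = range (\<lambda>w. (S (S w), C (C w)))" using eq by (simp add: psa_adj[OF L(1)])
  note inj = inj_quotient[OF SC sv[unfolded eq']] and dense = dense_quotient[OF SC sv[unfolded eq']]
  obtain Z where Z: "bounded_linear Z" "\<And>w. norm (Z w) = norm (C w)" "L = range (\<lambda>w. (S w, Z w))"
    using closed_relation_quotient[OF cl L(2) SC eq' sv] by blast
  interpret Z: bounded_linear Z by (rule Z(1))
  have inL: "(S w, Z w) \<in> L" for w using Z(3) by blast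
  have ZL: "u = Z w" if "(S w, u) \<in> L" for w u using single_valuedD[OF L(2) that inL] .
  have inv: "invariant L S" "invariant L C"
    using resolvent_invariant[OF cl SC eq'] by (simp_all add: psa_adj[OF L(1)])
  have SZ: "S (Z w) = Z (S w)" for w
    using inv(1) inL[of w] by (intro ZL) (simp add: invariant_def)
  have CZ: "C (Z w) = Z (C w)" for w
    using inv(2) inL[of w] by (intro ZL) (simp add: invariant_def cos_sin_commute[OF SC])
  have sym: "Z w \<bullet> S v = S w \<bullet> Z v" for w v by (rule psa_sym[OF L(1) inL inL])
  have Z_sym: "Z w \<bullet> v = w \<bullet> Z v" for w v
  proof (rule closed_linear_eqI[OF dense, of "\<lambda>v. Z w \<bullet> v" "\<lambda>v. w \<bullet> Z v"])
    show "bounded_linear (\<lambda>v. Z w \<bullet> v)" by (rule bounded_linear_inner_right)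
    show "bounded_linear (\<lambda>v. w \<bullet> Z v)"
      by (rule bounded_linear_compose[OF bounded_linear_inner_right Z(1)])
    fix m assume "m \<in> range S"
    then show "Z w \<bullet> m = w \<bullet> Z m"
      by (auto simp: sym) (simp add: SZ[symmetric] pos_map_inner[OF S])
  qed
  have ZZ: "Z (Z w) = C (C w)" for w
  proof -
    have "(Z (Z w) - C (C w)) \<bullet> v = 0" for v
      using inner_eq_of_norm_eq[OF Z.linear_axioms C.linear_axioms Z(2), of w v]
      by (simp add: inner_diff Z_sym pos_map_inner[OF C])
    from this[of "Z (Z w) - C (C w)"] show ?thesis by simp
  qed
  have pos: "pos_map (\<lambda>w. S (Z w))"
    unfolding pos_map_def sym_map_def
  proof (intro conjI allI)
    show "bounded_linear (\<lambda>w. S (Z w))" by (rule bounded_linear_compose[OF S.bounded_linear_axioms Z(1)])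
    show "S (Z x) \<bullet> y = x \<bullet> S (Z y)" for x y by (simp add: pos_map_inner[OF S] sym)
    show "0 \<le> S (Z x) \<bullet> x" for x
      using psa_nonneg[OF L(1) inL[of x]] by (simp add: pos_map_inner[OF S])
  qed
  have "(\<lambda>w. S (Z w)) = (\<lambda>w. S (C w))"
  proof (rule pos_map_sqrt_unique[OF pos pos_map_mult[OF S C cos_sin_commute[OF SC]]])
    show "S (Z (S (C x))) = S (C (S (Z x)))" for x
      by (simp add: SZ[symmetric] cos_sin_commute[OF SC, symmetric] CZ)
    show "S (Z (S (Z x))) = S (C (S (C x)))" for x
      by (simp add: SZ[symmetric] cos_sin_commute[OF SC, symmetric] ZZ)
  qed
  then have "S (Z w) = S (C w)" for w by (rule fun_cong)
  then have "S (Z w - C w) = 0" for w by (simp add: S.diff)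
  from inj[OF this] have "Z w = C w" for w by simp
  then have "Z = C" by (rule ext)
  then show ?thesis using Z(3) by simp
qed

section \<open>The Heinz inequality\<close>

lemma log_convex_bounded:
  fixes a :: "nat \<Rightarrow> real"
  assumes nonneg: "\<And>n. 0 \<le> a n" and convex: "\<And>n. (a (Suc n))\<^sup>2 \<le> a n * a (Suc (Suc n))"
    and bound: "\<And>n. a n \<le> M"
  shows "a 1 \<le> a 0"
proof (rule ccontr)
  assume gt: "\<not> a 1 \<le> a 0"
  have a0: "a 0 > 0"
  proof (rule ccontr)
    assume "\<not> a 0 > 0"
    then have "a 0 = 0" using nonneg[of 0] by simp
    then have "(a 1)\<^sup>2 \<le> 0" using convex[of 0] by simp
    then show False using gt \<open>a 0 = 0\<close> by simp
  qed
  define q where "q = a 1 / a 0"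
  have q: "q > 1" using gt a0 by (simp add: q_def)
  have ratio: "0 < a n \<and> q * a n \<le> a (Suc n)" for n
  proof (induction n)
    case 0
    then show ?case using a0 by (simp add: q_def)
  next
    case (Suc n)
    then have pos: "0 < a (Suc n)" using q by (smt (verit) mult_pos_pos)
    have "q * a (Suc n) * a n \<le> a (Suc n) * a (Suc n)"
      using Suc pos by (simp add: mult_ac)
    also have "\<dots> \<le> a (Suc (Suc n)) * a n"
      using convex[of n] by (simp add: power2_eq_square mult_ac)
    finally show ?case using Suc pos by (simp add: mult_le_cancel_right)
  qed
  have "a 0 * q ^ n \<le> a n" for n
  proof (induction n)
    case (Suc n)
    have "a 0 * q ^ Suc n \<le> q * a n" using Suc q by (simp add: mult_ac)
    also have "\<dots> \<le> a (Suc n)" using ratio by blast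
    finally show ?case .
  qed simp
  moreover obtain n where "M / a 0 < q ^ n" using real_arch_pow[OF q] by blast
  ultimately have "M < a n" using a0 by (smt (verit) pos_divide_less_eq mult.commute)
  with bound[of n] show False by simp
qed

text \<open>
  With \<open>a\<^sub>n = \<langle>R \<kappa>\<^sup>n y, \<kappa>\<^sup>n y\<rangle>\<close>, symmetry of \<open>\<kappa>\<close> for the form of \<open>R\<close> and the Cauchy-Schwarz inequality
  give log-convexity. A bounded log-convex sequence cannot start with an increase, so
  \<open>a\<^sub>1 \<le> a\<^sub>0\<close>, that is, \<open>\<kappa>\<close> is a contraction for the form of \<open>R\<close> as well.
\<close>

lemma symmetrizable_contraction:
  assumes R: "pos_map R" and sym: "\<And>a b. \<kappa> a \<bullet> R b = R a \<bullet> \<kappa> b"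
    and contr: "\<And>y. norm (\<kappa> y) \<le> norm y"
  shows "\<kappa> y \<bullet> R y \<le> y \<bullet> R y"
proof -
  define a where "a n = R ((\<kappa> ^^ n) y) \<bullet> (\<kappa> ^^ n) y" for n
  obtain K where K: "K > 0" "\<And>x. R x \<bullet> x \<le> K * (x \<bullet> x)" using pos_map_bound[OF R] by blast
  have iter: "norm ((\<kappa> ^^ n) y) \<le> norm y" for n
  proof (induction n)
    case (Suc n)
    then show ?case using contr[of "(\<kappa> ^^ n) y"] by simp
  qed simp
  have bound: "a n \<le> K * (norm y)\<^sup>2" for n
  proof -
    have "a n \<le> K * (norm ((\<kappa> ^^ n) y))\<^sup>2" using K(2) by (simp add: a_def power2_norm_eq_inner)
    also have "\<dots> \<le> K * (norm y)\<^sup>2" using K(1) iter by (intro mult_left_mono power_mono) auto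
    finally show ?thesis .
  qed
  have "a 1 \<le> a 0"
  proof (rule log_convex_bounded[OF _ _ bound])
    show "0 \<le> a n" for n by (simp add: a_def pos_map_nonneg[OF R])
    show "(a (Suc n))\<^sup>2 \<le> a n * a (Suc (Suc n))" for n
    proof -
      let ?u = "(\<kappa> ^^ n) y"
      have "a (Suc n) = R ?u \<bullet> \<kappa> (\<kappa> ?u)"
        using sym[of ?u "\<kappa> ?u"] by (simp add: a_def inner_commute)
      then show ?thesis
        using pos_map_Cauchy_Schwarz[OF R, of ?u "\<kappa> (\<kappa> ?u)"] by (simp add: a_def)
    qed
  qed
  then have "(R y \<bullet> \<kappa> y)\<^sup>2 \<le> (a 0)\<^sup>2"
    using pos_map_Cauchy_Schwarz[OF R, of y "\<kappa> y"] pos_map_nonneg[OF R, of y]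
      mult_left_mono[of "a 1" "a 0" "a 0"]
    by (simp add: a_def power2_eq_square)
  then have "\<bar>R y \<bullet> \<kappa> y\<bar> \<le> \<bar>a 0\<bar>" by (simp add: abs_le_square_iff)
  then show ?thesis using pos_map_nonneg[OF R, of y] by (simp add: a_def inner_commute)
qed

text \<open>
  Take \<open>R = (1 + L)\<^sup>-\<^sup>1\<close> and \<open>\<kappa> = KR\<close>, which satisfies \<open>\<parallel>\<kappa>w\<parallel> \<le> \<parallel>LRw\<parallel> = \<parallel>w - Rw\<parallel> \<le> \<parallel>w\<parallel>\<close>.
\<close>

lemma heinz_resolvent:
  fixes K L :: "('a::{real_inner,complete_space} \<times> 'a) set"
  assumes L: "psa L" and K: "\<And>x k y j. (x, k) \<in> K \<Longrightarrow> (y, j) \<in> K \<Longrightarrow> k \<bullet> y = x \<bullet> j"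
    and dom: "\<And>x l. (x, l) \<in> L \<Longrightarrow> \<exists>k. (x, k) \<in> K \<and> norm k \<le> norm l"
    and xl: "(x, l) \<in> L" and xk: "(x, k) \<in> K"
  shows "k \<bullet> x \<le> l \<bullet> x + x \<bullet> x"
proof -
  obtain R where R: "pos_map R" "\<And>x. R x \<bullet> x \<le> x \<bullet> x" "L = range (\<lambda>w. (R w, w - R w))"
    using psa_resolvent[OF L] by blast
  have "\<exists>k. (R w, k) \<in> K \<and> norm k \<le> norm (w - R w)" for w using dom R(3) by blast
  then obtain \<kappa> where \<kappa>: "\<And>w. (R w, \<kappa> w) \<in> K" "\<And>w. norm (\<kappa> w) \<le> norm (w - R w)" by metis
  have "norm (w - R w) \<le> 1 * norm w" for w
  proof (rule pos_map_norm_le)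
    have "bounded_linear (\<lambda>w. w - R w)"
      by (intro bounded_linear_sub bounded_linear_ident pos_map_linear R)
    then show "pos_map (\<lambda>w. w - R w)"
      using R(2) by (simp add: pos_map_def sym_map_def inner_diff pos_map_inner[OF R(1)])
    show "(x - R x) \<bullet> x \<le> 1 * (x \<bullet> x)" for x
      using pos_map_nonneg[OF R(1), of x] by (simp add: inner_diff)
  qed
  then have contr: "norm (\<kappa> w) \<le> norm w" for w using order_trans[OF \<kappa>(2)] by simp
  obtain y where y: "x = R y" "l = y - R y" using xl R(3) by auto
  have "k \<bullet> x = \<kappa> y \<bullet> R y" using K[OF xk \<kappa>(1)[of y]] by (simp add: y inner_commute)
  also have "\<dots> \<le> y \<bullet> R y" by (rule symmetrizable_contraction[OF R(1) K[OF \<kappa>(1) \<kappa>(1)] contr])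
  also have "\<dots> = l \<bullet> x + x \<bullet> x" by (simp add: y inner_diff)
  finally show ?thesis .
qed

lemma psa_scale:
  assumes L: "psa L" and t: "t > 0" shows "psa ((\<lambda>(x, l). (x, t *\<^sub>R l)) ` L)" (is "psa ?L")
  unfolding psa_def
proof (intro conjI allI impI set_eqI iffI)
  fix p assume "p \<in> adj ?L"
  then obtain y z where p: "p = (y, z)" "(y, z) \<in> adj ?L" by (cases p) auto
  have "(y, (1/t) *\<^sub>R z) \<in> adj L"
  proof (rule adjI)
    fix x u assume "(x, u) \<in> L"
    then have "(t *\<^sub>R u) \<bullet> y = x \<bullet> z" by (intro adjD[OF p(2)]) force
    then show "u \<bullet> y = x \<bullet> (1/t) *\<^sub>R z" using t by (simp add: field_simps)
  qed
  then have "(y, (1/t) *\<^sub>R z) \<in> L" by (simp add: psa_adj[OF L])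
  then show "p \<in> ?L" using t by (intro image_eqI[of _ _ "(y, (1/t) *\<^sub>R z)"]) (simp_all add: p)
next
  fix p assume "p \<in> ?L"
  then show "p \<in> adj ?L" using psa_sym[OF L] by (auto intro!: adjI)
next
  fix x u assume "(x, u) \<in> ?L"
  then show "0 \<le> u \<bullet> x" using psa_nonneg[OF L] t by auto
qed

text \<open>
  Homogeneity sharpens the previous bound: it also holds for \<open>tK\<close> and \<open>tL\<close> with any \<open>t > 0\<close>.
\<close>

lemma heinz_form:
  fixes K L :: "('a::{real_inner,complete_space} \<times> 'a) set"
  assumes L: "psa L" and K: "\<And>x k y j. (x, k) \<in> K \<Longrightarrow> (y, j) \<in> K \<Longrightarrow> k \<bullet> y = x \<bullet> j"
    and dom: "\<And>x l. (x, l) \<in> L \<Longrightarrow> \<exists>k. (x, k) \<in> K \<and> norm k \<le> norm l"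
    and xl: "(x, l) \<in> L" and xk: "(x, k) \<in> K"
  shows "k \<bullet> x \<le> l \<bullet> x"
proof (rule field_le_epsilon)
  fix e :: real assume e: "e > 0"
  define t where "t = (x \<bullet> x + 1) / e"
  have t: "t > 0" using e by (simp add: t_def add_nonneg_pos)
  let ?K = "(\<lambda>(x, l). (x, t *\<^sub>R l)) ` K" and ?L = "(\<lambda>(x, l). (x, t *\<^sub>R l)) ` L"
  have "(t *\<^sub>R k) \<bullet> x \<le> (t *\<^sub>R l) \<bullet> x + x \<bullet> x"
  proof (rule heinz_resolvent[of ?L ?K, OF psa_scale[OF L t]])
    show "a \<bullet> y = z \<bullet> j" if "(z, a) \<in> ?K" "(y, j) \<in> ?K" for z a y j
      using that K by auto
    show "\<exists>k. (z, k) \<in> ?K \<and> norm k \<le> norm a" if za: "(z, a) \<in> ?L" for z a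
    proof -
      obtain b where b: "(z, b) \<in> L" "a = t *\<^sub>R b" using za by auto
      obtain k where "(z, k) \<in> K" "norm k \<le> norm b" using dom[OF b(1)] by blast
      then show ?thesis
        using t b(2) by (intro exI[of _ "t *\<^sub>R k"]) (auto intro!: image_eqI mult_left_mono)
    qed
  qed (use xl xk in force)+
  then have "k \<bullet> x \<le> l \<bullet> x + x \<bullet> x / t" using t by (simp add: field_simps)
  also have "x \<bullet> x / t \<le> e"
  proof -
    have "e * (x \<bullet> x) \<le> e * (x \<bullet> x + 1)" using e by (intro mult_left_mono) auto
    moreover have "0 < x \<bullet> x + 1" by (simp add: add_nonneg_pos)
    ultimately show ?thesis using e by (simp add: t_def divide_le_eq mult.commute)
  qed
  finally show "k \<bullet> x \<le> l \<bullet> x + e" by simp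
qed

text \<open>
  The inequality \<open>\<langle>Kx, x\<rangle> \<le> \<langle>Lx, x\<rangle>\<close> reads \<open>\<parallel>K\<^sup>1\<^sup>/\<^sup>2 x\<parallel> \<le> \<parallel>L\<^sup>1\<^sup>/\<^sup>2 x\<parallel>\<close> on the domain of \<open>L\<close>. That
  domain is a core of \<open>L\<^sup>1\<^sup>/\<^sup>2\<close>, and \<open>K\<^sup>1\<^sup>/\<^sup>2\<close> is closed, so the inequality extends to the domain
  of \<open>L\<^sup>1\<^sup>/\<^sup>2\<close>.
\<close>

lemma heinz_sqrt:
  fixes K L KS :: "('a::{real_inner,complete_space} \<times> 'a) set"
  assumes K: "psa KS" "single_valued KS" "KS O KS = K"
    and L: "L = range (\<lambda>w. (S (S w), C (C w)))" "cos_sin S C" "single_valued L"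
    and dom: "\<And>x l. (x, l) \<in> L \<Longrightarrow> \<exists>k. (x, k) \<in> K \<and> norm k \<le> norm l"
  shows "\<exists>j. (S w, j) \<in> KS \<and> norm j \<le> norm (C w)"
proof -
  note S = cos_sin_S[OF L(2)] and C = cos_sin_C[OF L(2)]
  interpret S: bounded_linear S by (rule pos_map_linear[OF S])
  interpret C: bounded_linear C by (rule pos_map_linear[OF C])
  note sub = psa_subspace[OF K(1)]
  have psaL: "psa L"
    using von_neumann[OF psa_closed[OF psa_quotient[OF L(2)]] psa_subspace[OF psa_quotient[OF L(2)]]]
    by (simp add: psa_adj[OF psa_quotient[OF L(2)]] quotient_square[OF L(2)] L(1))
  have symK: "k \<bullet> y = x \<bullet> j" if xk: "(x, k) \<in> K" and yj: "(y, j) \<in> K" for x k y j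
  proof -
    obtain a b where "(x, a) \<in> KS" "(a, k) \<in> KS" "(y, b) \<in> KS" "(b, j) \<in> KS"
      using xk yj K(3) by blast
    then have "a \<bullet> b = x \<bullet> j" "b \<bullet> a = y \<bullet> k" using psa_sym[OF K(1)] by blast+
    then show ?thesis by (simp add: inner_commute)
  qed
  have "\<exists>j. (S (S v), j) \<in> KS \<and> norm j \<le> norm (C (S v))" for v
  proof -
    have inL: "(S (S v), C (C v)) \<in> L" using L(1) by blast
    obtain k where k: "(S (S v), k) \<in> K" using dom[OF inL] by blast
    obtain j where j: "(S (S v), j) \<in> KS" "(j, k) \<in> KS" using k K(3) by blast
    have "j \<bullet> j = k \<bullet> S (S v)" using psa_sym[OF K(1) j] by (simp add: inner_commute)
    also have "\<dots> \<le> C (C v) \<bullet> S (S v)" by (rule heinz_form[OF psaL symK dom inL k])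
    also have "\<dots> = C (S v) \<bullet> C (S v)"
      by (simp add: pos_map_inner[OF S] pos_map_inner[OF C] cos_sin_commute[OF L(2)])
    finally show ?thesis using j(1) by (auto simp: norm_eq_sqrt_inner)
  qed
  then obtain J where J: "\<And>v. (S (S v), J v) \<in> KS" "\<And>v. norm (J v) \<le> norm (C (S v))" by metis
  have J_diff: "norm (J v - J v') \<le> norm (C (S v - S v'))" for v v'
  proof -
    have "(S (S (v - v')), J v - J v') \<in> KS"
      using subspace_diff[OF sub J(1)[of v] J(1)[of v']] by (simp add: S.diff)
    then have "J v - J v' = J (v - v')" using single_valuedD[OF K(2)] J(1) by blast
    then show ?thesis using J(2)[of "v - v'"] by (simp add: S.diff)
  qed
  have "w \<in> closure (range S)" using dense_quotient[OF L(2) L(3)[unfolded L(1)]] by simp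
  then obtain g where "\<And>n. g n \<in> range S" and gw: "g \<longlonglongrightarrow> w" unfolding closure_sequential by blast
  then have "\<forall>n. \<exists>v. g n = S v" by blast
  then obtain v where "\<forall>n. g n = S (v n)" by metis
  then have g: "g = (\<lambda>n. S (v n))" by blast
  have Cg: "(\<lambda>n. C (g n)) \<longlonglongrightarrow> C w" by (rule C.tendsto[OF gw])
  have "dist (J (v m)) (J (v n)) \<le> 1 * dist (C (g m)) (C (g n))" for m n
    using J_diff[of "v m" "v n"] by (simp add: dist_norm g C.diff)
  from Cauchy_of_dist_le[OF LIMSEQ_imp_Cauchy[OF Cg] this]
  have "Cauchy (\<lambda>n. J (v n))" .
  then obtain j where j: "(\<lambda>n. J (v n)) \<longlonglongrightarrow> j" using Cauchy_convergent_iff convergent_def by blast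
  have "(\<lambda>n. (S (g n), J (v n))) \<longlonglongrightarrow> (S w, j)" by (intro tendsto_Pair j S.tendsto gw)
  then have "(S w, j) \<in> KS"
    by (rule closed_sequentially[OF psa_closed[OF K(1)], rotated]) (simp add: g J)
  moreover have "norm j \<le> norm (C w)"
    using J(2) by (intro LIMSEQ_le[OF tendsto_norm[OF j] tendsto_norm[OF Cg]]) (simp add: g)
  ultimately show ?thesis by blast
qed

section \<open>Spectral projections\<close>

lemma proj_mapD:
  assumes "proj_map E"
  shows proj_map_linear: "bounded_linear E"
    and proj_map_idem: "E (E x) = E x" and proj_map_inner: "E x \<bullet> y = x \<bullet> E y"
  using assms by (auto simp: proj_map_def sym_map_def)

lemma proj_map_pythagoras:
  assumes "proj_map E" shows "(norm x)\<^sup>2 = (norm (E x))\<^sup>2 + (norm (x - E x))\<^sup>2"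
  by (simp add: power2_norm_eq_inner inner_diff proj_map_inner[OF assms] proj_map_idem[OF assms])

lemma proj_map_norm_le:
  assumes "proj_map E" shows "norm (E x) \<le> norm x" "norm (x - E x) \<le> norm x"
proof -
  note pyth = proj_map_pythagoras[OF assms, of x]
  show "norm (E x) \<le> norm x" by (rule power2_le_imp_le) (simp_all add: pyth)
  show "norm (x - E x) \<le> norm x" by (rule power2_le_imp_le) (simp_all add: pyth)
qed

lemma sym_map_function_of:
  assumes "function_of T f" "bounded_linear T" shows "T (f x) = f (T x)"
  using function_of_commute[OF assms] by simp

lemma function_of_functions_commute:
  assumes "function_of T f" "function_of T g" "bounded_linear T" "bounded_linear g"
  shows "f (g x) = g (f x)"
  using function_of_commute[OF assms(1,4)] sym_map_function_of[OF assms(2,3)] by simp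

text \<open>
  \<open>E\<close> is the spectral projection of \<open>T\<close> for the half-line from \<open>c\<close> upwards. The strict inequality
  on the complement assigns the spectral value \<open>c\<close> itself to the range of \<open>E\<close>.
\<close>

definition spectral_cut :: "('a::real_inner \<Rightarrow> 'a) \<Rightarrow> real \<Rightarrow> ('a \<Rightarrow> 'a) \<Rightarrow> bool" where
  "spectral_cut T c E \<longleftrightarrow> proj_map E \<and> function_of T E \<and>
     (\<forall>x. E x = x \<longrightarrow> c * (x \<bullet> x) \<le> T x \<bullet> x) \<and>
     (\<forall>x. E x = 0 \<longrightarrow> x \<noteq> 0 \<longrightarrow> T x \<bullet> x < c * (x \<bullet> x))"

lemma spectral_cutD:
  assumes "spectral_cut T c E"
  shows spectral_cut_proj: "proj_map E" and spectral_cut_fun: "function_of T E"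
    and spectral_cut_ge: "E x = x \<Longrightarrow> c * (x \<bullet> x) \<le> T x \<bullet> x"
    and spectral_cut_less: "E x = 0 \<Longrightarrow> x \<noteq> 0 \<Longrightarrow> T x \<bullet> x < c * (x \<bullet> x)"
  using assms by (simp_all add: spectral_cut_def)

lemma spectral_cut_le:
  assumes "spectral_cut T c E" "E x = 0" shows "T x \<bullet> x \<le> c * (x \<bullet> x)"
  using spectral_cut_less[OF assms] by (cases "x = 0") simp_all

text \<open>
  For \<open>V = T - c\<close>, the projection onto the kernel of \<open>W = |V| - V\<close>, twice the negative part of \<open>V\<close>,
  does it: on the kernel \<open>V = |V|\<close>, and on its complement \<open>V = -|V|\<close>, because \<open>|V| + V\<close> is
  symmetric with range in the kernel.
\<close>

lemma spectral_cut_exists: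
  fixes T :: "'a::{real_inner,complete_space} \<Rightarrow> 'a"
  assumes T: "sym_map T" shows "\<exists>E. spectral_cut T c E"
proof -
  interpret T: bounded_linear T by (rule sym_map_linear[OF T])
  define V where "V x = T x - c *\<^sub>R x" for x
  have V_lin: "bounded_linear V"
    unfolding V_def
    by (intro bounded_linear_sub T.bounded_linear_axioms bounded_linear_const_scaleR bounded_linear_ident)
  interpret V: bounded_linear V by (rule V_lin)
  have V_sym: "V x \<bullet> y = x \<bullet> V y" for x y
    by (simp add: V_def inner_diff sym_map_inner[OF T])
  have TV: "function_of T V"
    unfolding V_def function_of_def by (intro allI impI invariant_diff invariant_scaleR invariant_id)
  have V2: "pos_map (\<lambda>x. V (V x))"
    unfolding pos_map_def sym_map_def
  proof (intro conjI allI)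
    show "0 \<le> V (V x) \<bullet> x" for x using V_sym[of "V x" x] by simp
  qed (simp_all add: V_sym bounded_linear_compose[OF V_lin V_lin])
  obtain A where A: "pos_map A" "\<And>x. A (A x) = V (V x)" "function_of (\<lambda>x. V (V x)) A"
    using pos_map_sqrt_exists[OF V2] by blast
  interpret A: bounded_linear A by (rule pos_map_linear[OF A(1)])
  have "function_of V (\<lambda>x. V (V x))" by (auto simp: function_of_def invariant_def)
  then have VA: "function_of V A" using A(3) function_of_trans by blast
  have AV: "A (V x) = V (A x)" for x using sym_map_function_of[OF VA V_lin] by simp
  define W where "W x = A x - V x" for x
  have W_lin: "bounded_linear W"
    unfolding W_def by (intro bounded_linear_sub A.bounded_linear_axioms V_lin)
  have W: "sym_map W"
    unfolding sym_map_def using W_lin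
    by (simp add: W_def inner_diff pos_map_inner[OF A(1)] V_sym)
  have "function_of V W"
    using VA unfolding W_def function_of_def by (blast intro: invariant_diff)
  then have TW: "function_of T W" using TV function_of_trans by blast
  obtain E where E: "proj_map E" "\<And>x. E x = x \<longleftrightarrow> W x = 0" "function_of W E"
    using kernel_projection[OF W] by blast
  have "c * (x \<bullet> x) \<le> T x \<bullet> x" if "E x = x" for x
  proof -
    have "A x = V x" using that E(2) by (simp add: W_def)
    then have "0 \<le> V x \<bullet> x" using pos_map_nonneg[OF A(1), of x] by simp
    then show ?thesis by (simp add: V_def inner_diff)
  qed
  moreover have "T x \<bullet> x < c * (x \<bullet> x)" if x: "E x = 0" "x \<noteq> 0" for x
  proof -
    have in_ker: "E (A y + V y) = A y + V y" for y
      by (simp add: E(2) W_def A.add V.add AV A(2))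
    define y where "y = A x + V x"
    have "y \<bullet> y = x \<bullet> (A y + V y)"
      by (subst (1) y_def) (simp add: inner_add pos_map_inner[OF A(1)] V_sym)
    also have "\<dots> = E x \<bullet> (A y + V y)" by (simp add: proj_map_inner[OF E(1)] in_ker)
    finally have "y = 0" by (simp add: x)
    then have Vx: "V x = - A x" by (simp add: y_def add_eq_0_iff)
    have "A x \<bullet> x \<noteq> 0"
    proof
      assume "A x \<bullet> x = 0"
      then have "A x = 0" using pos_map_eq_0[OF A(1)] by blast
      then have "W x = 0" by (simp add: W_def Vx)
      then show False using x E(2)[of x] by simp
    qed
    then have "A x \<bullet> x > 0" using pos_map_nonneg[OF A(1), of x] by simp
    then have "V x \<bullet> x < 0" by (simp add: Vx)
    then show ?thesis by (simp add: V_def inner_diff)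
  qed
  moreover have "function_of T E" using TW E(3) function_of_trans by blast
  ultimately show ?thesis using E(1) unfolding spectral_cut_def by blast
qed

section \<open>Commutation with the modulus\<close>

text \<open>
  The range of the spectral projection of \<open>R = (1 + T*T)\<^sup>-\<^sup>1\<close> for \<open>R \<ge> c\<close> is the one of \<open>T*T\<close> for
  \<open>T*T \<le> 1/c - 1\<close>. There \<open>R\<close> is bounded below, hence onto, and so its vectors lie in the domain
  of \<open>T\<close>.
\<close>

lemma cut_upper_bound:
  fixes S C :: "'a::{real_inner,complete_space} \<Rightarrow> 'a"
  assumes G: "closed G" "subspace G" and SC: "cos_sin S C"
    and eq: "G O adj G = range (\<lambda>w. (S (S w), C (C w)))" "adj G O G = G O adj G"
    and E: "spectral_cut (\<lambda>x. S (S x)) c E" and c: "c > 0" and x: "E x = x"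
  shows "\<exists>u. (x, u) \<in> G \<and> E u = u \<and> (norm u)\<^sup>2 \<le> (1/c - 1) * (norm x)\<^sup>2"
proof -
  define R where "R x = S (S x)" for x
  have E: "spectral_cut R c E" using E by (simp add: R_def[abs_def])
  note P = spectral_cut_proj[OF E]
  have R: "pos_map R"
    unfolding R_def by (rule pos_map_mult) (simp_all add: cos_sin_S[OF SC])
  interpret R: bounded_linear R by (rule pos_map_linear[OF R])
  interpret E: bounded_linear E by (rule proj_map_linear[OF P])
  have RE: "R (E y) = E (R y)" for y
    by (rule sym_map_function_of[OF spectral_cut_fun[OF E] R.bounded_linear_axioms])
  \<comment> \<open>\<open>R\<close> on the range of \<open>E\<close> and the constant \<open>c\<close> on its complement: coercive on the whole space.\<close>
  define f where "f y = R (E y) + c *\<^sub>R (y - E y)" for y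
  have "bounded_linear f"
    unfolding f_def
    by (intro bounded_linear_add bounded_linear_compose[OF R.bounded_linear_axioms E.bounded_linear_axioms]
        bounded_linear_const_scaleR bounded_linear_sub bounded_linear_ident E.bounded_linear_axioms)
  then have "sym_map f"
    by (simp add: sym_map_def f_def inner_add inner_diff proj_map_inner[OF P] pos_map_inner[OF R] RE)
  moreover have "c * (y \<bullet> y) \<le> f y \<bullet> y" for y
  proof -
    have "R (E y) \<bullet> y = R (E y) \<bullet> E y"
      by (simp add: RE proj_map_inner[OF P] proj_map_idem[OF P])
    moreover have "c * (E y \<bullet> E y) \<le> R (E y) \<bullet> E y"
      by (rule spectral_cut_ge[OF E proj_map_idem[OF P]])
    moreover have "(y - E y) \<bullet> y = y \<bullet> y - E y \<bullet> E y"
      by (simp add: inner_diff proj_map_inner[OF P] proj_map_idem[OF P])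
    ultimately show ?thesis by (simp add: f_def inner_add algebra_simps)
  qed
  ultimately have "surj f" using coercive_surj c by blast
  then obtain y where "x = f y" by blast
  define z where "z = E y"
  have "E (f y) = R z" by (simp add: f_def z_def E.add E.scaleR E.diff proj_map_idem[OF P] RE)
  then have xz: "x = R z" using x \<open>x = f y\<close> by simp
  have Ez: "E z = z" by (simp add: z_def proj_map_idem[OF P])
  have "(R z, C (C z)) \<in> G O adj G" unfolding eq R_def by blast
  then obtain u where u: "(x, u) \<in> G" "(u, C (C z)) \<in> adj G" using xz by blast
  have CC: "C (C z) = z - x"
    using cos_sin_sum[OF SC, of z] by (simp add: xz R_def algebra_simps)
  have "u \<bullet> u = x \<bullet> z - x \<bullet> x" using adjD[OF u(2,1)] by (simp add: CC inner_diff)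
  moreover have "x \<bullet> z \<le> (1/c) * (x \<bullet> x)"
  proof (cases "x \<bullet> z > 0")
    case True
    have "(x \<bullet> z)\<^sup>2 \<le> (x \<bullet> x) * (z \<bullet> z)" by (rule Cauchy_Schwarz_ineq)
    then have "c * (x \<bullet> z)\<^sup>2 \<le> (x \<bullet> x) * (c * (z \<bullet> z))"
      using mult_left_mono[of "(x \<bullet> z)\<^sup>2" _ c] c by (simp add: mult_ac)
    also have "\<dots> \<le> (x \<bullet> x) * (x \<bullet> z)"
      using spectral_cut_ge[OF E Ez] by (intro mult_left_mono) (simp_all add: xz)
    finally have "(c * (x \<bullet> z)) * (x \<bullet> z) \<le> (x \<bullet> x) * (x \<bullet> z)"
      by (simp add: power2_eq_square mult_ac)
    then have "c * (x \<bullet> z) \<le> x \<bullet> x" using True by (rule mult_right_le_imp_le)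
    then show ?thesis using c by (simp add: field_simps)
  next
    case False
    moreover have "0 \<le> (1/c) * (x \<bullet> x)" using c by simp
    ultimately show ?thesis by linarith
  qed
  ultimately have "(norm u)\<^sup>2 \<le> (1/c - 1) * (norm x)\<^sup>2"
    by (simp add: power2_norm_eq_inner algebra_simps)
  moreover have "(norm (E u))\<^sup>2 \<le> (norm u)\<^sup>2"
    using proj_map_norm_le(1)[OF P] by (intro power_mono) auto
  moreover have "invariant G E"
    using spectral_cut_fun[OF E] G resolvent_invariant(1)[OF G SC eq]
    by (simp add: function_of_def R_def[abs_def])
  then have "(E x, E u) \<in> G" using u(1) by (simp add: invariant_def)
  then have "(x, E u) \<in> G" by (simp add: x)
  ultimately have "(x, E u) \<in> G" "(norm (E u))\<^sup>2 \<le> (1/c - 1) * (norm x)\<^sup>2" by linarith+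
  then show ?thesis using proj_map_idem[OF P, of u] by (intro exI[of _ "E u"]) simp
qed

text \<open>
  Since \<open>\<parallel>x\<parallel>\<^sup>2\<close> is the graph inner product of \<open>(x, Tx)\<close> with \<open>(Rx, TRx)\<close>, the Cauchy-Schwarz
  inequality bounds \<open>\<parallel>x\<parallel>\<^sup>4\<close> by \<open>(\<parallel>x\<parallel>\<^sup>2 + \<parallel>Tx\<parallel>\<^sup>2) \<langle>Rx, x\<rangle>\<close>, where \<open>\<langle>Rx, x\<rangle> \<le> c\<parallel>x\<parallel>\<^sup>2\<close>.
\<close>

lemma cut_lower_bound:
  fixes S C :: "'a::{real_inner,complete_space} \<Rightarrow> 'a"
  assumes SC: "cos_sin S C" and eq: "G O adj G = range (\<lambda>w. (S (S w), C (C w)))"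
    and E: "spectral_cut (\<lambda>x. S (S x)) c E" and c: "c > 0"
    and x: "E x = 0" "(x, u) \<in> G"
  shows "(1/c - 1) * (norm x)\<^sup>2 \<le> (norm u)\<^sup>2"
proof (cases "x = 0")
  case False
  define y where "y = S (S x)"
  have "(y, C (C x)) \<in> G O adj G" unfolding eq y_def by blast
  then obtain a where a: "(y, a) \<in> G" "(a, C (C x)) \<in> adj G" by blast
  have CC: "C (C x) = x - y" using cos_sin_sum[OF SC, of x] by (simp add: y_def algebra_simps)
  have aa: "a \<bullet> a = y \<bullet> x - y \<bullet> y" "u \<bullet> a = x \<bullet> x - x \<bullet> y"
    using adjD[OF a(2) a(1)] adjD[OF a(2) x(2)] by (simp_all add: CC inner_diff)
  have "((x, u) \<bullet> (y, a))\<^sup>2 \<le> ((x, u) \<bullet> (x, u)) * ((y, a) \<bullet> (y, a))" by (rule Cauchy_Schwarz_ineq)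
  then have "(x \<bullet> x)\<^sup>2 \<le> (x \<bullet> x + u \<bullet> u) * (y \<bullet> x)" by (simp add: aa)
  also have "\<dots> \<le> (x \<bullet> x + u \<bullet> u) * (c * (x \<bullet> x))"
    using spectral_cut_le[OF E x(1)] by (intro mult_left_mono) (simp_all add: y_def)
  finally have "(x \<bullet> x) * (x \<bullet> x) \<le> (c * (x \<bullet> x + u \<bullet> u)) * (x \<bullet> x)"
    by (simp add: power2_eq_square mult_ac)
  moreover have "x \<bullet> x > 0" using False by simp
  ultimately have "x \<bullet> x \<le> c * (x \<bullet> x + u \<bullet> u)" by (rule mult_right_le_imp_le)
  then show ?thesis using c by (simp add: power2_norm_eq_inner field_simps)
qed simp

text \<open>
  Let \<open>\<rho> < \<rho>'\<close> be the bounds for \<open>T*T\<close> that correspond to \<open>c > c'\<close>. The vectors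
  \<open>u\<^sub>n = T\<^sup>n x\<close> grow at most like \<open>\<rho>\<^sup>n\<^sup>/\<^sup>2\<close>, and so do the parts \<open>v\<^sub>n = (1 - E') B u\<^sub>n = T\<^sup>n v\<^sub>0\<close>. But \<open>v\<^sub>0\<close>
  is in a subspace where \<open>T\<close> multiplies norms by at least \<open>\<rho>'\<^sup>1\<^sup>/\<^sup>2\<close>, so it vanishes.
\<close>

lemma fuglede_half:
  fixes S C :: "'a::{real_inner,complete_space} \<Rightarrow> 'a"
  assumes G: "closed G" "subspace G" and SC: "cos_sin S C"
    and eq: "G O adj G = range (\<lambda>w. (S (S w), C (C w)))" "adj G O G = G O adj G"
    and E: "spectral_cut (\<lambda>x. S (S x)) c E" and E': "spectral_cut (\<lambda>x. S (S x)) c' E'"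
    and c: "0 < c'" "c' < c" "c \<le> 1"
    and B: "bounded_linear B" "invariant G B" and x: "E x = x"
  shows "E' (B x) = B x"
proof -
  note P' = spectral_cut_proj[OF E']
  interpret B: bounded_linear B by (rule B(1))
  interpret E': bounded_linear E' by (rule proj_map_linear[OF P'])
  define \<rho> where "\<rho> = 1/c - 1"
  define \<rho>' where "\<rho>' = 1/c' - 1"
  have \<rho>: "0 \<le> \<rho>" "\<rho> < \<rho>'" using c by (simp_all add: \<rho>_def \<rho>'_def field_simps)
  have "\<exists>u. (y, u) \<in> G \<and> E u = u \<and> (norm u)\<^sup>2 \<le> \<rho> * (norm y)\<^sup>2" if "E y = y" for y
    unfolding \<rho>_def using cut_upper_bound[OF G SC eq E _ that] c by simp
  then obtain F where F: "\<And>y. E y = y \<Longrightarrow> (y, F y) \<in> G \<and> E (F y) = F y \<and> (norm (F y))\<^sup>2 \<le> \<rho> * (norm y)\<^sup>2"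
    by metis
  define u where "u n = (F ^^ n) x" for n
  have Eu: "E (u n) = u n" for n by (induction n) (simp_all add: u_def x F)
  have uG: "(u n, u (Suc n)) \<in> G" for n using F[OF Eu[of n]] by (simp add: u_def)
  have u_le: "(norm (u n))\<^sup>2 \<le> \<rho> ^ n * (norm x)\<^sup>2" for n
  proof (induction n)
    case (Suc n)
    have "(norm (u (Suc n)))\<^sup>2 \<le> \<rho> * (norm (u n))\<^sup>2" using F[OF Eu[of n]] by (simp add: u_def)
    also have "\<dots> \<le> \<rho> * (\<rho> ^ n * (norm x)\<^sup>2)" by (intro mult_left_mono Suc \<rho>)
    finally show ?case by (simp add: mult_ac)
  qed (simp add: u_def)
  define v where "v n = B (u n) - E' (B (u n))" for n
  have E'v: "E' (v n) = 0" for n by (simp add: v_def E'.diff proj_map_idem[OF P'])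
  have "invariant G E'"
    using spectral_cut_fun[OF E'] G resolvent_invariant(1)[OF G SC eq]
    by (simp add: function_of_def)
  have vG: "(v n, v (Suc n)) \<in> G" for n
  proof -
    have "(B (u n), B (u (Suc n))) \<in> G" using uG[of n] B(2) by (simp add: invariant_def)
    moreover from this have "(E' (B (u n)), E' (B (u (Suc n)))) \<in> G"
      using \<open>invariant G E'\<close> by (simp add: invariant_def)
    ultimately show ?thesis using subspace_diff[OF G(2)] by (fastforce simp: v_def)
  qed
  have v_ge: "\<rho>' ^ n * (norm (v 0))\<^sup>2 \<le> (norm (v n))\<^sup>2" for n
  proof (induction n)
    case (Suc n)
    have "\<rho>' ^ Suc n * (norm (v 0))\<^sup>2 \<le> \<rho>' * (norm (v n))\<^sup>2"
      using mult_left_mono[OF Suc, of \<rho>'] \<rho> by (simp add: mult_ac)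
    also have "\<dots> \<le> (norm (v (Suc n)))\<^sup>2"
      unfolding \<rho>'_def by (rule cut_lower_bound[OF SC eq(1) E' c(1) E'v vG])
    finally show ?case .
  qed simp
  obtain K where K: "\<And>x. norm (B x) \<le> norm x * K" using B.bounded by blast
  have bound: "(norm (v 0))\<^sup>2 \<le> K\<^sup>2 * (norm x)\<^sup>2 * (\<rho> / \<rho>') ^ n" for n
  proof -
    have "norm (v n) \<le> norm (u n) * K"
      unfolding v_def using proj_map_norm_le(2)[OF P'] K order_trans by blast
    then have "(norm (v n))\<^sup>2 \<le> (norm (u n) * K)\<^sup>2" by (intro power_mono) auto
    also have "\<dots> \<le> \<rho> ^ n * (norm x)\<^sup>2 * K\<^sup>2"
      unfolding power_mult_distrib by (intro mult_right_mono u_le) auto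
    finally have "\<rho>' ^ n * (norm (v 0))\<^sup>2 \<le> \<rho> ^ n * (norm x)\<^sup>2 * K\<^sup>2" using v_ge[of n] by linarith
    then show ?thesis using \<rho> by (simp add: power_divide field_simps)
  qed
  have "(\<lambda>n. K\<^sup>2 * (norm x)\<^sup>2 * (\<rho> / \<rho>') ^ n) \<longlonglongrightarrow> K\<^sup>2 * (norm x)\<^sup>2 * 0"
    using \<rho> by (intro tendsto_mult tendsto_const LIMSEQ_power_zero) simp
  then have "(norm (v 0))\<^sup>2 \<le> 0" using bound by (intro LIMSEQ_le_const[of _ _]) auto
  then show ?thesis by (simp add: v_def u_def)
qed

text \<open>
  Right continuity of the spectral projections closes the gap between \<open>c'\<close> and \<open>c\<close>: the part \<open>y\<close> of
  \<open>Bx\<close> outside the range of \<open>E\<close> has \<open>\<langle>Ry, y\<rangle> < c\<parallel>y\<parallel>\<^sup>2\<close>, and so it falls below some cut at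
  \<open>c' < c\<close>.
\<close>

lemma fuglede_cut_invariant:
  fixes S C :: "'a::{real_inner,complete_space} \<Rightarrow> 'a"
  assumes G: "closed G" "subspace G" and SC: "cos_sin S C"
    and eq: "G O adj G = range (\<lambda>w. (S (S w), C (C w)))" "adj G O G = G O adj G"
    and E: "spectral_cut (\<lambda>x. S (S x)) c E" and c: "0 < c" "c \<le> 1"
    and B: "bounded_linear B" "invariant G B" and x: "E x = x"
  shows "E (B x) = B x"
proof (rule ccontr)
  assume neq: "E (B x) \<noteq> B x"
  define R where "R x = S (S x)" for x
  have E: "spectral_cut R c E" using E by (simp add: R_def[abs_def])
  note P = spectral_cut_proj[OF E]
  have R: "pos_map R"
    unfolding R_def by (rule pos_map_mult) (simp_all add: cos_sin_S[OF SC])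
  interpret E: bounded_linear E by (rule proj_map_linear[OF P])
  define y where "y = B x - E (B x)"
  have y: "E y = 0" "y \<noteq> 0" using neq by (simp_all add: y_def E.diff proj_map_idem[OF P])
  then have yy: "y \<bullet> y > 0" by simp
  define r where "r = (R y \<bullet> y) / (y \<bullet> y)"
  have r: "0 \<le> r" "r < c" "R y \<bullet> y = r * (y \<bullet> y)"
    using pos_map_nonneg[OF R, of y] spectral_cut_less[OF E y] yy by (simp_all add: r_def field_simps)
  define c' where "c' = (r + c) / 2"
  have c': "0 < c'" "c' < c" "r < c'" using r c by (simp_all add: c'_def)
  obtain E' where E': "spectral_cut R c' E'" using spectral_cut_exists[OF pos_map_sym[OF R]] by blast
  interpret E': bounded_linear E' by (rule proj_map_linear[OF spectral_cut_proj[OF E']])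
  have "E' (B x) = B x"
    by (rule fuglede_half[OF G SC eq E[unfolded R_def[abs_def]] E'[unfolded R_def[abs_def]]
          c'(1,2) c(2) B x])
  moreover have "E' (E z) = E (E' z)" for z
    by (rule function_of_functions_commute[OF spectral_cut_fun[OF E'] spectral_cut_fun[OF E]
          pos_map_linear[OF R] E.bounded_linear_axioms])
  ultimately have "E' y = y" by (simp add: y_def E'.diff)
  from spectral_cut_ge[OF E' this] have "c' * (y \<bullet> y) \<le> r * (y \<bullet> y)" by (simp add: r(3))
  then show False using c'(3) yy by simp
qed

text \<open>
  On the part of the space where \<open>a \<le> T \<le> b\<close>, \<open>T\<close> differs from \<open>a\<close> by at most \<open>b - a\<close>, so there
  the commutator of \<open>T\<close> and \<open>B\<close> has norm at most \<open>2\<parallel>B\<parallel>(b - a)\<close>. The commutator commutes with all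
  the projections; therefore halving the interval splits it into orthogonal pieces and improves the
  bound by a factor of two each time.
\<close>

lemma commute_of_spectral_cuts:
  fixes T :: "'a::{real_inner,complete_space} \<Rightarrow> 'a"
  assumes T: "pos_map T" "\<And>x. T x \<bullet> x \<le> x \<bullet> x" and B: "bounded_linear B"
    and comm: "\<And>c E x. 0 < c \<Longrightarrow> c \<le> 1 \<Longrightarrow> spectral_cut T c E \<Longrightarrow> E (B x) = B (E x)"
  shows "T (B x) = B (T x)"
proof -
  interpret T: bounded_linear T by (rule pos_map_linear[OF T(1)])
  interpret B: bounded_linear B by (rule B)
  have "\<forall>c. \<exists>E. spectral_cut T c E" using spectral_cut_exists[OF pos_map_sym[OF T(1)]] by blast
  then obtain E where E: "\<And>c. spectral_cut T c (E c)" by metis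
  note P = spectral_cut_proj[OF E] and F = spectral_cut_fun[OF E]
  have E_lin: "bounded_linear (E c)" for c by (rule proj_map_linear[OF P])
  note E_lins = bounded_linear.linear[OF E_lin]
  have ET: "T (E c x) = E c (T x)" for c x by (rule sym_map_function_of[OF F T.bounded_linear_axioms])
  have EE: "E a (E b x) = E b (E a x)" for a b x
    by (rule function_of_functions_commute[OF F F T.bounded_linear_axioms E_lin])
  have E0: "E 0 x = x" for x
  proof (rule ccontr)
    assume "E 0 x \<noteq> x"
    then have "x - E 0 x \<noteq> 0" by simp
    moreover have "E 0 (x - E 0 x) = 0" by (simp add: linear_diff[OF E_lins] proj_map_idem[OF P])
    ultimately have "T (x - E 0 x) \<bullet> (x - E 0 x) < 0" using spectral_cut_less[OF E, of 0 "x - E 0 x"] by simp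
    then show False using pos_map_nonneg[OF T(1), of "x - E 0 x"] by linarith
  qed
  have E1: "E c x = 0" if "c > 1" for c x
  proof (rule ccontr)
    assume "E c x \<noteq> 0"
    then have "0 < E c x \<bullet> E c x" by simp
    then have "1 * (E c x \<bullet> E c x) < c * (E c x \<bullet> E c x)" using that by (intro mult_strict_right_mono)
    also have "\<dots> \<le> T (E c x) \<bullet> E c x" by (rule spectral_cut_ge[OF E proj_map_idem[OF P]])
    also have "\<dots> \<le> E c x \<bullet> E c x" by (rule T(2))
    finally show False by simp
  qed
  have EB: "E c (B x) = B (E c x)" if "c \<ge> 0" for c x
  proof -
    consider "c = 0" | "0 < c" "c \<le> 1" | "c > 1" using \<open>c \<ge> 0\<close> by linarith
    then show ?thesis by cases (simp_all add: E0 E1 B.zero comm[OF _ _ E])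
  qed
  \<comment> \<open>The bounds \<open>0 \<le> T \<le> 1\<close> make the cuts at 0 and beyond 1 trivial, so the bisection below can
    start with the interval from 0 to 2.\<close>
  define D where "D x = T (B x) - B (T x)" for x
  have D_lin: "linear D"
    unfolding D_def by (intro linearI) (simp_all add: T.add B.add T.scaleR B.scaleR algebra_simps)
  have ED: "E c (D x) = D (E c x)" if "c \<ge> 0" for c x
    by (simp add: D_def linear_diff[OF E_lins] EB[OF that] flip: ET)
  obtain K where K: "K > 0" "\<And>x. norm (B x) \<le> norm x * K" using B.pos_bounded by blast
  have slice: "norm (T x - a *\<^sub>R x) \<le> (b - a) * norm x" if ab: "a \<le> b" and x: "E a x = x" "E b x = 0" for a b x
  proof -
    define Q where "Q z = E a (z - E b z)" for z
    have Q_lin: "bounded_linear Q"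
      unfolding Q_def
      by (intro bounded_linear_compose[OF E_lin] bounded_linear_sub bounded_linear_ident E_lin)
    have QQ: "Q (Q z) = Q z" for z
      by (simp add: Q_def linear_diff[OF E_lins] EE[of b a] proj_map_idem[OF P])
    have Q_sym: "Q z \<bullet> y = z \<bullet> Q y" for z y
      by (simp add: Q_def linear_diff[OF E_lins] inner_diff proj_map_inner[OF P] EE[of b a])
    have TQ: "T (Q z) = Q (T z)" for z by (simp add: Q_def ET T.diff)
    have Qz: "E a (Q z) = Q z" "E b (Q z) = 0" for z
      by (simp_all add: Q_def linear_diff[OF E_lins] EE[of b a] proj_map_idem[OF P])
    define V where "V z = T (Q z) - a *\<^sub>R Q z" for z
    have V_inner: "V z \<bullet> z = T (Q z) \<bullet> Q z - a * (Q z \<bullet> Q z)" for z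
    proof -
      have "V z \<bullet> z = V (Q z) \<bullet> z" by (simp add: V_def QQ)
      also have "\<dots> = V z \<bullet> Q z"
        by (simp add: V_def inner_diff Q_sym QQ) (simp add: TQ Q_sym QQ)
      finally show ?thesis by (simp add: V_def inner_diff)
    qed
    have V: "pos_map V"
      unfolding pos_map_def sym_map_def
    proof (intro conjI allI)
      show "bounded_linear V"
        unfolding V_def
        by (intro bounded_linear_sub bounded_linear_compose[OF T.bounded_linear_axioms Q_lin]
            bounded_linear_const_scaleR Q_lin)
      show "V z \<bullet> y = z \<bullet> V y" for z y
        by (simp add: V_def inner_diff Q_sym pos_map_inner[OF T(1)]) (simp add: TQ)
      show "0 \<le> V z \<bullet> z" for z using spectral_cut_ge[OF E Qz(1)] by (simp add: V_inner)
    qed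
    have "norm (V x) \<le> (b - a) * norm x"
    proof (rule pos_map_norm_le[OF V])
      fix z
      have le: "V z \<bullet> z \<le> (b - a) * (Q z \<bullet> Q z)"
        using spectral_cut_le[OF E Qz(2), of z] by (simp add: V_inner algebra_simps)
      have "z \<bullet> z - Q z \<bullet> Q z = (z - Q z) \<bullet> (z - Q z)"
        by (simp add: inner_diff Q_sym QQ)
      then have "Q z \<bullet> Q z \<le> z \<bullet> z" using inner_ge_zero[of "z - Q z"] by linarith
      then have "(b - a) * (Q z \<bullet> Q z) \<le> (b - a) * (z \<bullet> z)" using ab by (intro mult_left_mono) auto
      with le show "V z \<bullet> z \<le> (b - a) * (z \<bullet> z)" by linarith
    qed
    moreover have "Q x = x" by (simp add: Q_def x linear_diff[OF E_lins])
    ultimately show ?thesis by (simp add: V_def)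
  qed
  have bisect: "norm (D x) \<le> 2 * K * (b - a) / 2 ^ n * norm x"
    if "0 \<le> a" "a \<le> b" "E a x = x" "E b x = 0" for n a b x
    using that
  proof (induction n arbitrary: a b x)
    case 0
    have Bx: "E a (B x) = B x" "E b (B x) = 0" using 0 EB by (simp_all add: B.zero)
    have "D x = (T (B x) - a *\<^sub>R B x) - B (T x - a *\<^sub>R x)"
      by (simp add: D_def B.diff B.scaleR)
    then have "norm (D x) \<le> norm (T (B x) - a *\<^sub>R B x) + norm (B (T x - a *\<^sub>R x))"
      by (metis norm_triangle_ineq4)
    also have "norm (T (B x) - a *\<^sub>R B x) \<le> (b - a) * (norm x * K)"
      using slice[OF 0(2) Bx] mult_left_mono[OF K(2)[of x], of "b - a"] 0(2) by linarith
    also have "norm (B (T x - a *\<^sub>R x)) \<le> ((b - a) * norm x) * K"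
      using K(2)[of "T x - a *\<^sub>R x"] mult_right_mono[OF slice[OF 0(2-4)], of K] K(1) by linarith
    finally show ?case by (simp add: algebra_simps)
  next
    case (Suc n)
    define m where "m = (a + b) / 2"
    define d where "d = 2 * K * (b - a) / 2 ^ Suc n"
    have m: "a \<le> m" "m \<le> b" "0 \<le> m" using Suc.prems by (simp_all add: m_def)
    have d: "2 * K * (b - m) / 2 ^ n = d" "2 * K * (m - a) / 2 ^ n = d" "0 \<le> d"
      using K(1) Suc.prems by (simp_all add: d_def m_def field_simps)
    have upper: "norm (D (E m x)) \<le> d * norm (E m x)"
      using Suc.IH[OF m(3,2), of "E m x"] Suc.prems
      by (simp add: d proj_map_idem[OF P] EE[of b m] linear_0[OF E_lins])
    have lower: "norm (D (x - E m x)) \<le> d * norm (x - E m x)"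
      using Suc.IH[OF Suc.prems(1) m(1), of "x - E m x"] Suc.prems
      by (simp add: d proj_map_idem[OF P] linear_diff[OF E_lins] EE[of a m])
    have "(norm (D x))\<^sup>2 = (norm (D (E m x)))\<^sup>2 + (norm (D (x - E m x)))\<^sup>2"
      using proj_map_pythagoras[OF P, of "D x" m] by (simp add: ED[OF m(3)] linear_diff[OF D_lin])
    also have "\<dots> \<le> (d * norm (E m x))\<^sup>2 + (d * norm (x - E m x))\<^sup>2"
      by (intro add_mono power_mono upper lower) auto
    also have "\<dots> = (d * norm x)\<^sup>2"
      unfolding power_mult_distrib using proj_map_pythagoras[OF P, of x m] by (simp add: algebra_simps)
    finally have "norm (D x) \<le> d * norm x" by (rule power2_le_imp_le) (simp add: d)
    then show ?case by (simp add: d_def)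
  qed
  have "norm (D x) \<le> 4 * K * norm x * (1/2) ^ n" for n
    using bisect[of 0 2 x n] by (simp add: E0 E1 power_divide field_simps)
  moreover have "(\<lambda>n. 4 * K * norm x * (1/2) ^ n) \<longlonglongrightarrow> 4 * K * norm x * 0"
    by (intro tendsto_mult tendsto_const LIMSEQ_power_zero) simp
  ultimately have "norm (D x) \<le> 0" by (intro LIMSEQ_le_const[of _ _]) auto
  then show ?thesis by (simp add: D_def)
qed

text \<open>
  The preceding results apply to \<open>B\<close> and the relation \<open>G\<close>, and also to \<open>B*\<close> and the adjoint of \<open>G\<close>,
  which is normal with the same modulus. So the ranges of the projections are invariant under
  both \<open>B\<close> and \<open>B*\<close>, which makes \<open>B\<close> commute with them.
\<close>

lemma fuglede_abs:
  fixes S C :: "'a::{real_inner,complete_space} \<Rightarrow> 'a"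
  assumes G: "closed G" "subspace G" and SC: "cos_sin S C"
    and eq: "G O adj G = range (\<lambda>w. (S (S w), C (C w)))" "adj G O G = G O adj G"
    and B: "bounded_linear B" "invariant G B" and B': "bounded_linear B'"
    and adj: "\<And>x y. B x \<bullet> y = x \<bullet> B' y"
  shows "B (S x) = S (B x)" "B (C x) = C (B x)"
proof -
  have "pos_map (\<lambda>x. S (S x))" by (rule pos_map_mult) (simp_all add: cos_sin_S[OF SC])
  note R = this
  have adj_eq: "adj G O adj (adj G) = range (\<lambda>w. (S (S w), C (C w)))"
    "adj (adj G) O adj G = adj G O adj (adj G)"
    using eq by (simp_all add: adj_adj[OF G])
  have inv: "invariant (adj G) B'"
    unfolding invariant_def
  proof (intro allI impI adjI)
    fix x y a b assume xy: "(x, y) \<in> adj G" and "(a, b) \<in> G"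
    then have "(B a, B b) \<in> G" using B(2) by (simp add: invariant_def)
    from adjD[OF xy this] show "b \<bullet> B' x = a \<bullet> B' y" by (simp add: adj)
  qed
  have "S (S (B x)) = B (S (S x))" for x
  proof (rule commute_of_spectral_cuts[OF R _ B(1)])
    show "S (S x) \<bullet> x \<le> x \<bullet> x" for x
      using cos_sin_norm[OF SC, of x] pos_map_inner[OF cos_sin_S[OF SC], of "S x" x]
        inner_ge_zero[of "C x"]
      unfolding power2_norm_eq_inner by linarith
    fix c E x assume c: "0 < c" "c \<le> (1::real)" and E: "spectral_cut (\<lambda>x. S (S x)) c E"
    note P = spectral_cut_proj[OF E]
    have EBE: "E (B (E z)) = B (E z)" for z
      by (rule fuglede_cut_invariant[OF G SC eq E c B proj_map_idem[OF P]])
    have EBE': "E (B' (E z)) = B' (E z)" for z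
      by (rule fuglede_cut_invariant[OF closed_adj subspace_adj SC adj_eq E c B' inv proj_map_idem[OF P]])
    have "(E (B x) - E (B (E x))) \<bullet> y = 0" for y
    proof -
      have "E (B x) \<bullet> y = x \<bullet> E (B' (E y))" by (simp add: proj_map_inner[OF P] adj EBE')
      also have "\<dots> = E (B (E x)) \<bullet> y" by (simp add: proj_map_inner[OF P] adj)
      finally show ?thesis by (simp add: inner_diff)
    qed
    from this[of "E (B x) - E (B (E x))"] show "E (B x) = B (E x)" by (simp add: EBE)
  qed
  then have comm: "B (S (S x)) = S (S (B x))" for x by (rule sym)
  show "B (S x) = S (B x)" by (rule function_of_commute[OF cos_sin_fun_S[OF SC] B(1) comm])
  show "B (C x) = C (B x)" by (rule function_of_commute[OF cos_sin_fun_C[OF SC] B(1) comm])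
qed

section \<open>Comparison of the mixed terms\<close>

lemma psa_graph:
  fixes f :: "'a::real_inner \<Rightarrow> 'a"
  assumes f: "pos_map f" shows "psa (range (\<lambda>x. (x, f x)))"
  unfolding psa_def
proof (intro conjI allI impI set_eqI iffI)
  fix p assume "p \<in> adj (range (\<lambda>x. (x, f x)))"
  then obtain y z where p: "p = (y, z)" "(y, z) \<in> adj (range (\<lambda>x. (x, f x)))" by (cases p) auto
  have "x \<bullet> (f y - z) = 0" for x
  proof -
    have "f x \<bullet> y = x \<bullet> z" by (rule adjD[OF p(2)]) simp
    then show ?thesis by (simp add: inner_diff pos_map_inner[OF f])
  qed
  from this[of "f y - z"] have "z = f y" by simp
  then show "p \<in> range (\<lambda>x. (x, f x))" using p(1) by blast
next
  fix p assume "p \<in> range (\<lambda>x. (x, f x))"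
  then show "p \<in> adj (range (\<lambda>x. (x, f x)))" by (auto intro!: adjI simp: pos_map_inner[OF f])
next
  fix x u assume "(x, u) \<in> range (\<lambda>x. (x, f x))"
  then show "0 \<le> u \<bullet> x" using pos_map_nonneg[OF f] by auto
qed

text \<open>
  In terms of the operator \<open>T\<close> with graph \<open>G\<close>, this is \<open>\<langle>Tx, Bx\<rangle> \<le> \<langle>|T|x, |B|x\<rangle>\<close> for \<open>x = Sw\<close>, with
  \<open>|B|\<close> written as \<open>P\<close>. It is \<open>heinz_form\<close> for the symmetric part of \<open>SB*Z\<close> and the positive map
  \<open>PCS\<close>.
\<close>

lemma abs_form_inequality:
  fixes G :: "('a::{real_inner,complete_space} \<times> 'a) set"
  assumes G: "closed G" "subspace G" "single_valued G" "single_valued (adj G)"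
    and SC: "cos_sin S C"
    and eq: "G O adj G = range (\<lambda>w. (S (S w), C (C w)))" "adj G O G = G O adj G"
    and Z: "bounded_linear Z" "\<And>w. norm (Z w) = norm (C w)" "G = range (\<lambda>w. (S w, Z w))"
    and B: "bounded_linear B" "invariant G B"
    and B': "bounded_linear B'" "\<And>x y. B x \<bullet> y = x \<bullet> B' y" "\<And>x. norm (B' x) \<le> norm (B x)"
    and P: "pos_map P" "\<And>x. P (P x) = B' (B x)" "function_of (\<lambda>x. B' (B x)) P"
  shows "Z w \<bullet> B (S w) \<le> C w \<bullet> P (S w)"
proof -
  note S = cos_sin_S[OF SC] and C = cos_sin_C[OF SC]
  note S_lin = pos_map_linear[OF S] and C_lin = pos_map_linear[OF C] and P_lin = pos_map_linear[OF P(1)]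
  have BS: "B (S x) = S (B x)" and BC: "B (C x) = C (B x)" for x
    by (rule fuglede_abs[OF G(1,2) SC eq B B'(1,2)])+
  have adjointI: "f x = g x" if "\<And>y. f x \<bullet> y = g x \<bullet> y" for f g :: "'a \<Rightarrow> 'a" and x
  proof -
    have "(f x - g x) \<bullet> (f x - g x) = 0" using that by (simp add: inner_diff_left)
    then show ?thesis by simp
  qed
  have B'_left: "B' x \<bullet> y = x \<bullet> B y" for x y using B'(2)[of y x] by (simp add: inner_commute)
  have B'S: "B' (S x) = S (B' x)" for x
    by (rule adjointI[of "\<lambda>x. B' (S x)" _ "\<lambda>x. S (B' x)"]) (simp add: B'_left pos_map_inner[OF S] BS)
  have B'C: "B' (C x) = C (B' x)" for x
    by (rule adjointI[of "\<lambda>x. B' (C x)" _ "\<lambda>x. C (B' x)"]) (simp add: B'_left pos_map_inner[OF C] BC)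
  have PS: "S (P x) = P (S x)" and PC: "C (P x) = P (C x)" for x
    using function_of_commute[OF P(3) S_lin] function_of_commute[OF P(3) C_lin]
    by (simp_all add: BS BC B'S B'C)
  have P_norm: "norm (P x) = norm (B x)" for x
  proof -
    have "P x \<bullet> P x = B x \<bullet> B x" by (simp add: pos_map_inner[OF P(1)] P(2) B'(2))
    then show ?thesis by (simp add: norm_eq_sqrt_inner)
  qed
  have sv: "single_valued (G O adj G)" using G(3,4) by (rule single_valued_relcomp)
  note dense = dense_quotient[OF SC sv[unfolded eq(1)]]
  have adj_eq: "adj G O adj (adj G) = range (\<lambda>w. (S (S w), C (C w)))"
    using eq by (simp add: adj_adj[OF G(1,2)])
  have "single_valued (adj G O adj (adj G))"
    unfolding adj_adj[OF G(1,2)] using G(4,3) by (rule single_valued_relcomp)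
  from closed_relation_quotient[OF closed_adj subspace_adj G(4) SC adj_eq this]
  obtain Z' where Z': "bounded_linear Z'" "\<And>w. norm (Z' w) = norm (C w)"
    "adj G = range (\<lambda>w. (S w, Z' w))" by blast
  have inG: "(S w, Z w) \<in> G" for w using Z(3) by blast
  have ZG: "u = Z w" if "(S w, u) \<in> G" for w u using single_valuedD[OF G(3) that inG] .
  have SZ: "S (Z w) = Z (S w)" for w
    using resolvent_invariant(2)[OF G(1,2) SC eq] inG[of w] by (intro ZG) (simp add: invariant_def)
  have BZ: "B (Z w) = Z (B w)" for w
    using B(2) inG[of w] by (intro ZG) (simp add: invariant_def BS[symmetric])
  have Z_adj: "Z x \<bullet> y = x \<bullet> Z' y" for x y
  proof (rule closed_linear_eqI[OF dense, of "\<lambda>x. Z x \<bullet> y" "\<lambda>x. x \<bullet> Z' y"])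
    show "bounded_linear (\<lambda>x. Z x \<bullet> y)"
      by (rule bounded_linear_compose[OF bounded_linear_inner_left Z(1)])
    show "bounded_linear (\<lambda>x. x \<bullet> Z' y)" by (rule bounded_linear_inner_left)
    fix m assume "m \<in> range S"
    then obtain v where v: "m = S v" by blast
    have "(S y, Z' y) \<in> adj G" using Z'(3) by blast
    from adjD[OF this inG[of v]] show "Z m \<bullet> y = m \<bullet> Z' y"
      by (simp add: v SZ[symmetric] pos_map_inner[OF S])
  qed
  \<comment> \<open>\<open>K\<close> is half the sum of \<open>SB*Z\<close> and its adjoint.\<close>
  define K where "K w = (1/2) *\<^sub>R (S (B' (Z w)) + Z' (B (S w)))" for w
  define L where "L w = P (C (S w))" for w
  have K_sym: "K x \<bullet> y = x \<bullet> K y" for x y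
  proof -
    have "S (B' (Z x)) \<bullet> y = x \<bullet> Z' (B (S y))" for x y
      by (simp add: pos_map_inner[OF S] B'_left Z_adj)
    from this[of x y] this[of y x] show ?thesis
      by (simp add: K_def inner_add inner_commute)
  qed
  have CS: "pos_map (\<lambda>w. C (S w))" by (rule pos_map_mult[OF C S]) (simp add: cos_sin_commute[OF SC])
  have L: "pos_map L"
    unfolding L_def by (rule pos_map_mult[OF P(1) CS]) (simp add: PS PC)
  have KL: "norm (K x) \<le> norm (L x)" for x
  proof -
    have Lx: "norm (C (B (S x))) = norm (L x)" by (simp add: L_def P_norm BC)
    have "norm (S (B' (Z x))) = norm (B' (Z (S x)))" by (simp add: B'S[symmetric] SZ)
    also have "\<dots> \<le> norm (B (Z (S x)))" by (rule B'(3))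
    also have "\<dots> = norm (L x)" by (simp add: BZ Z(2) Lx)
    finally have "norm (S (B' (Z x))) \<le> norm (L x)" .
    moreover have "norm (Z' (B (S x))) = norm (L x)" by (simp add: Z'(2) Lx)
    ultimately show ?thesis
      using norm_triangle_ineq[of "S (B' (Z x))" "Z' (B (S x))"] by (simp add: K_def)
  qed
  have "K w \<bullet> w \<le> L w \<bullet> w"
  proof (rule heinz_form[OF psa_graph[OF L], of "range (\<lambda>x. (x, K x))"])
    show "k \<bullet> y = x \<bullet> j"
      if "(x, k) \<in> range (\<lambda>x. (x, K x))" "(y, j) \<in> range (\<lambda>x. (x, K x))" for x k y j
      using that K_sym by auto
    show "\<exists>k. (x, k) \<in> range (\<lambda>x. (x, K x)) \<and> norm k \<le> norm l"
      if "(x, l) \<in> range (\<lambda>x. (x, L x))" for x l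
      using that KL by auto
  qed auto
  moreover have "K w \<bullet> w = Z w \<bullet> B (S w)"
  proof -
    have "S (B' (Z w)) \<bullet> w = Z w \<bullet> B (S w)" by (simp add: pos_map_inner[OF S] B'_left)
    moreover have "Z' (B (S w)) \<bullet> w = Z w \<bullet> B (S w)" by (simp add: Z_adj inner_commute[of _ w])
    ultimately show ?thesis by (simp add: K_def inner_add)
  qed
  moreover have "L w \<bullet> w = C w \<bullet> P (S w)"
    by (simp add: L_def pos_map_inner[OF C] PC inner_commute[of _ w])
  ultimately show ?thesis by simp
qed

lemma abs_diff_norm_le:
  fixes x y u v :: "'a::real_inner"
  assumes "norm x = norm u" "norm y = norm v" "u \<bullet> v \<le> x \<bullet> y"
  shows "norm (x - y) \<le> norm (u - v)"
proof (rule power2_le_imp_le)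
  have "(norm (a - b))\<^sup>2 = (norm a)\<^sup>2 + (norm b)\<^sup>2 - 2 * (a \<bullet> b)" for a b :: 'a
    by (simp add: power2_norm_eq_inner inner_diff inner_commute)
  then show "(norm (x - y))\<^sup>2 \<le> (norm (u - v))\<^sup>2" using assms by simp
qed simp

section \<open>Operators on complex Hilbert spaces\<close>

lemma cinner_scaleC_right: "cinner x (a *\<^sub>C y) = cnj a * cinner x y"
  by (metis cinner_commute cinner_scaleC_left complex_cnj_mult)

lemma norm_scaleC: "norm (a *\<^sub>C (x::'a::complex_inner)) = cmod a * norm x"
proof -
  have "cinner (a *\<^sub>C x) (a *\<^sub>C x) = (a * cnj a) * cinner x x"
    by (simp add: cinner_scaleC_left cinner_scaleC_right)
  also have "a * cnj a = complex_of_real ((cmod a)\<^sup>2)" by (simp only: complex_norm_square)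
  finally have "inner (a *\<^sub>C x) (a *\<^sub>C x) = (cmod a)\<^sup>2 * inner x x"
    by (simp add: inner_eq_Re_cinner flip: of_real_power)
  then show ?thesis by (simp add: norm_eq_sqrt_inner real_sqrt_mult)
qed

lemma bounded_linear_scaleC: "bounded_linear (\<lambda>x::'a::complex_inner. a *\<^sub>C x)"
proof (rule bounded_linear_intro[where K = "cmod a"])
  show "a *\<^sub>C (r *\<^sub>R x) = r *\<^sub>R a *\<^sub>C x" for r and x :: 'a
    by (simp add: scaleR_scaleC scaleC_scaleC mult.commute)
qed (simp_all add: scaleC_add_right norm_scaleC)

lemma Im_cinner: "Im (cinner x y) = - inner (\<i> *\<^sub>C x) y"
  by (simp add: inner_eq_Re_cinner cinner_scaleC_left)

lemma single_valued_graph: "single_valued (Map.graph T)"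
  by (auto simp: single_valued_def Map.graph_def)

lemma graph_inject: "Map.graph S = Map.graph T \<longleftrightarrow> S = T"
proof
  assume eq: "Map.graph S = Map.graph T"
  have "S x = T x" for x
  proof (cases "S x")
    case None
    then show ?thesis using eq in_graphI[of T x] in_graphD[of x _ S] by (cases "T x") auto
  next
    case (Some y)
    then show ?thesis using eq in_graphI[of S x y] in_graphD[of x y T] by simp
  qed
  then show "S = T" by (rule ext)
qed simp

lemma graph_iff: "(x, y) \<in> Map.graph T \<longleftrightarrow> T x = Some y"
  by (auto simp: Map.graph_def)

lemma linear_op_iff:
  "linear_op T \<longleftrightarrow> subspace (Map.graph T) \<and> (\<forall>c. invariant (Map.graph T) (\<lambda>x. c *\<^sub>C x))"
proof
  assume T: "linear_op T"
  then have "invariant (Map.graph T) (\<lambda>x. c *\<^sub>C x)" for c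
    by (simp add: linear_op_def invariant_def graph_iff)
  moreover from this have "subspace (Map.graph T)"
    using T by (auto simp: subspace_def linear_op_def graph_iff zero_prod_def invariant_def scaleR_scaleC)
  ultimately show "subspace (Map.graph T) \<and> (\<forall>c. invariant (Map.graph T) (\<lambda>x. c *\<^sub>C x))" by blast
next
  assume T: "subspace (Map.graph T) \<and> (\<forall>c. invariant (Map.graph T) (\<lambda>x. c *\<^sub>C x))"
  then have T': "subspace (Map.graph T)" by blast
  have "T 0 = Some 0" using subspace_0[OF T'] by (simp add: graph_iff zero_prod_def)
  moreover have "T (x + y) = Some (u + v)" if "T x = Some u" "T y = Some v" for x y u v
    using subspace_add[OF T', of "(x, u)" "(y, v)"] that by (simp add: graph_iff)
  moreover have "T (c *\<^sub>C x) = Some (c *\<^sub>C u)" if "T x = Some u" for c x u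
    using T that by (simp add: graph_iff invariant_def)
  ultimately show "linear_op T" by (simp add: linear_op_def)
qed

lemma closed_op_iff: "closed_op T \<longleftrightarrow> linear_op T \<and> closed (Map.graph T)"
  by (simp add: closed_op_def Map.graph_def)

definition rel_op :: "('a \<times> 'a) set \<Rightarrow> 'a operator" where
  "rel_op G = (\<lambda>x. if \<exists>y. (x, y) \<in> G then Some (THE y. (x, y) \<in> G) else None)"

lemma graph_rel_op:
  assumes "single_valued G" shows "Map.graph (rel_op G) = G"
proof -
  have "(THE y. (x, y) \<in> G) = y" if "(x, y) \<in> G" for x y
    using that assms by (blast dest: single_valuedD)
  then have "rel_op G x = Some y \<longleftrightarrow> (x, y) \<in> G" for x y by (auto simp: rel_op_def)
  then show ?thesis by (auto simp: Map.graph_def)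
qed

lemma subspace_dom: "linear_op T \<Longrightarrow> subspace (dom T)"
  unfolding linear_op_def subspace_def by (auto simp: scaleR_scaleC)

lemma dense_orthogonal:
  fixes M :: "'a::real_inner set"
  assumes "closure M = UNIV" "\<And>x. x \<in> M \<Longrightarrow> inner x z = 0" shows "z = 0"
proof -
  have "inner z z = 0"
    using closed_linear_eqI[OF assms(1) bounded_linear_inner_left bounded_linear_zero, of z z] assms(2)
    by blast
  then show ?thesis by simp
qed

text \<open>
  The graph of a complex linear operator contains \<open>(\<i>x, \<i>Tx)\<close> along with \<open>(x, Tx)\<close>, so the real part
  of the defining identity of the adjoint implies the imaginary part.
\<close>

lemma cinner_adjoint_iff:
  assumes "linear_op T"
  shows "(\<forall>x\<in>dom T. cinner (the (T x)) y = cinner x z) \<longleftrightarrow> (y, z) \<in> adj (Map.graph T)"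
proof
  assume "\<forall>x\<in>dom T. cinner (the (T x)) y = cinner x z"
  then show "(y, z) \<in> adj (Map.graph T)"
    by (auto intro!: adjI simp: graph_iff inner_eq_Re_cinner) (metis domI option.sel)
next
  assume yz: "(y, z) \<in> adj (Map.graph T)"
  show "\<forall>x\<in>dom T. cinner (the (T x)) y = cinner x z"
  proof
    fix x assume "x \<in> dom T"
    then obtain u where u: "T x = Some u" by blast
    have "inner (c *\<^sub>C u) y = inner (c *\<^sub>C x) z" for c
      using assms u by (intro adjD[OF yz]) (simp add: graph_iff linear_op_def)
    from this[of 1] this[of "\<i>"] have "Re (cinner u y) = Re (cinner x z)" "Im (cinner u y) = Im (cinner x z)"
      by (simp_all add: Im_cinner) (simp_all add: inner_eq_Re_cinner cinner_scaleC_left)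
    then show "cinner (the (T x)) y = cinner x z" by (simp add: u complex_eq_iff)
  qed
qed

lemma single_valued_adj:
  assumes "densely_defined T" shows "single_valued (adj (Map.graph T))"
proof (rule single_valuedI)
  fix y z z' assume z: "(y, z) \<in> adj (Map.graph T)" "(y, z') \<in> adj (Map.graph T)"
  have "z - z' = 0"
  proof (rule dense_orthogonal[of "dom T"])
    show "closure (dom T) = UNIV" using assms by (simp add: densely_defined_def)
    fix x assume "x \<in> dom T"
    then obtain u where "(x, u) \<in> Map.graph T" by (auto simp: graph_iff)
    from adjD[OF z(1) this] adjD[OF z(2) this] show "inner x (z - z') = 0" by (simp add: inner_diff)
  qed
  then show "z = z'" by simp
qed

lemma graph_op_adjoint:
  assumes T: "densely_defined T" shows "Map.graph (op_adjoint T) = adj (Map.graph T)"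
proof -
  have "linear_op T" using T by (simp add: densely_defined_def)
  then have "op_adjoint T = rel_op (adj (Map.graph T))"
    by (simp only: op_adjoint_def rel_op_def cinner_adjoint_iff[OF \<open>linear_op T\<close>])
  then show ?thesis using graph_rel_op[OF single_valued_adj[OF T]] by simp
qed

lemma psa_graph_of_op:
  assumes "pos_selfadjoint_op T"
  shows "densely_defined T" "psa (Map.graph T)" "\<And>c. invariant (Map.graph T) (\<lambda>x. c *\<^sub>C x)"
proof -
  show T: "densely_defined T" using assms by (simp add: pos_selfadjoint_op_def selfadjoint_op_def)
  have "op_adjoint T = T" using assms by (simp add: pos_selfadjoint_op_def selfadjoint_op_def)
  then have "adj (Map.graph T) = Map.graph T" using graph_op_adjoint[OF T] by simp
  moreover have "0 \<le> inner u x" if "(x, u) \<in> Map.graph T" for x u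
  proof -
    have "T x = Some u" using that by (simp add: graph_iff)
    then have "x \<in> dom T" "the (T x) = u" by auto
    then have "cinner u x \<in> \<real>\<^sub>\<ge>\<^sub>0" using assms unfolding pos_selfadjoint_op_def by blast
    then show ?thesis by (simp add: inner_eq_Re_cinner complex_nonneg_Reals_iff)
  qed
  ultimately show "psa (Map.graph T)" by (simp add: psa_def)
  show "invariant (Map.graph T) (\<lambda>x. c *\<^sub>C x)" for c
    using T by (simp add: densely_defined_def linear_op_iff)
qed

text \<open>
  A graph is single-valued, and this turns self-adjointness of the relation into density of the
  domain: a vector \<open>z\<close> orthogonal to the domain gives the element \<open>(0, z)\<close> of the adjoint.
\<close>

lemma pos_selfadjoint_opI:
  fixes T :: "'a::chilbert_space operator"
  assumes psa: "psa (Map.graph T)" and inv: "\<And>c. invariant (Map.graph T) (\<lambda>x. c *\<^sub>C x)"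
  shows "pos_selfadjoint_op T"
proof -
  have lin: "linear_op T" using psa_subspace[OF psa] inv by (simp add: linear_op_iff)
  have "closure (dom T) = UNIV"
  proof (rule dense_subspaceI[OF subspace_dom[OF lin]])
    fix z assume z: "\<And>m. m \<in> dom T \<Longrightarrow> inner z m = 0"
    have "(0, z) \<in> adj (Map.graph T)"
    proof (rule adjI)
      fix x u assume "(x, u) \<in> Map.graph T"
      then have "x \<in> dom T" by (auto simp: graph_iff)
      from z[OF this] show "inner u 0 = inner x z" by (simp add: inner_commute)
    qed
    then have "T 0 = Some z" by (simp add: psa_adj[OF psa] graph_iff)
    then show "z = 0" using lin by (simp add: linear_op_def)
  qed
  with lin have T: "densely_defined T" by (simp add: densely_defined_def)
  then have "Map.graph (op_adjoint T) = Map.graph T" using graph_op_adjoint[OF T] psa_adj[OF psa] by simp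
  then have adj: "op_adjoint T = T" by (simp add: graph_inject)
  have "cinner (the (T x)) x \<in> \<real>\<^sub>\<ge>\<^sub>0" if "x \<in> dom T" for x
  proof -
    from \<open>x \<in> dom T\<close> obtain u where u: "T x = Some u" by blast
    then have xu: "(x, u) \<in> Map.graph T" by (simp add: graph_iff)
    have "cinner u x = cinner x u"
      using cinner_adjoint_iff[OF lin, of x u] xu that by (simp add: psa_adj[OF psa] u) (metis u option.sel)
    then have "Im (cinner u x) = 0" by (metis cinner_commute complex_cnj_cancel_iff Reals_cnj_iff complex_is_Real_iff)
    moreover have "0 \<le> Re (cinner u x)" using psa_nonneg[OF psa xu] by (simp add: inner_eq_Re_cinner)
    ultimately show ?thesis by (simp add: u complex_nonneg_Reals_iff)
  qed
  then show ?thesis using T adj by (simp add: pos_selfadjoint_op_def selfadjoint_op_def)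
qed

text \<open>
  Multiplication by a complex scalar commutes with the resolvent and therefore with its functions
  \<open>S\<close> and \<open>C\<close>, so the real construction of the square root yields a complex linear operator.
\<close>

lemma quotient_scaleC_invariant:
  fixes S C :: "'a::chilbert_space \<Rightarrow> 'a"
  assumes SC: "cos_sin S C" and inv: "invariant (range (\<lambda>w. (S (S w), C (C w)))) (\<lambda>x. c *\<^sub>C x)"
  shows "invariant (range (\<lambda>w. (S w, C w))) (\<lambda>x. c *\<^sub>C x)"
proof -
  have comm: "c *\<^sub>C S (S w) = S (S (c *\<^sub>C w))" for w
  proof -
    have "(c *\<^sub>C S (S w), c *\<^sub>C C (C w)) \<in> range (\<lambda>w. (S (S w), C (C w)))"
      using inv by (auto simp: invariant_def)
    then obtain v where v: "c *\<^sub>C S (S w) = S (S v)" "c *\<^sub>C C (C w) = C (C v)" by auto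
    have "v = c *\<^sub>C (S (S w) + C (C w))"
      using cos_sin_sum[OF SC, of v] by (simp add: scaleC_add_right v)
    then have "v = c *\<^sub>C w" by (simp add: cos_sin_sum[OF SC])
    with v(1) show ?thesis by simp
  qed
  have "c *\<^sub>C S w = S (c *\<^sub>C w)" "c *\<^sub>C C w = C (c *\<^sub>C w)" for w
    by (rule function_of_commute[OF cos_sin_fun_S[OF SC] bounded_linear_scaleC comm])
      (rule function_of_commute[OF cos_sin_fun_C[OF SC] bounded_linear_scaleC comm])
  then show ?thesis by (auto simp: invariant_def)
qed

lemma op_sqrt_quotient:
  fixes T :: "'a::chilbert_space operator"
  assumes T: "pos_selfadjoint_op T"
    and SC: "cos_sin S C" "Map.graph T = range (\<lambda>w. (S (S w), C (C w)))"
  shows "pos_selfadjoint_op (op_sqrt T)" "Map.graph (op_sqrt T) = range (\<lambda>w. (S w, C w))"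
    "op_sqrt T \<circ>\<^sub>m op_sqrt T = T"
proof -
  let ?Q = "range (\<lambda>w. (S w, C w))"
  interpret S: bounded_linear S by (rule pos_map_linear[OF cos_sin_S[OF SC(1)]])
  have sv: "single_valued (range (\<lambda>w. (S (S w), C (C w))))"
    using single_valued_graph[of T] by (simp add: SC(2))
  have inj: "w = w'" if "S w = S w'" for w w'
    using inj_quotient[OF SC(1) sv, of "w - w'"] that by (simp add: S.diff)
  have "single_valued ?Q"
  proof (rule single_valuedI)
    fix x y y' assume xy: "(x, y) \<in> ?Q" and xy': "(x, y') \<in> ?Q"
    obtain w where w: "x = S w" "y = C w" using xy by auto
    obtain w' where w': "x = S w'" "y' = C w'" using xy' by auto
    have "w = w'" by (rule inj) (rule trans[OF w(1)[symmetric] w'(1)])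
    then show "y = y'" by (simp add: w w')
  qed
  then have graph: "Map.graph (rel_op ?Q) = ?Q" by (rule graph_rel_op)
  have inv: "invariant ?Q (\<lambda>x. c *\<^sub>C x)" for c
    by (rule quotient_scaleC_invariant[OF SC(1) psa_graph_of_op(3)[OF T, of c, unfolded SC(2)]])
  have pos: "pos_selfadjoint_op (rel_op ?Q)"
    using psa_quotient[OF SC(1)] inv by (intro pos_selfadjoint_opI) (simp_all add: graph)
  have sq: "rel_op ?Q \<circ>\<^sub>m rel_op ?Q = T"
    by (rule graph_inject[THEN iffD1]) (simp add: graph quotient_square[OF SC(1)] SC(2))
  have "op_sqrt T = rel_op ?Q"
    unfolding op_sqrt_def
  proof (rule the_equality)
    show "pos_selfadjoint_op (rel_op ?Q) \<and> rel_op ?Q \<circ>\<^sub>m rel_op ?Q = T" using pos sq by blast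
    fix R assume R: "pos_selfadjoint_op R \<and> R \<circ>\<^sub>m R = T"
    then have "Map.graph (R \<circ>\<^sub>m R) = Map.graph T" by simp
    then have "Map.graph R O Map.graph R = range (\<lambda>w. (S (S w), C (C w)))" by (simp add: SC(2))
    moreover have "psa (Map.graph R)" using R psa_graph_of_op(2) by blast
    ultimately have "Map.graph R = ?Q" using psa_sqrt_unique[OF _ single_valued_graph SC(1)] by blast
    then show "R = rel_op ?Q" by (intro graph_inject[THEN iffD1]) (simp add: graph)
  qed
  then show "pos_selfadjoint_op (op_sqrt T)" "Map.graph (op_sqrt T) = ?Q"
    "op_sqrt T \<circ>\<^sub>m op_sqrt T = T"
    using pos graph sq by simp_all
qed

lemma op_abs_quotient:
  fixes T :: "'a::chilbert_space operator"
  assumes T: "densely_defined T" "closed_op T"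
  obtains S C Z where "cos_sin S C"
    "Map.graph T O adj (Map.graph T) = range (\<lambda>w. (S (S w), C (C w)))"
    "Map.graph (op_abs T) = range (\<lambda>w. (S w, C w))" "pos_selfadjoint_op (op_abs T)"
    "bounded_linear Z" "\<And>w. norm (Z w) = norm (C w)" "Map.graph T = range (\<lambda>w. (S w, Z w))"
proof -
  let ?Q = "op_adjoint T \<circ>\<^sub>m T"
  have lin: "linear_op T" using T(1) by (simp add: densely_defined_def)
  then have G: "closed (Map.graph T)" "subspace (Map.graph T)"
    using T(2) by (simp_all add: closed_op_iff linear_op_iff)
  have graph: "Map.graph ?Q = Map.graph T O adj (Map.graph T)" by (simp add: graph_op_adjoint[OF T(1)])
  have psa: "psa (Map.graph ?Q)" unfolding graph by (rule von_neumann[OF G])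
  have inv_T: "invariant (Map.graph T) (\<lambda>x. c *\<^sub>C x)" for c using lin by (simp add: linear_op_iff)
  have inv_adj: "invariant (adj (Map.graph T)) (\<lambda>x. c *\<^sub>C x)" for c
    unfolding invariant_def cinner_adjoint_iff[OF lin, symmetric]
    by (simp add: cinner_scaleC_right)
  have "invariant (Map.graph ?Q) (\<lambda>x. c *\<^sub>C x)" for c
    unfolding graph using inv_T[of c] inv_adj[of c] unfolding invariant_def by blast
  with psa have pos: "pos_selfadjoint_op ?Q" by (intro pos_selfadjoint_opI)
  obtain S C where SC: "cos_sin S C" "Map.graph ?Q = range (\<lambda>w. (S (S w), C (C w)))"
    using psa_cos_sin[OF psa] by blast
  have eq: "Map.graph T O adj (Map.graph T) = range (\<lambda>w. (S (S w), C (C w)))"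
    using SC(2) graph by simp
  have sv: "single_valued (Map.graph T O adj (Map.graph T))"
    unfolding graph[symmetric] by (rule single_valued_graph)
  obtain Z where Z: "bounded_linear Z" "\<And>w. norm (Z w) = norm (C w)" "Map.graph T = range (\<lambda>w. (S w, Z w))"
    using closed_relation_quotient[OF G single_valued_graph SC(1) eq sv] by blast
  show ?thesis
    using that[OF SC(1) eq _ _ Z] op_sqrt_quotient[OF pos SC] by (simp add: op_abs_def)
qed

lemma op_abs_pos: 
  fixes T :: "'a::chilbert_space operator"
  assumes T: "densely_defined T" "closed_op T" shows "pos_selfadjoint_op (op_abs T)"
  by (rule op_abs_quotient[OF T])

lemma op_abs_norm:
  fixes T :: "'a::chilbert_space operator"
  assumes T: "densely_defined T" "closed_op T"
  shows "(\<exists>u. (x, u) \<in> Map.graph T \<and> norm u = r) \<longleftrightarrow> (\<exists>p. (x, p) \<in> Map.graph (op_abs T) \<and> norm p = r)"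
proof -
  obtain S C Z where "cos_sin S C"
    "Map.graph T O adj (Map.graph T) = range (\<lambda>w. (S (S w), C (C w)))"
    and abs: "Map.graph (op_abs T) = range (\<lambda>w. (S w, C w))" and "pos_selfadjoint_op (op_abs T)"
    "bounded_linear Z" and norm: "\<And>w. norm (Z w) = norm (C w)"
    and graph: "Map.graph T = range (\<lambda>w. (S w, Z w))"
    by (rule op_abs_quotient[OF T]) (rule that)
  show ?thesis unfolding abs graph using norm by auto
qed

lemma op_diff_bounded:
  fixes T :: "'a::complex_inner operator"
  assumes T: "densely_defined T" "closed_op T" and f: "bounded_linear f" "\<And>c x. f (c *\<^sub>C x) = c *\<^sub>C f x"
    and B: "Map.graph B = range (\<lambda>x. (x, f x))"
  shows "densely_defined (T -\<^sub>o B)" "closed_op (T -\<^sub>o B)"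
    "(x, v) \<in> Map.graph (T -\<^sub>o B) \<longleftrightarrow> (x, v + f x) \<in> Map.graph T"
proof -
  interpret f: bounded_linear f by (rule f(1))
  have "(x, f x) \<in> Map.graph B" for x using B by blast
  then have Bf: "B x = Some (f x)" for x by (simp add: graph_iff)
  then have dom: "dom (T -\<^sub>o B) = dom T" by (auto simp: op_diff_def dom_def)
  have graph: "(x, v) \<in> Map.graph (T -\<^sub>o B) \<longleftrightarrow> (x, v + f x) \<in> Map.graph T" for x v
    by (auto simp: graph_iff op_diff_def Bf dom_def)
  then show "(x, v) \<in> Map.graph (T -\<^sub>o B) \<longleftrightarrow> (x, v + f x) \<in> Map.graph T" .
  have lin: "linear_op T" using T(1) by (simp add: densely_defined_def)
  then have sub: "subspace (Map.graph T)" and inv: "\<And>c. invariant (Map.graph T) (\<lambda>x. c *\<^sub>C x)"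
    by (simp_all add: linear_op_iff)
  have eq: "Map.graph (T -\<^sub>o B) = (\<lambda>p. (fst p, snd p + f (fst p))) -` Map.graph T"
    using graph by auto
  have "linear (\<lambda>p. (fst p, snd p + f (fst p)))"
    by (intro linearI) (simp_all add: f.add f.scaleR algebra_simps)
  from linear_subspace_vimage[OF this sub] have "subspace (Map.graph (T -\<^sub>o B))" by (simp add: eq)
  moreover have "invariant (Map.graph (T -\<^sub>o B)) (\<lambda>x. c *\<^sub>C x)" for c
    using inv[of c] by (simp add: invariant_def graph f(2) flip: scaleC_add_right)
  ultimately have lin': "linear_op (T -\<^sub>o B)" by (simp add: linear_op_iff)
  then show "densely_defined (T -\<^sub>o B)" using T(1) by (simp add: densely_defined_def dom)
  have "closed (Map.graph (T -\<^sub>o B))"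
    unfolding eq
    by (intro closed_vimage continuous_intros bounded_linear.continuous_on[OF f(1)])
      (use T(2) in \<open>simp add: closed_op_iff\<close>)
  then show "closed_op (T -\<^sub>o B)" using lin' by (simp add: closed_op_iff)
qed

text \<open>
  Operator monotonicity of the square root, in the form in which the order of the moduli is
  read off from a comparison of norms.
\<close>

lemma op_le_sqrtI:
  fixes K L :: "'a::chilbert_space operator"
  assumes K: "pos_selfadjoint_op K" and L: "pos_selfadjoint_op L"
    and dom: "\<And>x l. (x, l) \<in> Map.graph L \<Longrightarrow> \<exists>k. (x, k) \<in> Map.graph K \<and> norm k \<le> norm l"
  shows "K \<le>\<^sub>o L"
proof -
  obtain S C where SC: "cos_sin S C" "Map.graph L = range (\<lambda>w. (S (S w), C (C w)))"
    using psa_cos_sin[OF psa_graph_of_op(2)[OF L]] by blast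
  obtain S' C' where SC': "cos_sin S' C'" "Map.graph K = range (\<lambda>w. (S' (S' w), C' (C' w)))"
    using psa_cos_sin[OF psa_graph_of_op(2)[OF K]] by blast
  note sqrtL = op_sqrt_quotient[OF L SC] and sqrtK = op_sqrt_quotient[OF K SC']
  have KK: "Map.graph (op_sqrt K) O Map.graph (op_sqrt K) = Map.graph K"
    by (simp only: graph_map_comp[symmetric] sqrtK(3))
  have *: "\<exists>j. op_sqrt K x = Some j \<and> norm j \<le> norm m" if "op_sqrt L x = Some m" for x m
  proof -
    have "(x, m) \<in> range (\<lambda>w. (S w, C w))" using that sqrtL(2) by (simp add: graph_iff[symmetric])
    then obtain w where w: "x = S w" "m = C w" by auto
    have "\<exists>j. (S w, j) \<in> Map.graph (op_sqrt K) \<and> norm j \<le> norm (C w)"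
      by (rule heinz_sqrt[OF psa_graph_of_op(2)[OF sqrtK(1)] single_valued_graph KK SC(2,1) single_valued_graph dom])
    then show ?thesis by (simp add: w graph_iff)
  qed
  show ?thesis
    unfolding op_le_def using K L * by (fastforce simp: dom_def)
qed

lemma relcomp_graphs:
  "range (\<lambda>x. (x, f x)) O range (\<lambda>x. (x, g x)) = range (\<lambda>x. (x, g (f x)))"
proof (intro set_eqI iffI)
  fix p assume "p \<in> range (\<lambda>x. (x, g (f x)))"
  then obtain x where p: "p = (x, g (f x))" by blast
  have "(x, f x) \<in> range (\<lambda>x. (x, f x))" "(f x, g (f x)) \<in> range (\<lambda>x. (x, g x))" by blast+
  then show "p \<in> range (\<lambda>x. (x, f x)) O range (\<lambda>x. (x, g x))" unfolding p by (rule relcompI)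
qed auto

theorem corollary3p17:
  fixes A B :: "'a::chilbert_space operator"
  assumes "normal_op A"
    and "bounded_op B"
    and "hyponormal_op B"
    and "B \<circ>\<^sub>m A \<subseteq>\<^sub>m A \<circ>\<^sub>m B"
  shows "op_abs (op_abs A -\<^sub>o op_abs B) \<le>\<^sub>o op_abs (A -\<^sub>o B)"
proof -
  have A: "densely_defined A" "closed_op A" and AA: "A \<circ>\<^sub>m op_adjoint A = op_adjoint A \<circ>\<^sub>m A"
    using assms(1) by (simp_all add: normal_op_def)
  let ?G = "Map.graph A"
  obtain S C Z where SC: "cos_sin S C"
    and eq: "?G O adj ?G = range (\<lambda>w. (S (S w), C (C w)))"
    and absA: "Map.graph (op_abs A) = range (\<lambda>w. (S w, C w))" "pos_selfadjoint_op (op_abs A)"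
    and Z: "bounded_linear Z" "\<And>w. norm (Z w) = norm (C w)" "?G = range (\<lambda>w. (S w, Z w))"
    by (rule op_abs_quotient[OF A]) (rule that)
  have G: "closed ?G" "subspace ?G" using A(2) by (simp_all add: closed_op_iff linear_op_iff)
  have normal: "adj ?G O ?G = ?G O adj ?G"
    using arg_cong[OF AA, of Map.graph] by (simp add: graph_op_adjoint[OF A(1)])
  have B_lin: "linear_op B" and domB: "dom B = UNIV" using assms(2) by (simp_all add: bounded_op_def)
  have B_dd: "densely_defined B" using B_lin domB by (simp add: densely_defined_def)
  define b where "b x = the (B x)" for x
  have Bb: "B x = Some (b x)" for x using domB by (metis UNIV_I b_def domD option.sel)
  have graphB: "Map.graph B = range (\<lambda>x. (x, b x))" by (auto simp: Map.graph_def Bb)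
  have b_add: "b (x + y) = b x + b y" and b_scaleC: "b (c *\<^sub>C x) = c *\<^sub>C b x" for x y c
    using B_lin by (simp_all add: linear_op_def Bb)
  obtain M where M: "\<And>x. norm (b x) \<le> M * norm x" using assms(2) by (auto simp: bounded_op_def b_def)
  have b: "bounded_linear b"
    by (rule bounded_linear_intro[where K = M])
      (simp_all add: b_add b_scaleC scaleR_scaleC M mult.commute[of _ M])
  have B_closed: "closed_op B"
    using B_lin closed_graph_bounded_linear[OF b] by (simp add: closed_op_iff graphB)
  define b' where "b' x = the (op_adjoint B x)" for x
  have Bb': "op_adjoint B x = Some (b' x)" for x
    using assms(3) domB unfolding hyponormal_op_def b'_def by (metis UNIV_I domD option.sel subsetD)
  have b'_le: "norm (b' x) \<le> norm (b x)" for x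
    using assms(3) domB by (simp add: hyponormal_op_def b_def b'_def)
  have graphB': "adj (Map.graph B) = range (\<lambda>x. (x, b' x))"
    using graph_op_adjoint[OF B_dd] by (auto simp: Map.graph_def Bb')
  have adj_b: "b x \<bullet> y = x \<bullet> b' y" for x y
  proof -
    have "(y, b' y) \<in> adj (Map.graph B)" using graphB' by blast
    from adjD[OF this, of x "b x"] show ?thesis by (simp add: graphB)
  qed
  have b': "bounded_linear b'"
  proof (rule bounded_linear_intro[where K = M])
    have sub: "subspace (range (\<lambda>x. (x, b' x)))" using subspace_adj[of "Map.graph B"] graphB' by simp
    show "b' (x + y) = b' x + b' y" for x y
      using subspace_add[OF sub, of "(x, b' x)" "(y, b' y)"] by auto
    show "b' (r *\<^sub>R x) = r *\<^sub>R b' x" for r x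
      using subspace_mul[OF sub, of "(x, b' x)" r] by auto
    show "norm (b' x) \<le> norm x * M" for x
      using order_trans[OF b'_le M] by (simp add: mult.commute)
  qed
  have inv: "invariant ?G b"
    unfolding invariant_def
  proof (intro allI impI)
    fix x u assume "(x, u) \<in> ?G"
    then have "(B \<circ>\<^sub>m A) x = Some (b u)" by (simp add: graph_iff Bb)
    then have "(A \<circ>\<^sub>m B) x = Some (b u)" using assms(4) by (metis domI map_le_def)
    then show "(b x, b u) \<in> ?G" by (simp add: Bb graph_iff)
  qed
  have pos: "pos_map (\<lambda>x. b' (b x))"
    unfolding pos_map_def sym_map_def
    using bounded_linear_compose[OF b' b] adj_b by (metis inner_commute inner_ge_zero)
  obtain P where P: "pos_map P" "\<And>x. P (P x) = b' (b x)" "function_of (\<lambda>x. b' (b x)) P"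
    using pos_map_sqrt_exists[OF pos] by blast
  have P_norm: "norm (P x) = norm (b x)" for x
  proof -
    have "P x \<bullet> P x = b x \<bullet> b x" by (simp add: pos_map_inner[OF P(1)] P(2) adj_b)
    then show ?thesis by (simp add: norm_eq_sqrt_inner)
  qed
  have absB: "Map.graph (op_abs B) = range (\<lambda>x. (x, P x))" "pos_selfadjoint_op (op_abs B)"
  proof -
    obtain S' C' Y where SC': "cos_sin S' C'"
      "Map.graph B O adj (Map.graph B) = range (\<lambda>w. (S' (S' w), C' (C' w)))"
      "Map.graph (op_abs B) = range (\<lambda>w. (S' w, C' w))" "pos_selfadjoint_op (op_abs B)"
      and "bounded_linear Y" "\<And>w. norm (Y w) = norm (C' w)" "Map.graph B = range (\<lambda>w. (S' w, Y w))"
      by (rule op_abs_quotient[OF B_dd B_closed]) (rule that)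
    have "range (\<lambda>x. (x, P x)) O range (\<lambda>x. (x, P x)) = range (\<lambda>w. (S' (S' w), C' (C' w)))"
      unfolding SC'(2)[symmetric]
      by (simp only: graphB' relcomp_graphs P(2)) (simp only: graphB relcomp_graphs)
    moreover have "single_valued (range (\<lambda>x. (x, P x)))" by (auto simp: single_valued_def)
    ultimately have "range (\<lambda>x. (x, P x)) = range (\<lambda>w. (S' w, C' w))"
      using psa_sqrt_unique[OF psa_graph[OF P(1)] _ SC'(1)] by blast
    then show "Map.graph (op_abs B) = range (\<lambda>x. (x, P x))" using SC'(3) by simp
    show "pos_selfadjoint_op (op_abs B)" by (rule SC'(4))
  qed
  have P_scaleC: "P (c *\<^sub>C x) = c *\<^sub>C P x" for c x
  proof -
    have "(c *\<^sub>C x, c *\<^sub>C P x) \<in> range (\<lambda>x. (x, P x))"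
      using psa_graph_of_op(3)[OF absB(2), of c] unfolding absB(1) by (simp add: invariant_def)
    then show ?thesis by auto
  qed
  have absA': "densely_defined (op_abs A)" "closed_op (op_abs A)"
    using psa_graph_of_op[OF absA(2)] psa_closed
    by (auto simp: closed_op_iff densely_defined_def)
  note X = op_diff_bounded[OF absA' pos_map_linear[OF P(1)] P_scaleC absB(1)]
  note Y = op_diff_bounded[OF A b b_scaleC graphB]
  show ?thesis
  proof (rule op_le_sqrtI[OF op_abs_pos[OF X(1,2)] op_abs_pos[OF Y(1,2)]])
    fix x l assume "(x, l) \<in> Map.graph (op_abs (A -\<^sub>o B))"
    then obtain v where v: "(x, v) \<in> Map.graph (A -\<^sub>o B)" "norm v = norm l"
      using op_abs_norm[OF Y(1,2), of x "norm l"] by blast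
    then have "(x, v + b x) \<in> ?G" by (simp add: Y(3))
    then obtain w where w: "x = S w" "v + b x = Z w" using Z(3) by auto
    have "(x, C w - P x) \<in> Map.graph (op_abs A -\<^sub>o op_abs B)" by (simp add: X(3) absA(1) w)
    then obtain k where k: "(x, k) \<in> Map.graph (op_abs (op_abs A -\<^sub>o op_abs B))" "norm k = norm (C w - P x)"
      using op_abs_norm[OF X(1,2), of x "norm (C w - P x)"] by blast
    have "norm (C w - P x) \<le> norm (Z w - b x)"
    proof (rule abs_diff_norm_le)
      show "Z w \<bullet> b x \<le> C w \<bullet> P x"
        unfolding w(1)
        by (rule abs_form_inequality[OF G single_valued_graph single_valued_adj[OF A(1)] SC eq normal
              Z b inv b' adj_b b'_le P])
    qed (simp_all add: Z(2) P_norm)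
    also have "Z w - b x = v" by (simp add: w(2)[symmetric])
    finally have "norm k \<le> norm l" using k(2) v(2) by simp
    then show "\<exists>k. (x, k) \<in> Map.graph (op_abs (op_abs A -\<^sub>o op_abs B)) \<and> norm k \<le> norm l"
      using k(1) by blast
  qed
qed

end
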